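(* Let $A$ be a ring, let $\mathfrak{C}$ be an $A$-coring, and let $g\in\mathfrak{C}$ be a grouplike element. Assume that $\mathfrak{C}$ is a simple semisimple $A$-coring. Then $A^{co\mathfrak{C}}=\{a\in A: ag=ga\}$ is a simple artinian ring, and the canonical $A$-bimodule map $A\otimes_{A^{co\mathfrak{C}}}A\to\mathfrak{C}$ which sends $1\otimes_{A^{co\mathfrak{C}}}1$ to $g$ is an isomorphism of $A$-corings.
   Context: Rings are associative unital algebras over a commutative ring $K$. An $A$-coring is an $A$-bimodule $\mathfrak{C}$ with $A$-bimodule maps $\Delta:\mathfrak{C}\to\mathfrak{C}\otimes_A\mathfrak{C}$ (coassociative) and $\epsilon:\mathfrak{C}\to A$ (counit: $(\mathfrak{C}\otimes_A\epsilon)\Delta$ and $(\epsilon\otimes_A\mathfrak{C})\Delta$ are the canonical isomorphisms). A left $\mathfrak{C}$-comodule is a left $A$-module $M$ with a left $A$-linear map $\lambda_M:M\to\mathfrak{C}\otimes_A M$ such that $(\Delta\otimes_A M)\lambda_M=(\mathfrak{C}\otimes_A\lambda_M)\lambda_M$ and $(\epsilon\otimes_A M)\lambda_M$ is the canonical isomorphism; right comodules are defined symmetrically. $\mathfrak{C}$ is a left and right comodule over itself via $\Delta$. ${}_A\mathfrak{C}$ and $\mathfrak{C}_A$ denote $\mathfrak{C}$ as a left and right $A$-module. When $\mathfrak{C}_A$ is flat, a subcomodule of a left comodule $M$ is an $A$-submodule $N$ with $\lambda_M(N)\subseteq\mathfrak{C}\otimes_A N$ (symmetrically on the right when ${}_A\mathfrak{C}$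 is flat). A comodule is simple if it is nonzero with no subcomodules other than $0$ and itself, and semisimple if it is a direct sum of simple subcomodules. The coring $\mathfrak{C}$ is semisimple if $\mathfrak{C}_A$ is flat and $\mathfrak{C}$ is semisimple as a left comodule over itself; equivalently, ${}_A\mathfrak{C}$ is flat and $\mathfrak{C}$ is semisimple as a right comodule over itself; equivalently, all left and all right comodules are semisimple and ${}_A\mathfrak{C}$, $\mathfrak{C}_A$ are projective. A semisimple coring is simple if its only $A$-sub-bimodules that are both left and right subcomodules of $\mathfrak{C}$ are $0$ and $\mathfrak{C}$; "simple semisimple" means simple and semisimple. A grouplike element is a nonzero $g\in\mathfrak{C}$ with $\epsilon(g)=1$ and $\Delta(g)=g\otimes_A g$. For a ring extension $B\to A$, $A\otimes_B A$ is an $A$-coring with comultiplication $a\otimes_B a'\mapsto (a\otimes_B 1)\otimes_A(1\otimes_B a')$ and counit the multiplication map. *)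

theory Defs
  imports "HOL-Algebra.Free_Abelian_Groups" "HOL-Algebra.Module" "HOL-Algebra.Ideal"
begin

section \<open>Algebras, modules and bimodules\<close>

text \<open>A \<open>K\<close>-algebra \<open>A\<close> is a ring with a structure map \<open>\<eta>\<close> from the commutative ring
  \<open>K\<close> to the centre of \<open>A\<close>; neither ring is assumed to be nonzero.\<close>

locale K_algebra = K?: cring K + A?: ring A
  for K :: "('k, 'y) ring_scheme" (structure) and A :: "('a, 'z) ring_scheme" (structure) +
  fixes \<eta> :: "'k \<Rightarrow> 'a"
  assumes structure_hom: "\<eta> \<in> ring_hom K A"
    and structure_central:
      "\<lbrakk>k \<in> carrier K; a \<in> carrier A\<rbrakk> \<Longrightarrow> \<eta> k \<otimes>\<^bsub>A\<^esub> a = a \<otimes>\<^bsub>A\<^esub> \<eta> k"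

text \<open>As in \<^typ>\<open>('a, 'b) module\<close>, the fields \<^const>\<open>monoid.mult\<close> and \<^const>\<open>monoid.one\<close> inherited
  from the ring record carry no information. A right module is a \<open>bimod\<close> whose left action is
  ignored.\<close>

record ('a, 'm) bimod = "('a, 'm) module" +
  rsmult :: "'m \<Rightarrow> 'a \<Rightarrow> 'm" (infixl \<open>\<triangleleft>\<index>\<close> 70)

locale left_module = R?: ring R + M?: abelian_group M
  for R :: "('a, 'z) ring_scheme" (structure) and M :: "('a, 'm, 'x) module_scheme" (structure) +
  assumes smult_closed: "\<lbrakk>r \<in> carrier R; m \<in> carrier M\<rbrakk> \<Longrightarrow> r \<odot>\<^bsub>M\<^esub> m \<in> carrier M"
    and smult_l_distr: "\<lbrakk>r \<in> carrier R; s \<in> carrier R; m \<in> carrier M\<rbrakk> \<Longrightarrow>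
      (r \<oplus>\<^bsub>R\<^esub> s) \<odot>\<^bsub>M\<^esub> m = (r \<odot>\<^bsub>M\<^esub> m) \<oplus>\<^bsub>M\<^esub> (s \<odot>\<^bsub>M\<^esub> m)"
    and smult_r_distr: "\<lbrakk>r \<in> carrier R; m \<in> carrier M; n \<in> carrier M\<rbrakk> \<Longrightarrow>
      r \<odot>\<^bsub>M\<^esub> (m \<oplus>\<^bsub>M\<^esub> n) = (r \<odot>\<^bsub>M\<^esub> m) \<oplus>\<^bsub>M\<^esub> (r \<odot>\<^bsub>M\<^esub> n)"
    and smult_assoc: "\<lbrakk>r \<in> carrier R; s \<in> carrier R; m \<in> carrier M\<rbrakk> \<Longrightarrow>
      (r \<otimes>\<^bsub>R\<^esub> s) \<odot>\<^bsub>M\<^esub> m = r \<odot>\<^bsub>M\<^esub> (s \<odot>\<^bsub>M\<^esub> m)"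
    and smult_one: "m \<in> carrier M \<Longrightarrow> \<one>\<^bsub>R\<^esub> \<odot>\<^bsub>M\<^esub> m = m"

locale right_module = R?: ring R + M?: abelian_group M
  for R :: "('a, 'z) ring_scheme" (structure) and M :: "('a, 'm, 'x) bimod_scheme" (structure) +
  assumes rsmult_closed: "\<lbrakk>r \<in> carrier R; m \<in> carrier M\<rbrakk> \<Longrightarrow> m \<triangleleft>\<^bsub>M\<^esub> r \<in> carrier M"
    and rsmult_r_distr: "\<lbrakk>r \<in> carrier R; s \<in> carrier R; m \<in> carrier M\<rbrakk> \<Longrightarrow>
      m \<triangleleft>\<^bsub>M\<^esub> (r \<oplus>\<^bsub>R\<^esub> s) = (m \<triangleleft>\<^bsub>M\<^esub> r) \<oplus>\<^bsub>M\<^esub> (m \<triangleleft>\<^bsub>M\<^esub> s)"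
    and rsmult_l_distr: "\<lbrakk>r \<in> carrier R; m \<in> carrier M; n \<in> carrier M\<rbrakk> \<Longrightarrow>
      (m \<oplus>\<^bsub>M\<^esub> n) \<triangleleft>\<^bsub>M\<^esub> r = (m \<triangleleft>\<^bsub>M\<^esub> r) \<oplus>\<^bsub>M\<^esub> (n \<triangleleft>\<^bsub>M\<^esub> r)"
    and rsmult_assoc: "\<lbrakk>r \<in> carrier R; s \<in> carrier R; m \<in> carrier M\<rbrakk> \<Longrightarrow>
      m \<triangleleft>\<^bsub>M\<^esub> (r \<otimes>\<^bsub>R\<^esub> s) = (m \<triangleleft>\<^bsub>M\<^esub> r) \<triangleleft>\<^bsub>M\<^esub> s"
    and rsmult_one: "m \<in> carrier M \<Longrightarrow> m \<triangleleft>\<^bsub>M\<^esub> \<one>\<^bsub>R\<^esub> = m"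

text \<open>Bimodules over a \<open>K\<close>-algebra: the two induced actions of \<open>K\<close> agree.\<close>

locale bimodule = K_algebra K A \<eta> + left_module A M + right_module A M
  for K :: "('k, 'y) ring_scheme" (structure) and A :: "('a, 'z) ring_scheme" (structure)
    and \<eta> :: "'k \<Rightarrow> 'a" and M :: "('a, 'm, 'x) bimod_scheme" (structure) +
  assumes smult_rsmult_assoc: "\<lbrakk>a \<in> carrier A; b \<in> carrier A; m \<in> carrier M\<rbrakk> \<Longrightarrow>
      (a \<odot>\<^bsub>M\<^esub> m) \<triangleleft>\<^bsub>M\<^esub> b = a \<odot>\<^bsub>M\<^esub> (m \<triangleleft>\<^bsub>M\<^esub> b)"
    and scalar_symmetric: "\<lbrakk>k \<in> carrier K; m \<in> carrier M\<rbrakk> \<Longrightarrow> \<eta> k \<odot>\<^bsub>M\<^esub> m = m \<triangleleft>\<^bsub>M\<^esub> \<eta> k"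

definition left_module_hom ::
    "('a, 'z) ring_scheme \<Rightarrow> ('a, 'm, 'x) module_scheme \<Rightarrow> ('a, 'n, 'w) module_scheme \<Rightarrow> ('m \<Rightarrow> 'n) set"
  where "left_module_hom R M N = {f \<in> hom (add_monoid M) (add_monoid N).
    \<forall>r\<in>carrier R. \<forall>m\<in>carrier M. f (r \<odot>\<^bsub>M\<^esub> m) = r \<odot>\<^bsub>N\<^esub> f m}"

definition bimodule_hom ::
    "('a, 'z) ring_scheme \<Rightarrow> ('a, 'm, 'x) bimod_scheme \<Rightarrow> ('a, 'n, 'w) bimod_scheme \<Rightarrow> ('m \<Rightarrow> 'n) set"
  where "bimodule_hom R M N = {f \<in> left_module_hom R M N.
    \<forall>r\<in>carrier R. \<forall>m\<in>carrier M. f (m \<triangleleft>\<^bsub>M\<^esub> r) = f m \<triangleleft>\<^bsub>N\<^esub> r}"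

definition regular_bimodule :: "('a, 'z) ring_scheme \<Rightarrow> ('a, 'a) bimod"
  where "regular_bimodule A =
    \<lparr>carrier = carrier A, monoid.mult = monoid.mult A, monoid.one = \<one>\<^bsub>A\<^esub>,
     ring.zero = \<zero>\<^bsub>A\<^esub>, ring.add = ring.add A, smult = monoid.mult A, rsmult = monoid.mult A\<rparr>"


section \<open>Tensor products over a noncommutative ring\<close>

text \<open>\<open>M \<otimes>\<^sub>R N\<close> is the free abelian group on \<open>M \<times> N\<close> modulo biadditivity and
  \<open>R\<close>-balancedness. The quotient is a multiplicatively written group in the library; it is
  repackaged with its operation in the \<^const>\<open>ring.add\<close> slot.\<close>

definition tensor_relations ::
    "('a, 'z) ring_scheme \<Rightarrow> ('a, 'm, 'x) bimod_scheme \<Rightarrow> ('a, 'n, 'w) module_scheme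
      \<Rightarrow> ('m \<times> 'n \<Rightarrow>\<^sub>0 int) set"
  where "tensor_relations R M N =
    {frag_of (m \<oplus>\<^bsub>M\<^esub> m', n) - frag_of (m, n) - frag_of (m', n) | m m' n.
        m \<in> carrier M \<and> m' \<in> carrier M \<and> n \<in> carrier N}
    \<union> {frag_of (m, n \<oplus>\<^bsub>N\<^esub> n') - frag_of (m, n) - frag_of (m, n') | m n n'.
        m \<in> carrier M \<and> n \<in> carrier N \<and> n' \<in> carrier N}
    \<union> {frag_of (m \<triangleleft>\<^bsub>M\<^esub> r, n) - frag_of (m, r \<odot>\<^bsub>N\<^esub> n) | m r n.
        m \<in> carrier M \<and> r \<in> carrier R \<and> n \<in> carrier N}"

definition tensor_kernel ::
    "('a, 'z) ring_scheme \<Rightarrow> ('a, 'm, 'x) bimod_scheme \<Rightarrow> ('a, 'n, 'w) module_scheme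
      \<Rightarrow> ('m \<times> 'n \<Rightarrow>\<^sub>0 int) set"
  where "tensor_kernel R M N =
    generate (free_Abelian_group (carrier M \<times> carrier N)) (tensor_relations R M N)"

definition tensor_group ::
    "('a, 'z) ring_scheme \<Rightarrow> ('a, 'm, 'x) bimod_scheme \<Rightarrow> ('a, 'n, 'w) module_scheme
      \<Rightarrow> ('m \<times> 'n \<Rightarrow>\<^sub>0 int) set ring"
  where "tensor_group R M N =
    (let Q = free_Abelian_group (carrier M \<times> carrier N) Mod tensor_kernel R M N
     in \<lparr>carrier = carrier Q, monoid.mult = undefined, monoid.one = undefined,
         ring.zero = \<one>\<^bsub>Q\<^esub>, ring.add = monoid.mult Q\<rparr>)"

definition tens ::
    "('a, 'z) ring_scheme \<Rightarrow> ('a, 'm, 'x) bimod_scheme \<Rightarrow> ('a, 'n, 'w) module_scheme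
      \<Rightarrow> 'm \<Rightarrow> 'n \<Rightarrow> ('m \<times> 'n \<Rightarrow>\<^sub>0 int) set"
  where "tens R M N m n =
    tensor_kernel R M N #>\<^bsub>free_Abelian_group (carrier M \<times> carrier N)\<^esub> frag_of (m, n)"

text \<open>The additive map \<open>M \<otimes>\<^sub>R N \<rightarrow> G\<close> with \<open>m \<otimes> n \<mapsto> \<beta> m n\<close>; it is meaningful (the image below
  is a singleton) only for biadditive \<open>R\<close>-balanced \<open>\<beta>\<close>.\<close>

definition tensor_lift ::
    "('g, 'z) ring_scheme \<Rightarrow> ('m \<Rightarrow> 'n \<Rightarrow> 'g) \<Rightarrow> ('m \<times> 'n \<Rightarrow>\<^sub>0 int) set \<Rightarrow> 'g"
  where "tensor_lift G \<beta> t =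
    the_elem ((\<lambda>x. \<Oplus>\<^bsub>G\<^esub>p\<in>Poly_Mapping.keys x. add_pow G (Poly_Mapping.lookup x p) (\<beta> (fst p) (snd p))) ` t)"

text \<open>The actions on \<open>M \<otimes>\<^sub>R N\<close> come from the left action on \<open>M\<close> and the right action on \<open>N\<close>.
  They are not restricted to \<open>R\<close>: for \<open>R\<close> a subring of \<open>A\<close> and \<open>M = N = A\<close> one gets an
  \<open>A\<close>-bimodule.\<close>

definition tensor ::
    "('a, 'z) ring_scheme \<Rightarrow> ('a, 'm, 'x) bimod_scheme \<Rightarrow> ('a, 'n, 'w) bimod_scheme
      \<Rightarrow> ('a, ('m \<times> 'n \<Rightarrow>\<^sub>0 int) set) bimod"
  where "tensor R M N = ring.extend (tensor_group R M N)
    \<lparr>smult = (\<lambda>a. tensor_lift (tensor_group R M N) (\<lambda>m n. tens R M N (a \<odot>\<^bsub>M\<^esub> m) n)),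
     rsmult = (\<lambda>t a. tensor_lift (tensor_group R M N) (\<lambda>m n. tens R M N m (n \<triangleleft>\<^bsub>N\<^esub> a)) t)\<rparr>"

text \<open>\<open>f \<otimes>\<^sub>R g\<close>, with target \<open>M \<otimes>\<^sub>R N\<close>.\<close>

definition tensor_map ::
    "('a, 'z) ring_scheme \<Rightarrow> ('a, 'm, 'x) bimod_scheme \<Rightarrow> ('a, 'n, 'w) module_scheme
      \<Rightarrow> ('p \<Rightarrow> 'm) \<Rightarrow> ('q \<Rightarrow> 'n) \<Rightarrow> ('p \<times> 'q \<Rightarrow>\<^sub>0 int) set \<Rightarrow> ('m \<times> 'n \<Rightarrow>\<^sub>0 int) set"
  where "tensor_map R M N f g = tensor_lift (tensor_group R M N) (\<lambda>p q. tens R M N (f p) (g q))"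

text \<open>The associativity isomorphism \<open>(L \<otimes>\<^sub>R M) \<otimes>\<^sub>R N \<rightarrow> L \<otimes>\<^sub>R (M \<otimes>\<^sub>R N)\<close>.\<close>

definition tensor_assoc ::
    "('a, 'z) ring_scheme \<Rightarrow> ('a, 'l, 'v) bimod_scheme \<Rightarrow> ('a, 'm, 'x) bimod_scheme
      \<Rightarrow> ('a, 'n, 'w) bimod_scheme
      \<Rightarrow> (('l \<times> 'm \<Rightarrow>\<^sub>0 int) set \<times> 'n \<Rightarrow>\<^sub>0 int) set
      \<Rightarrow> ('l \<times> ('m \<times> 'n \<Rightarrow>\<^sub>0 int) set \<Rightarrow>\<^sub>0 int) set"
  where "tensor_assoc R L M N =
    (let T = tensor R L (tensor R M N)
     in tensor_lift T (\<lambda>t n. tensor_lift T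
          (\<lambda>l m. tens R L (tensor R M N) l (tens R M N m n)) t))"


section \<open>Corings\<close>

record ('a, 'c) coring_struct = "('a, 'c) bimod" +
  comult :: "'c \<Rightarrow> ('c \<times> 'c \<Rightarrow>\<^sub>0 int) set"
  counit :: "'c \<Rightarrow> 'a"

locale coring = bimodule K A \<eta> C
  for K :: "('k, 'y) ring_scheme" (structure) and A :: "('a, 'z) ring_scheme" (structure)
    and \<eta> :: "'k \<Rightarrow> 'a" and C :: "('a, 'c, 'x) coring_struct_scheme" (structure) +
  assumes comult_hom: "comult C \<in> bimodule_hom A C (tensor A C C)"
    and counit_hom: "counit C \<in> bimodule_hom A C (regular_bimodule A)"
    and coassoc: "c \<in> carrier C \<Longrightarrow>
      tensor_assoc A C C C (tensor_map A (tensor A C C) C (comult C) id (comult C c))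
        = tensor_map A C (tensor A C C) id (comult C) (comult C c)"
    and counit_left: "c \<in> carrier C \<Longrightarrow>
      tensor_map A (regular_bimodule A) C (counit C) id (comult C c)
        = tens A (regular_bimodule A) C \<one>\<^bsub>A\<^esub> c"
    and counit_right: "c \<in> carrier C \<Longrightarrow>
      tensor_map A C (regular_bimodule A) id (counit C) (comult C c)
        = tens A C (regular_bimodule A) c \<one>\<^bsub>A\<^esub>"

definition coring_iso ::
    "('k, 'y) ring_scheme \<Rightarrow> ('a, 'z) ring_scheme \<Rightarrow> ('k \<Rightarrow> 'a)
      \<Rightarrow> ('a, 'c, 'x) coring_struct_scheme \<Rightarrow> ('a, 'd, 'w) coring_struct_scheme
      \<Rightarrow> ('c \<Rightarrow> 'd) \<Rightarrow> bool"
  where "coring_iso K A \<eta> C D f \<longleftrightarrow>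
    coring K A \<eta> C \<and> coring K A \<eta> D \<and>
    f \<in> bimodule_hom A C D \<and> bij_betw f (carrier C) (carrier D) \<and>
    (\<forall>c\<in>carrier C. comult D (f c) = tensor_map A D D f f (comult C c)) \<and>
    (\<forall>c\<in>carrier C. counit D (f c) = counit C c)"

definition grouplike ::
    "('a, 'z) ring_scheme \<Rightarrow> ('a, 'c, 'x) coring_struct_scheme \<Rightarrow> 'c \<Rightarrow> bool"
  where "grouplike A C g \<longleftrightarrow>
    g \<in> carrier C \<and> g \<noteq> \<zero>\<^bsub>C\<^esub> \<and> counit C g = \<one>\<^bsub>A\<^esub> \<and> comult C g = tens A C C g g"

definition coinvariants ::
    "('a, 'z) ring_scheme \<Rightarrow> ('a, 'c, 'x) coring_struct_scheme \<Rightarrow> 'c \<Rightarrow> 'a set"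
  where "coinvariants A C g = {a \<in> carrier A. a \<odot>\<^bsub>C\<^esub> g = g \<triangleleft>\<^bsub>C\<^esub> a}"

text \<open>The coring \<open>A \<otimes>\<^sub>B A\<close> of a subring \<open>B\<close> of \<open>A\<close>.\<close>

definition sweedler_bimodule ::
    "('a, 'z) ring_scheme \<Rightarrow> 'a set \<Rightarrow> ('a, ('a \<times> 'a \<Rightarrow>\<^sub>0 int) set) bimod"
  where "sweedler_bimodule A B =
    tensor (A\<lparr>carrier := B\<rparr>) (regular_bimodule A) (regular_bimodule A)"

definition sweedler_tens ::
    "('a, 'z) ring_scheme \<Rightarrow> 'a set \<Rightarrow> 'a \<Rightarrow> 'a \<Rightarrow> ('a \<times> 'a \<Rightarrow>\<^sub>0 int) set"
  where "sweedler_tens A B = tens (A\<lparr>carrier := B\<rparr>) (regular_bimodule A) (regular_bimodule A)"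

definition sweedler_coring ::
    "('a, 'z) ring_scheme \<Rightarrow> 'a set \<Rightarrow> ('a, ('a \<times> 'a \<Rightarrow>\<^sub>0 int) set) coring_struct"
  where "sweedler_coring A B =
    (let T = sweedler_bimodule A B
     in bimod.extend T
      \<lparr>comult = tensor_lift (tensor A T T)
         (\<lambda>a a'. tens A T T (sweedler_tens A B a \<one>\<^bsub>A\<^esub>) (sweedler_tens A B \<one>\<^bsub>A\<^esub> a')),
       counit = tensor_lift A (monoid.mult A)\<rparr>)"

text \<open>The canonical map \<open>a \<otimes> a' \<mapsto> a g a'\<close>.\<close>

definition canonical_map :: "('a, 'c, 'x) coring_struct_scheme \<Rightarrow> 'c \<Rightarrow> ('a \<times> 'a \<Rightarrow>\<^sub>0 int) set \<Rightarrow> 'c"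
  where "canonical_map C g = tensor_lift C (\<lambda>a a'. (a \<odot>\<^bsub>C\<^esub> g) \<triangleleft>\<^bsub>C\<^esub> a')"


section \<open>Flatness, semisimplicity, simplicity\<close>

text \<open>A right module \<open>M\<close> is flat if \<open>M \<otimes>\<^sub>R -\<close> preserves injectivity of homomorphisms of left
  modules. HOL cannot quantify over all types inside a definition, so the test modules have their
  carriers in a type \<open>'u\<close> given as a parameter. Testing inclusions of left ideals of \<open>R\<close> already
  characterizes flatness, so the notion is the usual one, and does not depend on \<open>'u\<close>, as soon as
  the elements of \<open>R\<close> inject into \<open>'u\<close>.\<close>

definition flat_right_module ::
    "'u itself \<Rightarrow> ('a, 'z) ring_scheme \<Rightarrow> ('a, 'm, 'x) bimod_scheme \<Rightarrow> bool"
  where "flat_right_module U R M \<longleftrightarrow> right_module R M \<and>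
    (\<forall>(N :: ('a, 'u) module) (N' :: ('a, 'u) module) f.
       left_module R N \<and> left_module R N' \<and> f \<in> left_module_hom R N N' \<and> inj_on f (carrier N) \<longrightarrow>
       inj_on (tensor_map R M N' id f) (carrier (tensor_group R M N)))"

text \<open>\<open>M\<close> is a left comodule with coaction \<open>\<rho> : M \<rightarrow> C \<otimes>\<^sub>A M\<close>, and \<open>C\<close> is meant to be flat as a
  right module, so that \<open>C \<otimes>\<^sub>A N\<close> is identified with its image in \<open>C \<otimes>\<^sub>A M\<close>. Symmetrically
  below. For the same reason the subcomodules of a subcomodule \<open>S\<close> of \<open>M\<close> are the subcomodules of
  \<open>M\<close> contained in \<open>S\<close>.\<close>

definition left_subcomodule ::
    "('a, 'z) ring_scheme \<Rightarrow> ('a, 'c, 'x) coring_struct_scheme \<Rightarrow> ('a, 'm, 'w) module_scheme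
      \<Rightarrow> ('m \<Rightarrow> ('c \<times> 'm \<Rightarrow>\<^sub>0 int) set) \<Rightarrow> 'm set \<Rightarrow> bool"
  where "left_subcomodule A C M \<rho> N \<longleftrightarrow>
    additive_subgroup N M \<and> (\<forall>a\<in>carrier A. \<forall>n\<in>N. a \<odot>\<^bsub>M\<^esub> n \<in> N) \<and>
    \<rho> ` N \<subseteq> tensor_map A C M id id ` carrier (tensor_group A C (M\<lparr>carrier := N\<rparr>))"

definition right_subcomodule ::
    "('a, 'z) ring_scheme \<Rightarrow> ('a, 'c, 'x) coring_struct_scheme \<Rightarrow> ('a, 'm, 'w) bimod_scheme
      \<Rightarrow> ('m \<Rightarrow> ('m \<times> 'c \<Rightarrow>\<^sub>0 int) set) \<Rightarrow> 'm set \<Rightarrow> bool"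
  where "right_subcomodule A C M \<rho> N \<longleftrightarrow>
    additive_subgroup N M \<and> (\<forall>a\<in>carrier A. \<forall>n\<in>N. n \<triangleleft>\<^bsub>M\<^esub> a \<in> N) \<and>
    \<rho> ` N \<subseteq> tensor_map A M C id id ` carrier (tensor_group A (M\<lparr>carrier := N\<rparr>) C)"

definition simple_left_subcomodule ::
    "('a, 'z) ring_scheme \<Rightarrow> ('a, 'c, 'x) coring_struct_scheme \<Rightarrow> ('a, 'm, 'w) module_scheme
      \<Rightarrow> ('m \<Rightarrow> ('c \<times> 'm \<Rightarrow>\<^sub>0 int) set) \<Rightarrow> 'm set \<Rightarrow> bool"
  where "simple_left_subcomodule A C M \<rho> S \<longleftrightarrow>
    left_subcomodule A C M \<rho> S \<and> S \<noteq> {\<zero>\<^bsub>M\<^esub>} \<and>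
    (\<forall>N. left_subcomodule A C M \<rho> N \<and> N \<subseteq> S \<longrightarrow> N = {\<zero>\<^bsub>M\<^esub>} \<or> N = S)"

text \<open>\<open>M\<close> is the internal direct sum of the members of \<open>\<S>\<close>: summation is an isomorphism from the
  external direct sum. A set of submodules suffices as index, because nonzero summands of a direct
  sum are pairwise distinct.\<close>

definition internal_direct_sum :: "('m, 'x) ring_scheme \<Rightarrow> 'm set set \<Rightarrow> bool"
  where "internal_direct_sum M \<S> \<longleftrightarrow>
    (\<lambda>x. \<Oplus>\<^bsub>M\<^esub>S\<in>{S \<in> \<S>. x S \<noteq> \<zero>\<^bsub>M\<^esub>}. x S)
      \<in> iso (sum_group \<S> (\<lambda>S. add_monoid (M\<lparr>carrier := S\<rparr>))) (add_monoid M)"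

definition semisimple_left_comodule ::
    "('a, 'z) ring_scheme \<Rightarrow> ('a, 'c, 'x) coring_struct_scheme \<Rightarrow> ('a, 'm, 'w) module_scheme
      \<Rightarrow> ('m \<Rightarrow> ('c \<times> 'm \<Rightarrow>\<^sub>0 int) set) \<Rightarrow> bool"
  where "semisimple_left_comodule A C M \<rho> \<longleftrightarrow>
    (\<exists>\<S>. (\<forall>S\<in>\<S>. simple_left_subcomodule A C M \<rho> S) \<and> internal_direct_sum M \<S>)"

text \<open>The type of test modules for flatness contains, up to isomorphism, every left \<open>A\<close>-module
  with a generating set no larger than the disjoint union of \<open>\<nat>\<close>, \<open>'a\<close> and \<open>'c\<close>, represented as
  a quotient of a free module.\<close>

definition semisimple_coring ::
    "('k, 'y) ring_scheme \<Rightarrow> ('a, 'z) ring_scheme \<Rightarrow> ('k \<Rightarrow> 'a)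
      \<Rightarrow> ('a, 'c, 'x) coring_struct_scheme \<Rightarrow> bool"
  where "semisimple_coring K A \<eta> C \<longleftrightarrow>
    coring K A \<eta> C \<and> flat_right_module TYPE((nat + 'a + 'c) list set) A C \<and>
    semisimple_left_comodule A C C (comult C)"

definition simple_semisimple_coring ::
    "('k, 'y) ring_scheme \<Rightarrow> ('a, 'z) ring_scheme \<Rightarrow> ('k \<Rightarrow> 'a)
      \<Rightarrow> ('a, 'c, 'x) coring_struct_scheme \<Rightarrow> bool"
  where "simple_semisimple_coring K A \<eta> C \<longleftrightarrow>
    semisimple_coring K A \<eta> C \<and>
    (\<forall>N. left_subcomodule A C C (comult C) N \<and> right_subcomodule A C C (comult C) N \<longrightarrow>
      N = {\<zero>\<^bsub>C\<^esub>} \<or> N = carrier C)"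


section \<open>Simple artinian rings\<close>

definition left_ideal :: "'a set \<Rightarrow> ('a, 'z) ring_scheme \<Rightarrow> bool"
  where "left_ideal I R \<longleftrightarrow>
    additive_subgroup I R \<and> (\<forall>r\<in>carrier R. \<forall>x\<in>I. r \<otimes>\<^bsub>R\<^esub> x \<in> I)"

definition right_ideal :: "'a set \<Rightarrow> ('a, 'z) ring_scheme \<Rightarrow> bool"
  where "right_ideal I R \<longleftrightarrow>
    additive_subgroup I R \<and> (\<forall>r\<in>carrier R. \<forall>x\<in>I. x \<otimes>\<^bsub>R\<^esub> r \<in> I)"

definition artinian_ring :: "('a, 'z) ring_scheme \<Rightarrow> bool"
  where "artinian_ring R \<longleftrightarrow> ring R \<and>
    (\<forall>I :: nat \<Rightarrow> 'a set. (\<forall>n. left_ideal (I n) R \<and> I (Suc n) \<subseteq> I n) \<longrightarrow>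
      (\<exists>n. \<forall>m\<ge>n. I m = I n)) \<and>
    (\<forall>I :: nat \<Rightarrow> 'a set. (\<forall>n. right_ideal (I n) R \<and> I (Suc n) \<subseteq> I n) \<longrightarrow>
      (\<exists>n. \<forall>m\<ge>n. I m = I n))"

definition simple_ring :: "('a, 'z) ring_scheme \<Rightarrow> bool"
  where "simple_ring R \<longleftrightarrow> ring R \<and> \<one>\<^bsub>R\<^esub> \<noteq> \<zero>\<^bsub>R\<^esub> \<and>
    (\<forall>I. ideal I R \<longrightarrow> I = {\<zero>\<^bsub>R\<^esub>} \<or> I = carrier R)"

end

theory Submission
  imports Defs "HOL-Algebra.Subrings"
begin

text \<open>Since \<open>A g A\<close> is a nonzero subbicomodule, \<open>C = A g A\<close>, so that the left comodule
  \<open>C\<close> is a sum of images of \<open>A \<cong> A g\<close>, whose colinear endomorphisms are the right multiplications by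
  \<open>B = A\<^sup>c\<^sup>o\<^sup>C\<close>. Colinear maps send coinvariants \<open>g x\<close> to coinvariants, and every subcomodule is a direct
  summand. Splitting \<open>A g x\<^sub>1 + \<dots> + A g x\<^sub>n\<close> one summand at a time yields additive coefficient maps which,
  on elements \<open>g y\<close>, take values in \<open>B\<close>. This shows at once that the kernel of \<open>A \<otimes>\<^sub>B A \<rightarrow> C\<close> is zero
  and that a left \<open>B\<close>-submodule \<open>X\<close> of \<open>A\<close> is recovered from the subcomodule \<open>A g X\<close>. Taking for \<open>X\<close>
  a left ideal of \<open>B\<close>, the projection onto the summand \<open>A g X\<close> of \<open>A g\<close> provides an idempotent generator,
  so \<open>B\<close> is artinian; for a two-sided ideal the same correspondence leads to a subbicomodule of \<open>C\<close>, so
  \<open>B\<close> is simple.\<close>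

section \<open>Tensor products\<close>

text \<open>Flatness of \<open>C\<close> enters through one fact: the preimage of a subcomodule
  under a colinear map is a subcomodule. Kernels depend on it, and so do intersections and with them
  the complements found by Zorn's lemma. Flatness is tested on modules over one fixed type, so the
  quotients in that argument are built inside this type. Two obstacles shape the splitting of A g
  x_1 + ... + A g x_n: the sum need not be direct, and \<open>a\<close> is not determined by the
  element a g v. Projecting modulo the earlier summands replaces x by some v and settles the first.
  For the second there is a coinvariant idempotent \<open>w\<close> such that \<open>a w\<close>
  depends only on a g v and a w g v = a g v. If a g v = g y, then \<open>a w\<close> is coinvariant:
  the comultiplication of this element is both a g \<otimes> g v and g \<otimes> a g v, and the
  second factor is contracted by the coefficient map. An inverse of the canonical map is never
  written down. Each tensor involves finitely many right factors, and for finitely many of them an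
  additive left inverse is built by recursion.\<close>

definition ahom :: "('a, 'x) ring_scheme \<Rightarrow> ('b, 'y) ring_scheme \<Rightarrow> ('a \<Rightarrow> 'b) set"
  where "ahom G H = hom (add_monoid G) (add_monoid H)"

lemma ahomI:
  assumes "\<And>x. x \<in> carrier G \<Longrightarrow> f x \<in> carrier H"
    and "\<And>x y. x \<in> carrier G \<Longrightarrow> y \<in> carrier G \<Longrightarrow> f (x \<oplus>\<^bsub>G\<^esub> y) = f x \<oplus>\<^bsub>H\<^esub> f y"
  shows "f \<in> ahom G H"
  using assms by (auto simp: ahom_def hom_def)

lemma ahom_closed: "f \<in> ahom G H \<Longrightarrow> x \<in> carrier G \<Longrightarrow> f x \<in> carrier H"
  by (auto simp: ahom_def hom_def)

lemma ahom_add: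
  "f \<in> ahom G H \<Longrightarrow> x \<in> carrier G \<Longrightarrow> y \<in> carrier G \<Longrightarrow> f (x \<oplus>\<^bsub>G\<^esub> y) = f x \<oplus>\<^bsub>H\<^esub> f y"
  by (auto simp: ahom_def hom_def)

lemma ahom_comp: "f \<in> ahom G H \<Longrightarrow> h \<in> ahom H L \<Longrightarrow> (\<lambda>x. h (f x)) \<in> ahom G L"
  by (rule ahomI) (auto simp: ahom_add ahom_closed)

lemma ahom_abelian_group_hom:
  assumes "abelian_group G" "abelian_group H" "f \<in> ahom G H"
  shows "abelian_group_hom G H f"
  using assms by (intro abelian_group_homI) (auto simp: group_hom_def group_hom_axioms_def ahom_def
        abelian_group.a_group)

lemma ahom_zero:
  assumes "abelian_group G" "abelian_group H" "f \<in> ahom G H"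
  shows "f \<zero>\<^bsub>G\<^esub> = \<zero>\<^bsub>H\<^esub>"
proof -
  interpret abelian_group_hom G H f
    using assms by (rule ahom_abelian_group_hom)
  show ?thesis by simp
qed

lemma ahom_uminus:
  assumes "abelian_group G" "abelian_group H" "f \<in> ahom G H" "x \<in> carrier G"
  shows "f (\<ominus>\<^bsub>G\<^esub> x) = \<ominus>\<^bsub>H\<^esub> f x"
proof -
  interpret abelian_group_hom G H f
    using assms(1-3) by (rule ahom_abelian_group_hom)
  show ?thesis using assms by simp
qed

lemma ahom_minus:
  assumes "abelian_group G" "abelian_group H" "f \<in> ahom G H" "x \<in> carrier G" "y \<in> carrier G"
  shows "f (x \<ominus>\<^bsub>G\<^esub> y) = f x \<ominus>\<^bsub>H\<^esub> f y"
proof -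
  interpret G: abelian_group G by fact
  interpret H: abelian_group H by fact
  show ?thesis
    using assms by (simp add: a_minus_def ahom_add ahom_uminus)
qed

lemma ahom_sum:
  assumes "abelian_group H" "f \<in> ahom G H" "h \<in> ahom G H"
  shows "(\<lambda>x. f x \<oplus>\<^bsub>H\<^esub> h x) \<in> ahom G H"
proof -
  interpret H: abelian_group H by fact
  show ?thesis
    using assms by (intro ahomI) (simp_all add: ahom_closed ahom_add H.a_ac)
qed

text \<open>Several records carry the same group and differ only in their other fields, for instance
  \<open>tensor\<close> and \<open>tensor_group\<close>; the group laws read only these three
  fields.\<close>

lemma abelian_group_cong:
  assumes "abelian_group G" "carrier H = carrier G"
    "ring.add H = ring.add G" "\<zero>\<^bsub>H\<^esub> = \<zero>\<^bsub>G\<^esub>"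
  shows "abelian_group H"
proof -
  interpret abelian_group G by fact
  show ?thesis
  proof (rule abelian_groupI, unfold assms(2-))
    fix x assume x: "x \<in> carrier G"
    then show "\<exists>y\<in>carrier G. y \<oplus>\<^bsub>G\<^esub> x = \<zero>\<^bsub>G\<^esub>" using l_neg a_inv_closed by blast
  qed (auto simp: a_assoc intro: a_comm)
qed

lemma additive_subgroupI':
  assumes "abelian_group G" "H \<subseteq> carrier G" "\<zero>\<^bsub>G\<^esub> \<in> H"
    and "\<And>x. x \<in> H \<Longrightarrow> \<ominus>\<^bsub>G\<^esub> x \<in> H"
    and "\<And>x y. x \<in> H \<Longrightarrow> y \<in> H \<Longrightarrow> x \<oplus>\<^bsub>G\<^esub> y \<in> H"
  shows "additive_subgroup H G"
  using assms by (intro additive_subgroup.intro subgroup.intro) (auto simp flip: a_inv_def)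

lemma additive_subgroup_uminus:
  assumes "abelian_group G" "additive_subgroup H G" "x \<in> H"
  shows "\<ominus>\<^bsub>G\<^esub> x \<in> H"
  using assms additive_subgroup.a_subgroup subgroup.m_inv_closed by (fastforce simp: a_inv_def)

lemma additive_subgroup_minus:
  assumes "abelian_group G" "additive_subgroup H G" "x \<in> H" "y \<in> H"
  shows "x \<ominus>\<^bsub>G\<^esub> y \<in> H"
  using assms by (simp add: a_minus_def additive_subgroup_uminus additive_subgroup.a_closed)

lemma additive_subgroup_abelian_group:
  assumes "abelian_group G" "additive_subgroup H G"
  shows "abelian_group (G\<lparr>carrier := H\<rparr>)"
proof -
  interpret abelian_group G by fact
  interpret H: additive_subgroup H G by fact
  have "group ((add_monoid G)\<lparr>carrier := H\<rparr>)"
    using H.a_subgroup by (intro subgroup.subgroup_is_group a_group)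
  then have "group (add_monoid (G\<lparr>carrier := H\<rparr>))" by simp
  then have "comm_group (add_monoid (G\<lparr>carrier := H\<rparr>))"
    by (rule group.group_comm_groupI) (auto simp: a_comm)
  then show ?thesis by (rule comm_group_abelian_groupI)
qed

lemma (in abelian_group) uminus_zero: "\<ominus> \<zero> = \<zero>"
  by (rule minus_equality) simp_all

lemma (in abelian_group) minus_eq_zero_iff:
  assumes "x \<in> carrier G" "y \<in> carrier G"
  shows "x \<ominus> y = \<zero> \<longleftrightarrow> x = y"
proof
  assume "x \<ominus> y = \<zero>"
  then have "\<ominus> (\<ominus> y) = x" using assms by (intro minus_equality) (simp_all add: a_minus_def)
  then show "x = y" using assms by simp
qed (use assms in \<open>simp add: a_minus_def r_neg\<close>)

text \<open>The inverse in the restricted record is described over the smaller carrier, so the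
  equality is not definitional; it follows from uniqueness of inverses there.\<close>

lemma additive_subgroup_uminus_eq:
  assumes "abelian_group G" "additive_subgroup H G" "x \<in> H"
  shows "\<ominus>\<^bsub>G\<lparr>carrier := H\<rparr>\<^esub> x = \<ominus>\<^bsub>G\<^esub> x"
proof -
  interpret G: abelian_group G by fact
  interpret H: abelian_group "G\<lparr>carrier := H\<rparr>"
    using assms(1,2) by (rule additive_subgroup_abelian_group)
  have "x \<in> carrier G" using assms(2,3) additive_subgroup.a_subset by blast
  then show ?thesis
    using assms(3) additive_subgroup_uminus[OF assms] by (intro H.minus_equality) (simp_all add: G.l_neg)
qed

section \<open>Balanced maps and the universal property of the tensor product\<close>

definition balanced ::
    "('a, 'z) ring_scheme \<Rightarrow> ('a, 'm, 'x) bimod_scheme \<Rightarrow> ('a, 'n, 'w) module_scheme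
      \<Rightarrow> ('g, 'v) ring_scheme \<Rightarrow> ('m \<Rightarrow> 'n \<Rightarrow> 'g) \<Rightarrow> bool"
  where "balanced R M N G \<beta> \<longleftrightarrow>
    (\<forall>m\<in>carrier M. \<forall>n\<in>carrier N. \<beta> m n \<in> carrier G) \<and>
    (\<forall>m\<in>carrier M. \<forall>m'\<in>carrier M. \<forall>n\<in>carrier N. \<beta> (m \<oplus>\<^bsub>M\<^esub> m') n = \<beta> m n \<oplus>\<^bsub>G\<^esub> \<beta> m' n) \<and>
    (\<forall>m\<in>carrier M. \<forall>n\<in>carrier N. \<forall>n'\<in>carrier N. \<beta> m (n \<oplus>\<^bsub>N\<^esub> n') = \<beta> m n \<oplus>\<^bsub>G\<^esub> \<beta> m n') \<and>
    (\<forall>m\<in>carrier M. \<forall>r\<in>carrier R. \<forall>n\<in>carrier N. \<beta> (m \<triangleleft>\<^bsub>M\<^esub> r) n = \<beta> m (r \<odot>\<^bsub>N\<^esub> n))"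

lemma balancedI:
  assumes "\<And>m n. m \<in> carrier M \<Longrightarrow> n \<in> carrier N \<Longrightarrow> \<beta> m n \<in> carrier G"
    and "\<And>m m' n. m \<in> carrier M \<Longrightarrow> m' \<in> carrier M \<Longrightarrow> n \<in> carrier N \<Longrightarrow>
      \<beta> (m \<oplus>\<^bsub>M\<^esub> m') n = \<beta> m n \<oplus>\<^bsub>G\<^esub> \<beta> m' n"
    and "\<And>m n n'. m \<in> carrier M \<Longrightarrow> n \<in> carrier N \<Longrightarrow> n' \<in> carrier N \<Longrightarrow>
      \<beta> m (n \<oplus>\<^bsub>N\<^esub> n') = \<beta> m n \<oplus>\<^bsub>G\<^esub> \<beta> m n'"
    and "\<And>m r n. m \<in> carrier M \<Longrightarrow> r \<in> carrier R \<Longrightarrow> n \<in> carrier N \<Longrightarrow>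
      \<beta> (m \<triangleleft>\<^bsub>M\<^esub> r) n = \<beta> m (r \<odot>\<^bsub>N\<^esub> n)"
  shows "balanced R M N G \<beta>"
  using assms by (auto simp: balanced_def)

text \<open>This is the sum that \<open>tensor_lift\<close> evaluates on the representatives of a
  coset; on the free abelian group it is the homomorphism extending \<beta>.\<close>

definition frag_eval :: "('g, 'v) ring_scheme \<Rightarrow> ('p \<Rightarrow> 'g) \<Rightarrow> ('p \<Rightarrow>\<^sub>0 int) \<Rightarrow> 'g"
  where "frag_eval G \<beta> x =
    (\<Oplus>\<^bsub>G\<^esub>p\<in>Poly_Mapping.keys x. add_pow G (Poly_Mapping.lookup x p) (\<beta> p))"

context abelian_group
begin

text \<open>Additivity compares sums over the supports of x, y and x + y, which differ. Over a
  common finite superset the extra terms have coefficient 0.\<close>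

lemma frag_eval_superset:
  assumes "finite U" "Poly_Mapping.keys x \<subseteq> U" "\<beta> ` U \<subseteq> carrier G"
  shows "frag_eval G \<beta> x = (\<Oplus>p\<in>U. add_pow G (Poly_Mapping.lookup x p) (\<beta> p))"
  unfolding frag_eval_def
  using assms by (intro add.finprod_mono_neutral_cong_left)
    (auto simp: in_keys_iff image_subset_iff add_pow_int_ge add_pow_def[of _ 0])

lemma frag_eval_hom:
  assumes "\<beta> ` S \<subseteq> carrier G"
  shows "frag_eval G \<beta> \<in> hom (free_Abelian_group S) (add_monoid G)"
proof (rule homI)
  fix x assume x: "x \<in> carrier (free_Abelian_group S)"
  then have "\<beta> ` Poly_Mapping.keys x \<subseteq> carrier G" using assms by auto
  then show "frag_eval G \<beta> x \<in> carrier (add_monoid G)"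
    unfolding frag_eval_def by (auto intro!: finsum_closed)
  fix y assume y: "y \<in> carrier (free_Abelian_group S)"
  let ?U = "Poly_Mapping.keys x \<union> Poly_Mapping.keys y"
  have U: "\<beta> ` ?U \<subseteq> carrier G" using x y assms by auto
  then have \<beta>: "\<beta> p \<in> carrier G" if "p \<in> ?U" for p using that by blast
  have "frag_eval G \<beta> (x + y)
      = (\<Oplus>p\<in>?U. add_pow G (Poly_Mapping.lookup x p) (\<beta> p) \<oplus> add_pow G (Poly_Mapping.lookup y p) (\<beta> p))"
    using U keys_add[of x y] \<beta>
    by (subst frag_eval_superset[where U = ?U])
      (auto simp: lookup_add add.int_pow_mult simp del: finsum_addf intro!: add.finprod_cong')
  also have "\<dots> = frag_eval G \<beta> x \<oplus> frag_eval G \<beta> y"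
    using U \<beta> by (subst finsum_addf) (auto simp: frag_eval_superset[where U = ?U])
  finally show "frag_eval G \<beta> (x \<otimes>\<^bsub>free_Abelian_group S\<^esub> y) =
      frag_eval G \<beta> x \<otimes>\<^bsub>add_monoid G\<^esub> frag_eval G \<beta> y" by simp
qed

lemma frag_eval_of: "\<beta> p \<in> carrier G \<Longrightarrow> frag_eval G \<beta> (frag_of p) = \<beta> p"
  by (simp add: frag_eval_def)

lemma frag_eval_diff:
  assumes "\<beta> ` S \<subseteq> carrier G" "Poly_Mapping.keys x \<subseteq> S" "Poly_Mapping.keys y \<subseteq> S"
  shows "frag_eval G \<beta> (x - y) = frag_eval G \<beta> x \<ominus> frag_eval G \<beta> y"
proof -
  interpret h: group_hom "free_Abelian_group S" "add_monoid G" "frag_eval G \<beta>"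
    using frag_eval_hom[OF assms(1)]
    by (simp add: group_hom_def group_hom_axioms_def a_group)
  have "frag_eval G \<beta> (- y) = \<ominus> frag_eval G \<beta> y"
    using h.hom_inv[of y] assms by (simp add: a_inv_def)
  then show ?thesis
    using h.hom_mult[of x "- y"] assms by (simp add: a_minus_def)
qed

end

locale tensor_product =
  fixes R :: "('a, 'z) ring_scheme" and M :: "('a, 'm, 'x) bimod_scheme"
    and N :: "('a, 'n, 'w) module_scheme"
  assumes right: "right_module R M" and left: "left_module R N"
begin

sublocale M: right_module R M by (rule right)
sublocale N: left_module R N by (rule left)

abbreviation "F \<equiv> free_Abelian_group (carrier M \<times> carrier N)"
abbreviation "T \<equiv> tensor_group R M N"
abbreviation "ts \<equiv> tens R M N"

sublocale F: comm_group F by (rule abelian_free_Abelian_group)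

lemma tensor_relations_carrier: "tensor_relations R M N \<subseteq> carrier F"
proof -
  have "frag_of x \<in> carrier F" if "x \<in> carrier M \<times> carrier N" for x using that by simp
  moreover have "x - y \<in> carrier F" if "x \<in> carrier F" "y \<in> carrier F" for x y
    using that keys_diff[of x y] by auto
  ultimately show ?thesis
    unfolding tensor_relations_def
    using M.rsmult_closed N.smult_closed by (auto simp del: carrier_free_Abelian_group_iff)
qed

lemma tensor_kernel_subgroup: "subgroup (tensor_kernel R M N) F"
  unfolding tensor_kernel_def
  using F.generate_is_subgroup[OF tensor_relations_carrier] .

lemma tensor_kernel_normal: "tensor_kernel R M N \<lhd> F"
  using tensor_kernel_subgroup by (simp add: F.normal_iff_subgroup)

lemma add_monoid_tensor_group: "add_monoid T = F Mod tensor_kernel R M N"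
  by (simp add: tensor_group_def Let_def FactGroup_def)

sublocale T: abelian_group T
proof -
  have "comm_group (add_monoid T)"
    unfolding add_monoid_tensor_group
    using F.abelian_FactGroup tensor_kernel_subgroup by blast
  then show "abelian_group T" by (rule comm_group_abelian_groupI)
qed

lemma coset_hom: "(\<lambda>x. tensor_kernel R M N #>\<^bsub>F\<^esub> x) \<in> hom F (add_monoid T)"
  unfolding add_monoid_tensor_group using normal.r_coset_hom_Mod[OF tensor_kernel_normal] .

lemma tensor_group_carrier:
  "carrier T = (\<lambda>x. tensor_kernel R M N #>\<^bsub>F\<^esub> x) ` carrier F"
  by (simp add: tensor_group_def Let_def FactGroup_def RCOSETS_def image_def)
     (auto simp: subset_iff)

lemma tens_closed [simp, intro]: "m \<in> carrier M \<Longrightarrow> n \<in> carrier N \<Longrightarrow> ts m n \<in> carrier T"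
  unfolding tensor_group_carrier tens_def by (rule imageI) simp

lemma coset_eq_iff:
  assumes "x \<in> carrier F" "y \<in> carrier F"
  shows "tensor_kernel R M N #>\<^bsub>F\<^esub> x = tensor_kernel R M N #>\<^bsub>F\<^esub> y \<longleftrightarrow>
    x - y \<in> tensor_kernel R M N"
proof -
  have "x - y = x \<otimes>\<^bsub>F\<^esub> inv\<^bsub>F\<^esub> y" using assms by (simp add: inv_free_Abelian_group)
  moreover have "tensor_kernel R M N #>\<^bsub>F\<^esub> x = tensor_kernel R M N #>\<^bsub>F\<^esub> y \<longleftrightarrow>
     x \<otimes>\<^bsub>F\<^esub> inv\<^bsub>F\<^esub> y \<in> tensor_kernel R M N"
    using subgroup.rcos_module[OF tensor_kernel_subgroup F.group_axioms assms(2,1)]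
       F.repr_independence[OF _ _ tensor_kernel_subgroup] F.rcos_self[OF _ tensor_kernel_subgroup] assms
    by metis
  ultimately show ?thesis by metis
qed

lemma tens_add_left:
  assumes "m \<in> carrier M" "m' \<in> carrier M" "n \<in> carrier N"
  shows "ts (m \<oplus>\<^bsub>M\<^esub> m') n = ts m n \<oplus>\<^bsub>T\<^esub> ts m' n"
proof -
  have c: "frag_of (m, n) \<in> carrier F" "frag_of (m', n) \<in> carrier F" "frag_of (m \<oplus>\<^bsub>M\<^esub> m', n) \<in> carrier F"
    using assms by auto
  have c2: "frag_of (m, n) + frag_of (m', n) \<in> carrier F"
    using F.m_closed[OF c(1,2)] by simp
  have "frag_of (m \<oplus>\<^bsub>M\<^esub> m', n) - frag_of (m, n) - frag_of (m', n) \<in> tensor_kernel R M N"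
    unfolding tensor_kernel_def by (rule generate.incl) (use assms in \<open>auto simp: tensor_relations_def\<close>)
  then have "ts (m \<oplus>\<^bsub>M\<^esub> m') n = tensor_kernel R M N #>\<^bsub>F\<^esub> (frag_of (m, n) + frag_of (m', n))"
    unfolding tens_def using coset_eq_iff[OF c(3) c2] by (simp add: diff_diff_eq)
  then show ?thesis
    using hom_mult[OF coset_hom c(1,2)] by (simp add: tens_def)
qed

lemma tens_add_right:
  assumes "m \<in> carrier M" "n' \<in> carrier N" "n \<in> carrier N"
  shows "ts m (n \<oplus>\<^bsub>N\<^esub> n') = ts m n \<oplus>\<^bsub>T\<^esub> ts m n'"
proof -
  have c: "frag_of (m, n) \<in> carrier F" "frag_of (m, n') \<in> carrier F" "frag_of (m, n \<oplus>\<^bsub>N\<^esub> n') \<in> carrier F"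
    using assms by auto
  have c2: "frag_of (m, n) + frag_of (m, n') \<in> carrier F"
    using F.m_closed[OF c(1,2)] by simp
  have "frag_of (m, n \<oplus>\<^bsub>N\<^esub> n') - frag_of (m, n) - frag_of (m, n') \<in> tensor_kernel R M N"
    unfolding tensor_kernel_def by (rule generate.incl) (use assms in \<open>auto simp: tensor_relations_def\<close>)
  then have "ts m (n \<oplus>\<^bsub>N\<^esub> n') = tensor_kernel R M N #>\<^bsub>F\<^esub> (frag_of (m, n) + frag_of (m, n'))"
    unfolding tens_def using coset_eq_iff[OF c(3) c2] by (simp add: diff_diff_eq)
  then show ?thesis
    using hom_mult[OF coset_hom c(1,2)] by (simp add: tens_def)
qed

lemma tens_balanced:
  assumes "m \<in> carrier M" "r \<in> carrier R" "n \<in> carrier N"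
  shows "ts (m \<triangleleft>\<^bsub>M\<^esub> r) n = ts m (r \<odot>\<^bsub>N\<^esub> n)"
proof -
  have c: "frag_of (m \<triangleleft>\<^bsub>M\<^esub> r, n) \<in> carrier F" "frag_of (m, r \<odot>\<^bsub>N\<^esub> n) \<in> carrier F"
    using assms M.rsmult_closed N.smult_closed by auto
  have "frag_of (m \<triangleleft>\<^bsub>M\<^esub> r, n) - frag_of (m, r \<odot>\<^bsub>N\<^esub> n) \<in> tensor_kernel R M N"
    unfolding tensor_kernel_def by (rule generate.incl) (use assms in \<open>auto simp: tensor_relations_def\<close>)
  then show ?thesis
    unfolding tens_def using coset_eq_iff[OF c] by simp
qed


lemma tens_uminus_left:
  assumes "m \<in> carrier M" "n \<in> carrier N"
  shows "ts (\<ominus>\<^bsub>M\<^esub> m) n = \<ominus>\<^bsub>T\<^esub> ts m n"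
  using assms by (intro ahom_uminus[where f = "\<lambda>m. ts m n"] ahomI M.abelian_group_axioms
      T.abelian_group_axioms) (auto simp: tens_add_left)


lemma tens_zero_right: "m \<in> carrier M \<Longrightarrow> ts m \<zero>\<^bsub>N\<^esub> = \<zero>\<^bsub>T\<^esub>"
  by (intro ahom_zero[where f = "ts m"] ahomI N.abelian_group_axioms
      T.abelian_group_axioms) (auto simp: tens_add_right)

lemma tens_minus_right:
  assumes "m \<in> carrier M" "n \<in> carrier N" "n' \<in> carrier N"
  shows "ts m (n \<ominus>\<^bsub>N\<^esub> n') = ts m n \<ominus>\<^bsub>T\<^esub> ts m n'"
  using assms by (intro ahom_minus[where f = "ts m"] ahomI N.abelian_group_axioms
      T.abelian_group_axioms) (auto simp: tens_add_right)

text \<open>Negatives need no case of their own, because the negative of a pure tensor is again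
  pure: the sign goes into the left factor.\<close>

lemma tensor_induct [consumes 1, case_names zero tens add]:
  assumes "t \<in> carrier T"
    and zero: "P \<zero>\<^bsub>T\<^esub>"
    and tens: "\<And>m n. m \<in> carrier M \<Longrightarrow> n \<in> carrier N \<Longrightarrow> P (ts m n)"
    and add: "\<And>s t. s \<in> carrier T \<Longrightarrow> t \<in> carrier T \<Longrightarrow> P s \<Longrightarrow> P t \<Longrightarrow> P (s \<oplus>\<^bsub>T\<^esub> t)"
  shows "P t"
proof -
  let ?q = "\<lambda>x. tensor_kernel R M N #>\<^bsub>F\<^esub> x"
  interpret q: group_hom F "add_monoid T" ?q
    using coset_hom T.a_group by (auto simp: group_hom_def group_hom_axioms_def)
  obtain x where x: "x \<in> carrier F" "t = ?q x" using assms(1) tensor_group_carrier by auto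
  \<comment> \<open>The induction on the free abelian group passes through differences, so the
    property is carried along together with the one for the negative.\<close>
  have "P (?q x) \<and> P (\<ominus>\<^bsub>T\<^esub> ?q x)"
    using x(1)[simplified]
  proof (induction x rule: free_Abelian_group_induct[consumes 1, case_names base diff single])
    case base
    have "?q 0 = \<zero>\<^bsub>T\<^esub>" using q.hom_one by simp
    then show ?case using zero T.uminus_zero by (simp only: simp_thms)
  next
    case (diff x y)
    have cl: "?q x \<in> carrier T" "?q y \<in> carrier T"
      using q.hom_closed[of x] q.hom_closed[of y] diff by auto
    have "?q (x - y) = ?q x \<oplus>\<^bsub>T\<^esub> \<ominus>\<^bsub>T\<^esub> ?q y"
      using q.hom_mult[of x "inv\<^bsub>F\<^esub> y"] q.hom_inv[of y] diff by (simp add: a_inv_def)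
    moreover have "\<ominus>\<^bsub>T\<^esub> (?q x \<oplus>\<^bsub>T\<^esub> \<ominus>\<^bsub>T\<^esub> ?q y) = ?q y \<oplus>\<^bsub>T\<^esub> \<ominus>\<^bsub>T\<^esub> ?q x"
      using cl by (simp add: T.minus_add T.minus_minus T.a_comm)
    ultimately show ?case
      using diff cl by (simp add: add)
  next
    case (single p)
    then obtain m n where p: "p = (m, n)" "m \<in> carrier M" "n \<in> carrier N" by auto
    then have "?q (frag_of p) = ts m n" by (simp add: tens_def)
    moreover have "\<ominus>\<^bsub>T\<^esub> ts m n = ts (\<ominus>\<^bsub>M\<^esub> m) n" using p by (simp add: tens_uminus_left)
    ultimately show ?case using p tens by simp
  qed
  then show ?thesis using x by simp
qed

lemma tensor_hom_eqI:
  assumes "abelian_group G" "f \<in> ahom T G" "h \<in> ahom T G"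
    and eq: "\<And>m n. m \<in> carrier M \<Longrightarrow> n \<in> carrier N \<Longrightarrow> f (ts m n) = h (ts m n)"
    and "t \<in> carrier T"
  shows "f t = h t"
  using \<open>t \<in> carrier T\<close>
proof (induction t rule: tensor_induct)
  case zero
  then show ?case using assms ahom_zero T.abelian_group_axioms by metis
next
  case (tens m n)
  then show ?case by (rule eq)
next
  case (add s t)
  then show ?case using assms by (simp add: ahom_add)
qed

context
  fixes G :: "('g, 'v) ring_scheme" and \<beta> :: "'m \<Rightarrow> 'n \<Rightarrow> 'g"
  assumes G: "abelian_group G" and bal: "balanced R M N G \<beta>"
begin

interpretation G: abelian_group G by (rule G)

private abbreviation "ev \<equiv> frag_eval G (\<lambda>p. \<beta> (fst p) (snd p))"

private lemma \<beta>_carrier: "(\<lambda>p. \<beta> (fst p) (snd p)) ` (carrier M \<times> carrier N) \<subseteq> carrier G"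
  using bal by (auto simp: balanced_def)

private lemma ev_hom: "group_hom F (add_monoid G) ev"
  using G.frag_eval_hom[OF \<beta>_carrier] by (simp add: group_hom_def group_hom_axioms_def G.a_group)

private lemma ev_of: "m \<in> carrier M \<Longrightarrow> n \<in> carrier N \<Longrightarrow> ev (frag_of (m, n)) = \<beta> m n"
  using bal by (subst G.frag_eval_of) (auto simp: balanced_def)

private lemma ev_diff:
  assumes "x \<in> carrier F" "y \<in> carrier F"
  shows "ev (x - y) = ev x \<ominus>\<^bsub>G\<^esub> ev y"
  using assms by (intro G.frag_eval_diff[OF \<beta>_carrier]) auto

private lemma ev_kernel:
  assumes "x \<in> tensor_kernel R M N"
  shows "ev x = \<zero>\<^bsub>G\<^esub>"
proof -
  interpret group_hom F "add_monoid G" ev by (rule ev_hom)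
  have \<beta>: "\<beta> m n \<in> carrier G" if "m \<in> carrier M" "n \<in> carrier N" for m n
    using that bal by (auto simp: balanced_def)
  have fc: "frag_of (m, n) \<in> carrier F" if "m \<in> carrier M" "n \<in> carrier N" for m n
    using that by simp
  have dc: "x - y \<in> carrier F" if "x \<in> carrier F" "y \<in> carrier F" for x y
    using that keys_diff[of x y] by auto
  note cl = M.rsmult_closed N.smult_closed M.a_closed N.a_closed
  have "tensor_relations R M N \<subseteq> kernel F (add_monoid G) ev"
  proof
    fix x assume x: "x \<in> tensor_relations R M N"
    have d: "a \<oplus>\<^bsub>G\<^esub> b \<oplus>\<^bsub>G\<^esub> \<ominus>\<^bsub>G\<^esub> a \<oplus>\<^bsub>G\<^esub> \<ominus>\<^bsub>G\<^esub> b = \<zero>\<^bsub>G\<^esub>" if "a \<in> carrier G" "b \<in> carrier G" for a b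
    proof -
      have "a \<oplus>\<^bsub>G\<^esub> b \<oplus>\<^bsub>G\<^esub> \<ominus>\<^bsub>G\<^esub> a = b" using that
        by (metis G.a_assoc G.a_comm G.a_inv_closed G.r_neg1)
      then show ?thesis using that G.r_neg by simp
    qed
    have "ev x = \<zero>\<^bsub>G\<^esub>"
      using x bal unfolding tensor_relations_def
      by (auto simp: ev_diff ev_of fc dc cl \<beta> d balanced_def G.r_neg a_minus_def
          simp del: carrier_free_Abelian_group_iff)
    then show "x \<in> kernel F (add_monoid G) ev"
      using x tensor_relations_carrier unfolding kernel_def by (auto simp del: carrier_free_Abelian_group_iff)
  qed
  then have "tensor_kernel R M N \<subseteq> kernel F (add_monoid G) ev"
    unfolding tensor_kernel_def by (rule F.generate_subgroup_incl[OF _ subgroup_kernel])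
  then show ?thesis using assms by (auto simp: kernel_def)
qed

text \<open>\<open>ev\<close> vanishes on \<open>tensor_kernel\<close>, hence is constant on each
  coset. The image in the definition of \<open>tensor_lift\<close> is therefore a singleton, and
  \<open>the_elem\<close> returns its member.\<close>

private lemma tensor_lift_coset:
  assumes "x \<in> carrier F"
  shows "tensor_lift G \<beta> (tensor_kernel R M N #>\<^bsub>F\<^esub> x) = ev x"
proof -
  interpret group_hom F "add_monoid G" ev by (rule ev_hom)
  have "ev (k + x) = ev x" if "k \<in> tensor_kernel R M N" for k
  proof -
    have "k \<in> carrier F" using that tensor_kernel_subgroup subgroup.mem_carrier by metis
    then show ?thesis
      using hom_mult[of k x] hom_closed[of x] assms ev_kernel[OF that] by simp
  qed
  moreover have "0 \<in> tensor_kernel R M N"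
    using subgroup.one_closed[OF tensor_kernel_subgroup] by simp
  moreover have "tensor_kernel R M N #>\<^bsub>F\<^esub> x = (\<lambda>k. k + x) ` tensor_kernel R M N"
    by (auto simp: r_coset_def)
  ultimately have "ev ` (tensor_kernel R M N #>\<^bsub>F\<^esub> x) = {ev x}"
    by (auto simp: image_image intro!: image_eqI[where x = 0])
  then show ?thesis
    by (simp add: tensor_lift_def frag_eval_def)
qed

lemma tensor_lift_tens [simp]:
  assumes "m \<in> carrier M" "n \<in> carrier N"
  shows "tensor_lift G \<beta> (ts m n) = \<beta> m n"
  using assms tensor_lift_coset[of "frag_of (m, n)"] by (simp add: tens_def ev_of)

lemma tensor_lift_hom [simp]: "tensor_lift G \<beta> \<in> ahom T G"
proof -
  interpret group_hom F "add_monoid G" ev by (rule ev_hom)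
  let ?q = "\<lambda>x. tensor_kernel R M N #>\<^bsub>F\<^esub> x"
  show ?thesis
  proof (rule ahomI)
    fix s assume "s \<in> carrier T"
    then obtain x where x: "x \<in> carrier F" "s = ?q x" using tensor_group_carrier by auto
    then show "tensor_lift G \<beta> s \<in> carrier G"
      using tensor_lift_coset hom_closed by simp
    fix t assume "t \<in> carrier T"
    then obtain y where y: "y \<in> carrier F" "t = ?q y" using tensor_group_carrier by auto
    have "s \<oplus>\<^bsub>T\<^esub> t = ?q (x + y)" using Group.hom_mult[OF coset_hom x(1) y(1)] x y by simp
    moreover have "x + y \<in> carrier F" using F.m_closed[OF x(1) y(1)] by simp
    ultimately show "tensor_lift G \<beta> (s \<oplus>\<^bsub>T\<^esub> t) = tensor_lift G \<beta> s \<oplus>\<^bsub>G\<^esub> tensor_lift G \<beta> t"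
      using tensor_lift_coset x y hom_mult[OF x(1) y(1)] by simp
  qed
qed

end

end

section \<open>Module actions, linear maps and maps between tensor products\<close>

context left_module
begin

lemma smult_ahom_right: "r \<in> carrier R \<Longrightarrow> (\<lambda>m. r \<odot>\<^bsub>M\<^esub> m) \<in> ahom M M"
  by (rule ahomI) (simp_all add: smult_r_distr smult_closed)

lemma smult_ahom_left: "m \<in> carrier M \<Longrightarrow> (\<lambda>r. r \<odot>\<^bsub>M\<^esub> m) \<in> ahom R M"
  by (rule ahomI) (simp_all add: smult_l_distr smult_closed)

lemmas smult_zero_right =
  ahom_zero[OF M.abelian_group_axioms M.abelian_group_axioms smult_ahom_right]
lemmas smult_minus_right =
  ahom_minus[OF M.abelian_group_axioms M.abelian_group_axioms smult_ahom_right]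
lemmas smult_zero_left =
  ahom_zero[OF R.abelian_group_axioms M.abelian_group_axioms smult_ahom_left]
lemmas smult_uminus_left =
  ahom_uminus[OF R.abelian_group_axioms M.abelian_group_axioms smult_ahom_left]

end

context right_module
begin

lemma rsmult_ahom_left: "r \<in> carrier R \<Longrightarrow> (\<lambda>m. m \<triangleleft>\<^bsub>M\<^esub> r) \<in> ahom M M"
  by (rule ahomI) (simp_all add: rsmult_l_distr rsmult_closed)

lemma rsmult_ahom_right: "m \<in> carrier M \<Longrightarrow> (\<lambda>r. m \<triangleleft>\<^bsub>M\<^esub> r) \<in> ahom R M"
  by (rule ahomI) (simp_all add: rsmult_r_distr rsmult_closed)

lemmas rsmult_zero_left =
  ahom_zero[OF M.abelian_group_axioms M.abelian_group_axioms rsmult_ahom_left]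
lemmas rsmult_zero_right =
  ahom_zero[OF R.abelian_group_axioms M.abelian_group_axioms rsmult_ahom_right]
lemmas rsmult_uminus_right =
  ahom_uminus[OF R.abelian_group_axioms M.abelian_group_axioms rsmult_ahom_right]
lemmas rsmult_minus_right =
  ahom_minus[OF R.abelian_group_axioms M.abelian_group_axioms rsmult_ahom_right]

end

lemma left_module_homI:
  assumes "\<And>m. m \<in> carrier M \<Longrightarrow> f m \<in> carrier N"
    and "\<And>m n. m \<in> carrier M \<Longrightarrow> n \<in> carrier M \<Longrightarrow> f (m \<oplus>\<^bsub>M\<^esub> n) = f m \<oplus>\<^bsub>N\<^esub> f n"
    and "\<And>r m. r \<in> carrier R \<Longrightarrow> m \<in> carrier M \<Longrightarrow> f (r \<odot>\<^bsub>M\<^esub> m) = r \<odot>\<^bsub>N\<^esub> f m"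
  shows "f \<in> left_module_hom R M N"
  using assms by (auto simp: left_module_hom_def hom_def)

lemma left_module_hom_ahom: "f \<in> left_module_hom R M N \<Longrightarrow> f \<in> ahom M N"
  by (simp add: left_module_hom_def ahom_def)

lemma left_module_hom_smult:
  "f \<in> left_module_hom R M N \<Longrightarrow> r \<in> carrier R \<Longrightarrow> m \<in> carrier M \<Longrightarrow>
    f (r \<odot>\<^bsub>M\<^esub> m) = r \<odot>\<^bsub>N\<^esub> f m"
  by (simp add: left_module_hom_def)

text \<open>The hypotheses on \<open>f\<close> and \<open>g\<close> under which \<open>f \<otimes>\<^sub>R g\<close> is meaningful; no right linearity
  of \<open>g\<close> or left linearity of \<open>f\<close> is involved.\<close>

lemma (in tensor_product) balanced_tensor_map:
  assumes "tensor_product R P Q"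
    and f: "f \<in> ahom P M" "\<And>p r. p \<in> carrier P \<Longrightarrow> r \<in> carrier R \<Longrightarrow> f (p \<triangleleft>\<^bsub>P\<^esub> r) = f p \<triangleleft>\<^bsub>M\<^esub> r"
    and g: "g \<in> left_module_hom R Q N"
  shows "balanced R P Q T (\<lambda>p q. ts (f p) (g q))"
proof -
  have g': "g \<in> ahom Q N" using g by (rule left_module_hom_ahom)
  show ?thesis
    using f g g' left_module_hom_smult[OF g]
    by (intro balancedI)
      (auto simp: ahom_closed ahom_add tens_add_left tens_add_right tens_balanced)
qed

context tensor_product
begin

lemma tensor_map_hom:
  assumes "tensor_product R P Q"
    and "f \<in> ahom P M" "\<And>p r. p \<in> carrier P \<Longrightarrow> r \<in> carrier R \<Longrightarrow> f (p \<triangleleft>\<^bsub>P\<^esub> r) = f p \<triangleleft>\<^bsub>M\<^esub> r"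
    and "g \<in> left_module_hom R Q N"
  shows "tensor_map R M N f g \<in> ahom (tensor_group R P Q) T"
  unfolding tensor_map_def
  using assms by (intro tensor_product.tensor_lift_hom balanced_tensor_map T.abelian_group_axioms)

lemma tensor_map_tens:
  assumes "tensor_product R P Q"
    and "f \<in> ahom P M" "\<And>p r. p \<in> carrier P \<Longrightarrow> r \<in> carrier R \<Longrightarrow> f (p \<triangleleft>\<^bsub>P\<^esub> r) = f p \<triangleleft>\<^bsub>M\<^esub> r"
    and "g \<in> left_module_hom R Q N" "p \<in> carrier P" "q \<in> carrier Q"
  shows "tensor_map R M N f g (tens R P Q p q) = ts (f p) (g q)"
  unfolding tensor_map_def
  using assms by (intro tensor_product.tensor_lift_tens balanced_tensor_map T.abelian_group_axioms)

lemma tensor_map_id: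
  assumes Q: "left_module R Q" and g: "g \<in> left_module_hom R Q N"
  shows "tensor_map R M N id g \<in> ahom (tensor_group R M Q) T"
    and "\<lbrakk>m \<in> carrier M; q \<in> carrier Q\<rbrakk> \<Longrightarrow> tensor_map R M N id g (tens R M Q m q) = ts m (g q)"
proof -
  have MQ: "tensor_product R M Q" and id: "id \<in> ahom M M"
    using right Q by (auto intro: tensor_product.intro ahomI)
  show "tensor_map R M N id g \<in> ahom (tensor_group R M Q) T"
    by (rule tensor_map_hom[OF MQ id _ g]) simp
  show "\<lbrakk>m \<in> carrier M; q \<in> carrier Q\<rbrakk> \<Longrightarrow> tensor_map R M N id g (tens R M Q m q) = ts m (g q)"
    using tensor_map_tens[OF MQ id _ g] by simp
qed

end

lemma tensor_fields [simp]:
  "carrier (tensor R M N) = carrier (tensor_group R M N)"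
  "ring.add (tensor R M N) = ring.add (tensor_group R M N)"
  "ring.zero (tensor R M N) = ring.zero (tensor_group R M N)"
  "smult (tensor R M N) a = tensor_lift (tensor_group R M N) (\<lambda>m n. tens R M N (a \<odot>\<^bsub>M\<^esub> m) n)"
  "rsmult (tensor R M N) t a = tensor_lift (tensor_group R M N) (\<lambda>m n. tens R M N m (n \<triangleleft>\<^bsub>N\<^esub> a)) t"
  by (simp_all add: tensor_def ring.extend_def)

text \<open>Here \<open>M\<close> carries a left and \<open>N\<close> a right action of a possibly larger ring \<open>A\<close>.\<close>

locale tensor_bimodule = tensor_product R M N
  for R :: "('a, 'z) ring_scheme" and M :: "('a, 'm, 'x) bimod_scheme"
    and N :: "('a, 'n, 'w) bimod_scheme" +
  fixes A :: "('a, 'y) ring_scheme"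
  assumes left_M: "left_module A M" and right_N: "right_module A N"
    and M_assoc: "\<lbrakk>a \<in> carrier A; r \<in> carrier R; m \<in> carrier M\<rbrakk> \<Longrightarrow>
      (a \<odot>\<^bsub>M\<^esub> m) \<triangleleft>\<^bsub>M\<^esub> r = a \<odot>\<^bsub>M\<^esub> (m \<triangleleft>\<^bsub>M\<^esub> r)"
    and N_assoc: "\<lbrakk>a \<in> carrier A; r \<in> carrier R; n \<in> carrier N\<rbrakk> \<Longrightarrow>
      (r \<odot>\<^bsub>N\<^esub> n) \<triangleleft>\<^bsub>N\<^esub> a = r \<odot>\<^bsub>N\<^esub> (n \<triangleleft>\<^bsub>N\<^esub> a)"
begin

sublocale lM: left_module A M by (rule left_M)
sublocale rN: right_module A N by (rule right_N)

lemma tensor_smult_hom: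
  assumes "a \<in> carrier A"
  shows "smult (tensor R M N) a \<in> ahom T T"
    and "\<And>m n. m \<in> carrier M \<Longrightarrow> n \<in> carrier N \<Longrightarrow>
      smult (tensor R M N) a (ts m n) = ts (a \<odot>\<^bsub>M\<^esub> m) n"
proof -
  have "balanced R M N T (\<lambda>m n. ts (a \<odot>\<^bsub>M\<^esub> m) n)"
    using assms by (intro balancedI)
      (simp_all add: lM.smult_closed lM.smult_r_distr tens_add_left tens_add_right M_assoc flip: tens_balanced)
  then show "smult (tensor R M N) a \<in> ahom T T"
    "\<And>m n. m \<in> carrier M \<Longrightarrow> n \<in> carrier N \<Longrightarrow> smult (tensor R M N) a (ts m n) = ts (a \<odot>\<^bsub>M\<^esub> m) n"
    using tensor_lift_hom tensor_lift_tens T.abelian_group_axioms by auto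
qed

lemma tensor_rsmult_hom:
  assumes "a \<in> carrier A"
  shows "(\<lambda>t. rsmult (tensor R M N) t a) \<in> ahom T T"
    and "\<And>m n. m \<in> carrier M \<Longrightarrow> n \<in> carrier N \<Longrightarrow>
      rsmult (tensor R M N) (ts m n) a = ts m (n \<triangleleft>\<^bsub>N\<^esub> a)"
proof -
  have "balanced R M N T (\<lambda>m n. ts m (n \<triangleleft>\<^bsub>N\<^esub> a))"
    using assms by (intro balancedI)
      (simp_all add: rN.rsmult_closed rN.rsmult_l_distr tens_add_left tens_add_right N_assoc tens_balanced)
  then show "(\<lambda>t. rsmult (tensor R M N) t a) \<in> ahom T T"
    "\<And>m n. m \<in> carrier M \<Longrightarrow> n \<in> carrier N \<Longrightarrow> rsmult (tensor R M N) (ts m n) a = ts m (n \<triangleleft>\<^bsub>N\<^esub> a)"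
    using tensor_lift_hom tensor_lift_tens T.abelian_group_axioms by auto
qed

abbreviation "TT \<equiv> tensor R M N"

lemma tensor_abelian_group: "abelian_group TT"
  by (rule abelian_group_cong[OF T.abelian_group_axioms]) simp_all

lemma tensor_left_module: "left_module A TT"
proof -
  interpret TT: abelian_group TT by (rule tensor_abelian_group)
  note sm = tensor_smult_hom(1) tensor_smult_hom(2)
  show ?thesis
  proof (intro left_module.intro left_module_axioms.intro lM.R.ring_axioms tensor_abelian_group)
    fix r t assume r: "r \<in> carrier A" and t: "t \<in> carrier TT"
    show "r \<odot>\<^bsub>TT\<^esub> t \<in> carrier TT"
      using ahom_closed[OF sm(1)[OF r]] t by (simp del: tensor_fields(4))
  next
    fix r s t assume r: "r \<in> carrier A" and s: "s \<in> carrier A" and t: "t \<in> carrier TT"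
    have rs: "r \<oplus>\<^bsub>A\<^esub> s \<in> carrier A" "r \<otimes>\<^bsub>A\<^esub> s \<in> carrier A" using r s by auto
    have t': "t \<in> carrier T" using t by simp
    show "(r \<oplus>\<^bsub>A\<^esub> s) \<odot>\<^bsub>TT\<^esub> t = (r \<odot>\<^bsub>TT\<^esub> t) \<oplus>\<^bsub>TT\<^esub> (s \<odot>\<^bsub>TT\<^esub> t)"
      by (rule tensor_hom_eqI[OF T.abelian_group_axioms sm(1)[OF rs(1)] _ _ t'])
        (insert r s rs, auto intro!: ahom_sum T.abelian_group_axioms sm(1) simp: sm(2) lM.smult_l_distr
          tens_add_left lM.smult_closed T.a_ac simp del: tensor_fields(4))
    show "(r \<otimes>\<^bsub>A\<^esub> s) \<odot>\<^bsub>TT\<^esub> t = r \<odot>\<^bsub>TT\<^esub> (s \<odot>\<^bsub>TT\<^esub> t)"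
      by (rule tensor_hom_eqI[OF T.abelian_group_axioms sm(1)[OF rs(2)] ahom_comp[OF sm(1)[OF s] sm(1)[OF r]] _ t'])
        (insert r s rs, auto simp: sm(2) lM.smult_assoc lM.smult_closed simp del: tensor_fields(4))
  next
    fix r t u assume r: "r \<in> carrier A" and t: "t \<in> carrier TT" "u \<in> carrier TT"
    show "r \<odot>\<^bsub>TT\<^esub> (t \<oplus>\<^bsub>TT\<^esub> u) = (r \<odot>\<^bsub>TT\<^esub> t) \<oplus>\<^bsub>TT\<^esub> (r \<odot>\<^bsub>TT\<^esub> u)"
      using ahom_add[OF sm(1)[OF r]] t by (simp del: tensor_fields(4))
  next
    fix t assume t: "t \<in> carrier TT"
    show "\<one>\<^bsub>A\<^esub> \<odot>\<^bsub>TT\<^esub> t = t"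
      by (rule tensor_hom_eqI[OF T.abelian_group_axioms sm(1)[OF lM.R.one_closed], where h = "\<lambda>t. t"])
       (insert t, auto intro!: ahomI simp: sm(2) lM.smult_one simp del: tensor_fields(4))
  qed
qed

lemma tensor_right_module: "right_module A TT"
proof -
  interpret TT: abelian_group TT by (rule tensor_abelian_group)
  note sm = tensor_rsmult_hom(1) tensor_rsmult_hom(2)
  show ?thesis
  proof (intro right_module.intro right_module_axioms.intro lM.R.ring_axioms tensor_abelian_group)
    fix r t assume r: "r \<in> carrier A" and t: "t \<in> carrier TT"
    show "t \<triangleleft>\<^bsub>TT\<^esub> r \<in> carrier TT"
      using ahom_closed[OF sm(1)[OF r]] t by (simp del: tensor_fields(5))
  next
    fix r s t assume r: "r \<in> carrier A" and s: "s \<in> carrier A" and t: "t \<in> carrier TT"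
    have rs: "r \<oplus>\<^bsub>A\<^esub> s \<in> carrier A" "r \<otimes>\<^bsub>A\<^esub> s \<in> carrier A" using r s by auto
    have t': "t \<in> carrier T" using t by simp
    show "t \<triangleleft>\<^bsub>TT\<^esub> (r \<oplus>\<^bsub>A\<^esub> s) = (t \<triangleleft>\<^bsub>TT\<^esub> r) \<oplus>\<^bsub>TT\<^esub> (t \<triangleleft>\<^bsub>TT\<^esub> s)"
      by (rule tensor_hom_eqI[OF T.abelian_group_axioms sm(1)[OF rs(1)] _ _ t'])
        (insert r s rs, auto intro!: ahom_sum T.abelian_group_axioms sm(1) simp: sm(2) rN.rsmult_r_distr
          tens_add_right rN.rsmult_closed T.a_ac simp del: tensor_fields(5))
    show "t \<triangleleft>\<^bsub>TT\<^esub> (r \<otimes>\<^bsub>A\<^esub> s) = (t \<triangleleft>\<^bsub>TT\<^esub> r) \<triangleleft>\<^bsub>TT\<^esub> s"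
      by (rule tensor_hom_eqI[OF T.abelian_group_axioms sm(1)[OF rs(2)] ahom_comp[OF sm(1)[OF r] sm(1)[OF s]] _ t'])
        (insert r s rs, auto simp: sm(2) rN.rsmult_assoc rN.rsmult_closed simp del: tensor_fields(5))
  next
    fix r t u assume r: "r \<in> carrier A" and t: "t \<in> carrier TT" "u \<in> carrier TT"
    show "(t \<oplus>\<^bsub>TT\<^esub> u) \<triangleleft>\<^bsub>TT\<^esub> r = (t \<triangleleft>\<^bsub>TT\<^esub> r) \<oplus>\<^bsub>TT\<^esub> (u \<triangleleft>\<^bsub>TT\<^esub> r)"
      using ahom_add[OF sm(1)[OF r]] t by (simp del: tensor_fields(5))
  next
    fix t assume t: "t \<in> carrier TT"
    show "t \<triangleleft>\<^bsub>TT\<^esub> \<one>\<^bsub>A\<^esub> = t"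
      by (rule tensor_hom_eqI[OF T.abelian_group_axioms sm(1)[OF lM.R.one_closed], where h = "\<lambda>t. t"])
       (insert t, auto intro!: ahomI simp: sm(2) rN.rsmult_one simp del: tensor_fields(5))
  qed
qed

lemma tensor_smult_rsmult_assoc:
  assumes "a \<in> carrier A" "b \<in> carrier A" "t \<in> carrier TT"
  shows "(a \<odot>\<^bsub>TT\<^esub> t) \<triangleleft>\<^bsub>TT\<^esub> b = a \<odot>\<^bsub>TT\<^esub> (t \<triangleleft>\<^bsub>TT\<^esub> b)"
proof -
  have t': "t \<in> carrier T" using assms by simp
  note sm = tensor_smult_hom tensor_rsmult_hom
  show ?thesis
    by (rule tensor_hom_eqI[OF T.abelian_group_axioms ahom_comp[OF sm(1)[OF assms(1)] sm(3)[OF assms(2)]]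
       ahom_comp[OF sm(3)[OF assms(2)] sm(1)[OF assms(1)]] _ t'])
     (insert assms, auto simp: sm(2,4) lM.smult_closed rN.rsmult_closed simp del: tensor_fields(4,5))
qed

text \<open>A scalar passes from the left end to the right end through the middle: it is symmetric
  on \<open>M\<close>, crosses the tensor sign because it lies in \<open>R\<close>, and is symmetric
  on \<open>N\<close>.\<close>

lemma tensor_bimodule:
  assumes "K_algebra K A \<eta>" "\<And>k. k \<in> carrier K \<Longrightarrow> \<eta> k \<in> carrier R"
    and "\<And>k m. k \<in> carrier K \<Longrightarrow> m \<in> carrier M \<Longrightarrow> \<eta> k \<odot>\<^bsub>M\<^esub> m = m \<triangleleft>\<^bsub>M\<^esub> \<eta> k"
    and "\<And>k n. k \<in> carrier K \<Longrightarrow> n \<in> carrier N \<Longrightarrow> \<eta> k \<odot>\<^bsub>N\<^esub> n = n \<triangleleft>\<^bsub>N\<^esub> \<eta> k"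
  shows "bimodule K A \<eta> TT"
proof (intro bimodule.intro bimodule_axioms.intro assms(1) tensor_left_module tensor_right_module
    tensor_smult_rsmult_assoc)
  fix k t assume k: "k \<in> carrier K" and t: "t \<in> carrier TT"
  interpret K_algebra K A \<eta> by fact
  have k': "\<eta> k \<in> carrier A" using k structure_hom by (auto simp: ring_hom_def)
  have t': "t \<in> carrier T" using t by simp
  note sm = tensor_smult_hom tensor_rsmult_hom
  show "\<eta> k \<odot>\<^bsub>TT\<^esub> t = t \<triangleleft>\<^bsub>TT\<^esub> \<eta> k"
    by (rule tensor_hom_eqI[OF T.abelian_group_axioms sm(1)[OF k'] sm(3)[OF k'] _ t'])
      (insert k k', auto simp: sm(2,4) assms tens_balanced simp del: tensor_fields(4,5))
qed

end

section \<open>Submodules, quotients and right exactness\<close>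

definition left_submodule ::
    "('a, 'z) ring_scheme \<Rightarrow> ('a, 'm, 'x) module_scheme \<Rightarrow> 'm set \<Rightarrow> bool"
  where "left_submodule R M P \<longleftrightarrow>
    additive_subgroup P M \<and> (\<forall>r\<in>carrier R. \<forall>p\<in>P. r \<odot>\<^bsub>M\<^esub> p \<in> P)"

lemma left_submodule_left_module:
  assumes "left_module R M" "left_submodule R M P"
  shows "left_module R (M\<lparr>carrier := P\<rparr>)"
proof -
  interpret left_module R M by fact
  interpret P: additive_subgroup P M using assms(2) by (simp add: left_submodule_def)
  have c: "p \<in> P \<Longrightarrow> p \<in> carrier M" for p using P.a_subset by blast
  show ?thesis
    using assms(2) additive_subgroup_abelian_group[OF M.abelian_group_axioms P.additive_subgroup_axioms]
    by (intro left_module.intro left_module_axioms.intro R.ring_axioms)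
      (auto simp: left_submodule_def c smult_l_distr smult_r_distr smult_assoc smult_one)
qed

lemma left_submodule_inclusion:
  assumes "left_submodule R M P"
  shows "id \<in> left_module_hom R (M\<lparr>carrier := P\<rparr>) M"
proof -
  interpret P: additive_subgroup P M using assms by (simp add: left_submodule_def)
  show ?thesis using P.a_subset by (intro left_module_homI) auto
qed

text \<open>A quotient by a subgroup, with carrier the image of an arbitrary map \<open>q\<close> whose fibres are
  the cosets; this allows the carrier to live in a prescribed type.\<close>

definition quot_group :: "('n, 'w) ring_scheme \<Rightarrow> ('n \<Rightarrow> 'u) \<Rightarrow> 'u ring"
  where "quot_group N q = \<lparr>carrier = q ` carrier N, monoid.mult = undefined, monoid.one = undefined,
    ring.zero = q \<zero>\<^bsub>N\<^esub>,
    ring.add = (\<lambda>u v. q (inv_into (carrier N) q u \<oplus>\<^bsub>N\<^esub> inv_into (carrier N) q v))\<rparr>"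

definition quot_module :: "('a, 'n, 'w) module_scheme \<Rightarrow> ('n \<Rightarrow> 'u) \<Rightarrow> ('a, 'u) module"
  where "quot_module N q = ring.extend (quot_group N q)
    \<lparr>smult = (\<lambda>a u. q (a \<odot>\<^bsub>N\<^esub> inv_into (carrier N) q u))\<rparr>"

lemma quot_module_fields [simp]:
  "carrier (quot_module N q) = carrier (quot_group N q)"
  "ring.add (quot_module N q) = ring.add (quot_group N q)"
  "ring.zero (quot_module N q) = ring.zero (quot_group N q)"
  "smult (quot_module N q) = (\<lambda>a u. q (a \<odot>\<^bsub>N\<^esub> inv_into (carrier N) q u))"
  by (simp_all add: quot_module_def ring.extend_def)

locale quotient =
  fixes N :: "('n, 'w) ring_scheme" and P :: "'n set" and q :: "'n \<Rightarrow> 'u"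
  assumes group: "abelian_group N" and subgroup: "additive_subgroup P N"
    and q_eq: "\<lbrakk>m \<in> carrier N; n \<in> carrier N\<rbrakk> \<Longrightarrow> q m = q n \<longleftrightarrow> m \<ominus>\<^bsub>N\<^esub> n \<in> P"
begin

sublocale N: abelian_group N by (rule group)
sublocale P: additive_subgroup P N by (rule subgroup)

abbreviation "rep \<equiv> inv_into (carrier N) q"

lemma rep_closed: "u \<in> q ` carrier N \<Longrightarrow> rep u \<in> carrier N"
  by (rule inv_into_into)

lemma q_rep: "u \<in> q ` carrier N \<Longrightarrow> q (rep u) = u"
  by (rule f_inv_into_f)

lemma rep_q_minus: "m \<in> carrier N \<Longrightarrow> rep (q m) \<ominus>\<^bsub>N\<^esub> m \<in> P"
  using q_eq[of "rep (q m)" m] rep_closed q_rep by simp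

lemma q_add_cong:
  assumes "m \<in> carrier N" "m' \<in> carrier N" "n \<in> carrier N" "n' \<in> carrier N"
    and "q m = q m'" "q n = q n'"
  shows "q (m \<oplus>\<^bsub>N\<^esub> n) = q (m' \<oplus>\<^bsub>N\<^esub> n')"
proof -
  have "(m \<oplus>\<^bsub>N\<^esub> n) \<ominus>\<^bsub>N\<^esub> (m' \<oplus>\<^bsub>N\<^esub> n') = (m \<ominus>\<^bsub>N\<^esub> m') \<oplus>\<^bsub>N\<^esub> (n \<ominus>\<^bsub>N\<^esub> n')"
    using assms by (simp add: a_minus_def N.minus_add N.a_ac)
  then show ?thesis
    using assms q_eq by (simp add: P.a_closed)
qed

lemma quot_add: "m \<in> carrier N \<Longrightarrow> n \<in> carrier N \<Longrightarrow> q m \<oplus>\<^bsub>quot_group N q\<^esub> q n = q (m \<oplus>\<^bsub>N\<^esub> n)"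
  by (auto simp: quot_group_def rep_closed q_rep intro!: q_add_cong)

lemma quot_carrier [simp]: "carrier (quot_group N q) = q ` carrier N"
  by (simp add: quot_group_def)

lemma quot_zero [simp]: "\<zero>\<^bsub>quot_group N q\<^esub> = q \<zero>\<^bsub>N\<^esub>"
  by (simp add: quot_group_def)

lemma quot_abelian_group: "abelian_group (quot_group N q)"
proof (rule abelian_groupI)
  fix u assume "u \<in> carrier (quot_group N q)"
  then obtain m where m: "m \<in> carrier N" "u = q m" by auto
  then have "q (\<ominus>\<^bsub>N\<^esub> m) \<oplus>\<^bsub>quot_group N q\<^esub> u = \<zero>\<^bsub>quot_group N q\<^esub>"
    by (simp add: quot_add N.l_neg)
  then show "\<exists>v\<in>carrier (quot_group N q). v \<oplus>\<^bsub>quot_group N q\<^esub> u = \<zero>\<^bsub>quot_group N q\<^esub>"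
    using m by auto
qed (auto simp: quot_add N.a_ac)

lemma quot_hom: "q \<in> ahom N (quot_group N q)"
  by (rule ahomI) (auto simp: quot_add)

lemma quot_zero_iff: "m \<in> carrier N \<Longrightarrow> q m = \<zero>\<^bsub>quot_group N q\<^esub> \<longleftrightarrow> m \<in> P"
  using q_eq[of m "\<zero>\<^bsub>N\<^esub>"] by (simp add: a_minus_def N.uminus_zero)

end

definition coset :: "('n, 'w) ring_scheme \<Rightarrow> 'n set \<Rightarrow> 'n \<Rightarrow> 'n set"
  where "coset N P m = {n \<in> carrier N. n \<ominus>\<^bsub>N\<^esub> m \<in> P}"

text \<open>The injective \<open>enc\<close> only moves the cosets to another type; their equality
  is unaffected.\<close>

lemma coset_quotient:
  assumes "abelian_group N" "additive_subgroup P N" "inj enc"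
  shows "quotient N P (\<lambda>m. enc ` coset N P m)"
proof (intro quotient.intro assms)
  fix m n assume m: "m \<in> carrier N" and n: "n \<in> carrier N"
  interpret N: abelian_group N by fact
  interpret P: additive_subgroup P N by fact
  have tr: "x \<ominus>\<^bsub>N\<^esub> z \<in> P" if "x \<ominus>\<^bsub>N\<^esub> y \<in> P" "y \<ominus>\<^bsub>N\<^esub> z \<in> P"
    "x \<in> carrier N" "y \<in> carrier N" "z \<in> carrier N" for x y z
  proof -
    have "x \<ominus>\<^bsub>N\<^esub> z = (x \<ominus>\<^bsub>N\<^esub> y) \<oplus>\<^bsub>N\<^esub> (y \<ominus>\<^bsub>N\<^esub> z)"
      using that(3-) by (simp add: a_minus_def N.a_assoc N.r_neg1)
    then show ?thesis using that P.a_closed by simp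
  qed
  have sy: "y \<ominus>\<^bsub>N\<^esub> x \<in> P" if "x \<ominus>\<^bsub>N\<^esub> y \<in> P" "x \<in> carrier N" "y \<in> carrier N" for x y
  proof -
    have "y \<ominus>\<^bsub>N\<^esub> x = \<ominus>\<^bsub>N\<^esub> (x \<ominus>\<^bsub>N\<^esub> y)"
      using that(2-) by (simp add: a_minus_def N.minus_add N.a_comm)
    then show ?thesis using that additive_subgroup_uminus[OF assms(1,2)] by simp
  qed
  have "coset N P m = coset N P n \<longleftrightarrow> m \<ominus>\<^bsub>N\<^esub> n \<in> P"
  proof
    have "m \<in> coset N P m" using m P.zero_closed N.r_neg by (simp add: coset_def a_minus_def)
    then show "m \<ominus>\<^bsub>N\<^esub> n \<in> P" if "coset N P m = coset N P n"
      using that by (auto simp: coset_def)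
    show "coset N P m = coset N P n" if "m \<ominus>\<^bsub>N\<^esub> n \<in> P"
      using tr[OF _ that _ m n] tr[OF _ sy[OF that m n] _ n m] by (auto simp: coset_def)
  qed
  then show "enc ` coset N P m = enc ` coset N P n \<longleftrightarrow> m \<ominus>\<^bsub>N\<^esub> n \<in> P"
    using assms(3) by (simp add: inj_image_eq_iff)
qed

lemma quot_module:
  assumes "left_module R N" "left_submodule R N P" "quotient N P q"
  shows "left_module R (quot_module N q)" "q \<in> left_module_hom R N (quot_module N q)"
proof -
  interpret quotient N P q by fact
  interpret left_module R N by fact
  let ?Q = "quot_module N q"
  have sm: "r \<odot>\<^bsub>?Q\<^esub> q m = q (r \<odot>\<^bsub>N\<^esub> m)" if "r \<in> carrier R" "m \<in> carrier N" for r m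
  proof -
    have "r \<odot>\<^bsub>N\<^esub> (rep (q m)) \<ominus>\<^bsub>N\<^esub> r \<odot>\<^bsub>N\<^esub> m = r \<odot>\<^bsub>N\<^esub> (rep (q m) \<ominus>\<^bsub>N\<^esub> m)"
      using that by (simp add: smult_minus_right rep_closed)
    also have "\<dots> \<in> P" using assms(2) that rep_q_minus by (simp add: left_submodule_def)
    finally show ?thesis using that by (simp add: q_eq smult_closed rep_closed)
  qed
  show "q \<in> left_module_hom R N ?Q"
    by (rule left_module_homI) (simp_all add: quot_add sm del: quot_module_fields(4))
  have Q: "abelian_group ?Q" by (rule abelian_group_cong[OF quot_abelian_group]) simp_all
  show "left_module R ?Q"
  proof (intro left_module.intro left_module_axioms.intro Q R.ring_axioms)
  qed (auto simp: quot_add sm smult_closed smult_l_distr smult_r_distr smult_assoc smult_one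
        simp del: quot_module_fields(4))
qed

context tensor_product
begin

text \<open>The image of M \<otimes> P in M \<otimes> N. It is kept apart from M \<otimes> P itself,
  since the map between them is injective only under a flatness assumption on
  \<open>M\<close>.\<close>

definition sub_image :: "'n set \<Rightarrow> ('m \<times> 'n \<Rightarrow>\<^sub>0 int) set set"
  where "sub_image P = tensor_map R M N id id ` carrier (tensor_group R M (N\<lparr>carrier := P\<rparr>))"

context
  fixes P assumes P: "left_submodule R N P"
begin

lemma tensor_product_sub: "tensor_product R M (N\<lparr>carrier := P\<rparr>)"
  using right left_submodule_left_module[OF left P] by (rule tensor_product.intro)

lemma sub_image_hom:
  obtains i where "i \<in> ahom (tensor_group R M (N\<lparr>carrier := P\<rparr>)) T"
    and "\<forall>m\<in>carrier M. \<forall>p\<in>P. i (tens R M (N\<lparr>carrier := P\<rparr>) m p) = ts m p"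
    and "sub_image P = i ` carrier (tensor_group R M (N\<lparr>carrier := P\<rparr>))"
proof
  note incl = tensor_map_id[OF left_submodule_left_module[OF left P] left_submodule_inclusion[OF P]]
  show "tensor_map R M N id id \<in> ahom (tensor_group R M (N\<lparr>carrier := P\<rparr>)) T"
    by (rule incl(1))
  show "\<forall>m\<in>carrier M. \<forall>p\<in>P. tensor_map R M N id id (tens R M (N\<lparr>carrier := P\<rparr>) m p) = ts m p"
    using incl(2) by simp
qed (rule sub_image_def)

lemma sub_image_subgroup: "additive_subgroup (sub_image P) T"
proof -
  interpret S: tensor_product R M "N\<lparr>carrier := P\<rparr>" by (rule tensor_product_sub)
  obtain i where i: "i \<in> ahom S.T T" "sub_image P = i ` carrier S.T"
    by (rule sub_image_hom) blast
  interpret i: abelian_group_hom S.T T i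
    using i(1) by (intro ahom_abelian_group_hom S.T.abelian_group_axioms T.abelian_group_axioms)
  show ?thesis
    unfolding i(2)
  proof (rule additive_subgroupI'[OF T.abelian_group_axioms])
    show "\<zero>\<^bsub>T\<^esub> \<in> i ` carrier S.T" using i.hom_zero S.T.zero_closed by (metis imageI)
    fix x assume "x \<in> i ` carrier S.T"
    then obtain s where s: "s \<in> carrier S.T" "x = i s" by blast
    then show "\<ominus>\<^bsub>T\<^esub> x \<in> i ` carrier S.T" using i.hom_a_inv S.T.a_inv_closed by (metis imageI)
    fix y assume "y \<in> i ` carrier S.T"
    then obtain t where t: "t \<in> carrier S.T" "y = i t" by blast
    then show "x \<oplus>\<^bsub>T\<^esub> y \<in> i ` carrier S.T"
      using s i.hom_add S.T.a_closed by (metis imageI)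
  qed auto
qed

lemma tens_sub_image:
  assumes "m \<in> carrier M" "p \<in> P"
  shows "ts m p \<in> sub_image P"
proof -
  interpret S: tensor_product R M "N\<lparr>carrier := P\<rparr>" by (rule tensor_product_sub)
  have "S.ts m p \<in> carrier S.T" using assms by (simp add: S.tens_closed)
  then show ?thesis using sub_image_hom assms by (metis imageI)
qed

lemma sub_image_induct [consumes 1, case_names zero tens add]:
  assumes "t \<in> sub_image P"
    and "Q \<zero>\<^bsub>T\<^esub>"
    and "\<And>m p. m \<in> carrier M \<Longrightarrow> p \<in> P \<Longrightarrow> Q (ts m p)"
    and "\<And>s t. s \<in> carrier T \<Longrightarrow> t \<in> carrier T \<Longrightarrow> Q s \<Longrightarrow> Q t \<Longrightarrow> Q (s \<oplus>\<^bsub>T\<^esub> t)"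
  shows "Q t"
proof -
  interpret S: tensor_product R M "N\<lparr>carrier := P\<rparr>" by (rule tensor_product_sub)
  obtain i where i: "i \<in> ahom S.T T"
    "\<forall>m\<in>carrier M. \<forall>p\<in>P. i (S.ts m p) = ts m p" "sub_image P = i ` carrier S.T"
    by (rule sub_image_hom) blast
  obtain s where s: "s \<in> carrier S.T" "t = i s" using assms(1) i(3) by blast
  have "Q (i s)"
    using s(1)
  proof (induction s rule: S.tensor_induct)
    case zero
    then show ?case
      using assms(2) ahom_zero[OF S.T.abelian_group_axioms T.abelian_group_axioms i(1)] by simp
  next
    case (tens m n)
    then show ?case using i(2) assms(3) by simp
  next
    case (add s t)
    then show ?case using assms(4) ahom_add[OF i(1)] ahom_closed[OF i(1)] by simp
  qed
  then show ?thesis using s by simp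
qed

text \<open>Right exactness of \<open>M \<otimes>\<^sub>R -\<close>: the inverse of \<open>(M \<otimes> N) / im (M \<otimes> P) \<rightarrow> M \<otimes> N/P\<close> is
  constructed from representatives.\<close>

lemma tensor_quotient_kernel:
  assumes "quotient N P q" "t \<in> carrier T"
    and zero: "tensor_map R M (quot_module N q) id q t = \<zero>\<^bsub>tensor_group R M (quot_module N q)\<^esub>"
  shows "t \<in> sub_image P"
proof -
  interpret q: quotient N P q by fact
  note quot = quot_module[OF left P assms(1)]
  let ?N1 = "quot_module N q"
  interpret S: tensor_product R M ?N1 using right quot(1) by (rule tensor_product.intro)
  let ?pr = "coset T (sub_image P)"
  interpret \<pi>: quotient T "sub_image P" ?pr
    using coset_quotient[OF T.abelian_group_axioms sub_image_subgroup inj_on_id] by simp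
  let ?G = "quot_group T ?pr"
  \<comment> \<open>Two representatives of a class differ by an element of \<open>P\<close>, so
    their tensors differ by an element of \<open>sub_image P\<close>.\<close>
  have key: "?pr (ts m n) = ?pr (ts m n')"
    if "m \<in> carrier M" "n \<in> carrier N" "n' \<in> carrier N" "q n = q n'" for m n n'
    using that \<pi>.q_eq[of "ts m n" "ts m n'"] tens_minus_right[of m n n'] q.q_eq[of n n']
      tens_sub_image[of m "n \<ominus>\<^bsub>N\<^esub> n'"]
    by simp
  define \<beta> where "\<beta> m u = ?pr (ts m (q.rep u))" for m u
  have \<beta>q: "\<beta> m (q n) = ?pr (ts m n)" if "m \<in> carrier M" "n \<in> carrier N" for m n
    unfolding \<beta>_def using that by (intro key) (auto simp: q.rep_closed q.q_rep)
  have q: "q \<in> ahom N ?N1" using quot(2) by (rule left_module_hom_ahom)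
  have bal: "balanced R M ?N1 ?G \<beta>"
  proof (rule balancedI)
    fix m u assume m: "m \<in> carrier M" and "u \<in> carrier ?N1"
    then obtain n where n: "n \<in> carrier N" "u = q n" by auto
    show "\<beta> m u \<in> carrier ?G" using \<beta>q m n by simp
    {
      fix m' assume m': "m' \<in> carrier M"
      show "\<beta> (m \<oplus>\<^bsub>M\<^esub> m') u = \<beta> m u \<oplus>\<^bsub>?G\<^esub> \<beta> m' u"
        using m m' n by (simp add: \<beta>q tens_add_left \<pi>.quot_add)
    next
      fix v assume "v \<in> carrier ?N1"
      then obtain n' where n': "n' \<in> carrier N" "v = q n'" by auto
      then show "\<beta> m (u \<oplus>\<^bsub>?N1\<^esub> v) = \<beta> m u \<oplus>\<^bsub>?G\<^esub> \<beta> m v"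
        using m n ahom_add[OF q, of n n', symmetric]
        by (simp add: \<beta>q tens_add_right \<pi>.quot_add)
    next
      fix r assume r: "r \<in> carrier R"
      have "r \<odot>\<^bsub>?N1\<^esub> u = q (r \<odot>\<^bsub>N\<^esub> n)"
        using left_module_hom_smult[OF quot(2) r n(1)] n by simp
      then show "\<beta> (m \<triangleleft>\<^bsub>M\<^esub> r) u = \<beta> m (r \<odot>\<^bsub>?N1\<^esub> u)"
        using m n r by (simp add: \<beta>q M.rsmult_closed N.smult_closed tens_balanced del: quot_module_fields)
    }
  qed
  let ?lift = "tensor_lift ?G \<beta>"
  note mq = S.tensor_map_id(1)[OF left quot(2)] and mqt = S.tensor_map_id(2)[OF left quot(2)]
  have l: "?lift \<in> ahom S.T ?G"
    by (rule S.tensor_lift_hom[OF \<pi>.quot_abelian_group bal])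
  \<comment> \<open>The lift undoes the induced map up to \<open>sub_image P\<close>. An element
    killed by the induced map is therefore killed by the projection modulo
    \<open>sub_image P\<close>.\<close>
  have "?lift (tensor_map R M ?N1 id q t) = ?pr t"
  proof (rule tensor_hom_eqI[OF \<pi>.quot_abelian_group ahom_comp[OF mq l] \<pi>.quot_hom _ assms(2)])
    fix m n assume "m \<in> carrier M" "n \<in> carrier N"
    then show "?lift (tensor_map R M ?N1 id q (ts m n)) = ?pr (ts m n)"
      using S.tensor_lift_tens[OF \<pi>.quot_abelian_group bal, of m "q n"]
      by (simp add: mqt \<beta>q)
  qed
  moreover have "?lift (tensor_map R M ?N1 id q t) = \<zero>\<^bsub>?G\<^esub>"
    unfolding zero by (rule ahom_zero[OF S.T.abelian_group_axioms \<pi>.quot_abelian_group l])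
  ultimately show ?thesis using \<pi>.quot_zero_iff[OF assms(2)] by simp
qed

end

lemma sub_image_mono:
  assumes "left_submodule R N P" "left_submodule R N P'" "P \<subseteq> P'"
  shows "sub_image P \<subseteq> sub_image P'"
proof
  fix t assume "t \<in> sub_image P"
  interpret I: additive_subgroup "sub_image P'" T by (rule sub_image_subgroup[OF assms(2)])
  from \<open>t \<in> sub_image P\<close> show "t \<in> sub_image P'"
  proof (induction t rule: sub_image_induct[OF assms(1), consumes 1, case_names zero tens add])
    case zero then show ?case by (rule I.zero_closed)
  next
    case (tens m p) then show ?case using assms by (auto intro!: tens_sub_image)
  next
    case (add s t) then show ?case by (intro I.a_closed)
  qed
qed

end

section \<open>Rings with idempotent left ideals\<close>

text \<open>The chain condition on right ideals is deduced from the one on left ideals through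
  annihilators.\<close>

locale left_idempotent_ring = ring R for R (structure) +
  assumes idempotent_generator: "left_ideal I R \<Longrightarrow> \<exists>z\<in>I. \<forall>i\<in>I. i \<otimes> z = i"
begin

lemma left_idealD:
  assumes "left_ideal I R"
  shows "I \<subseteq> carrier R" "\<zero> \<in> I" "\<And>x y. x \<in> I \<Longrightarrow> y \<in> I \<Longrightarrow> x \<oplus> y \<in> I"
    "\<And>x. x \<in> I \<Longrightarrow> \<ominus> x \<in> I" "\<And>r x. r \<in> carrier R \<Longrightarrow> x \<in> I \<Longrightarrow> r \<otimes> x \<in> I"
proof -
  interpret additive_subgroup I R using assms by (simp add: left_ideal_def)
  show "I \<subseteq> carrier R" "\<zero> \<in> I" "\<And>x y. x \<in> I \<Longrightarrow> y \<in> I \<Longrightarrow> x \<oplus> y \<in> I"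
    "\<And>x. x \<in> I \<Longrightarrow> \<ominus> x \<in> I" "\<And>r x. r \<in> carrier R \<Longrightarrow> x \<in> I \<Longrightarrow> r \<otimes> x \<in> I"
    using assms a_subset additive_subgroup_uminus[OF abelian_group_axioms additive_subgroup_axioms]
    by (auto simp: left_ideal_def)
qed

lemma left_idealI:
  assumes "I \<subseteq> carrier R" "\<zero> \<in> I" "\<And>x y. x \<in> I \<Longrightarrow> y \<in> I \<Longrightarrow> x \<oplus> y \<in> I"
    "\<And>r x. r \<in> carrier R \<Longrightarrow> x \<in> I \<Longrightarrow> r \<otimes> x \<in> I"
  shows "left_ideal I R"
proof -
  have "\<ominus> x \<in> I" if "x \<in> I" for x
    using assms(4)[of "\<ominus> \<one>" x] that assms(1) by (auto simp: l_minus)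
  then show ?thesis
    using assms by (auto simp: left_ideal_def intro!: additive_subgroupI' abelian_group_axioms)
qed

lemma left_ideal_Union_chain:
  fixes J :: "nat \<Rightarrow> 'a set"
  assumes "\<And>n. left_ideal (J n) R" "\<And>n. J n \<subseteq> J (Suc n)"
  shows "left_ideal (\<Union>n. J n) R"
proof (rule left_idealI)
  have mono: "J m \<subseteq> J n" if "m \<le> n" for m n
    using assms(2) that by (rule lift_Suc_mono_le)
  fix x y assume "x \<in> (\<Union>n. J n)" "y \<in> (\<Union>n. J n)"
  then obtain m n where "x \<in> J m" "y \<in> J n" by auto
  then have "x \<in> J (max m n)" "y \<in> J (max m n)"
    using mono[of m "max m n"] mono[of n "max m n"] by auto
  then have "x \<oplus> y \<in> J (max m n)" by (rule left_idealD(3)[OF assms(1)])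
  then show "x \<oplus> y \<in> (\<Union>n. J n)" by blast
next
  show "(\<Union>n. J n) \<subseteq> carrier R" using left_idealD(1)[OF assms(1)] by blast
  show "\<zero> \<in> (\<Union>n. J n)" using left_idealD(2)[OF assms(1)] by blast
  fix r x assume "r \<in> carrier R" "x \<in> (\<Union>n. J n)"
  then show "r \<otimes> x \<in> (\<Union>n. J n)" using left_idealD(5)[OF assms(1)] by blast
qed

text \<open>The union of the chain is a left ideal, so it has a right unit \<open>j\<close> inside
  it, and \<open>j\<close> already lies in some member \<open>J N\<close>. From i = i j the chain is
  constant from \<open>N\<close> on.\<close>

lemma ascending_chain_generator:
  fixes J :: "nat \<Rightarrow> 'a set"
  assumes "\<And>n. left_ideal (J n) R" "\<And>n. J n \<subseteq> J (Suc n)"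
  obtains N j where "j \<in> J N" "\<And>n i. i \<in> J n \<Longrightarrow> i \<otimes> j = i"
proof -
  obtain j where "j \<in> (\<Union>n. J n)" "\<forall>i\<in>(\<Union>n. J n). i \<otimes> j = i"
    using idempotent_generator[OF left_ideal_Union_chain, of J] assms by blast
  then show ?thesis using that by blast
qed

text \<open>Right units \<open>e n\<close> of the members turn the descending chain into the
  ascending chain of the left annihilators of the \<open>e n\<close>, and the latter stops by
  \<open>ascending_chain_generator\<close>.\<close>

lemma left_dcc:
  fixes I :: "nat \<Rightarrow> 'a set"
  assumes I: "\<And>n. left_ideal (I n) R" and dec: "\<And>n. I (Suc n) \<subseteq> I n"
  shows "\<exists>n. \<forall>m\<ge>n. I m = I n"
proof -
  have "\<exists>z. z \<in> I n \<and> (\<forall>i\<in>I n. i \<otimes> z = i)" for n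
    using idempotent_generator[OF I] by blast
  then obtain z where z: "\<And>n. z n \<in> I n" "\<And>n i. i \<in> I n \<Longrightarrow> i \<otimes> z n = i" by metis
  have anti: "I n \<subseteq> I m" if "m \<le> n" for m n
    using dec that by (rule lift_Suc_antimono_le)
  have car: "i \<in> carrier R" if "i \<in> I n" for i n using left_idealD(1)[OF I] that by blast
  \<comment> \<open>Arbitrary right units \<open>z n\<close> need not have nested annihilators. The
    product of \<open>e n\<close> with \<open>z (Suc n)\<close> is killed by whatever kills
    \<open>e n\<close>, and it is still a right unit of \<open>I (Suc n)\<close> because that ideal
    is contained in \<open>I n\<close>.\<close>
  define e where "e = rec_nat (z 0) (\<lambda>n x. x \<otimes> z (Suc n))"
  have e_Suc: "e (Suc n) = e n \<otimes> z (Suc n)" for n by (simp add: e_def)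
  have e: "e n \<in> I n \<and> (\<forall>i\<in>I n. i \<otimes> e n = i)" for n
  proof (induction n)
    case 0
    then show ?case using z by (simp add: e_def)
  next
    case (Suc n)
    have "i \<otimes> e (Suc n) = i" if "i \<in> I (Suc n)" for i
    proof -
      have "i \<otimes> e (Suc n) = (i \<otimes> e n) \<otimes> z (Suc n)"
        using m_assoc[OF car[OF that] car[of "e n" n] car[OF z(1)[of "Suc n"]]] Suc by (simp add: e_Suc)
      moreover have "i \<in> I n" using dec that by blast
      ultimately show ?thesis using Suc z(2)[OF that] by simp
    qed
    then show ?case
      using left_idealD(5)[OF I] Suc car z(1) by (auto simp: e_Suc)
  qed
  have ec: "e n \<in> carrier R" for n using e car by blast
  define J where "J n = {r \<in> carrier R. r \<otimes> e n = \<zero>}" for n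
  have J: "left_ideal (J n) R" for n
    by (rule left_idealI) (auto simp: J_def ec l_distr m_assoc)
  have J_mono: "J n \<subseteq> J (Suc n)" for n
  proof
    fix r assume "r \<in> J n"
    then show "r \<in> J (Suc n)"
      using ec car[OF z(1)] by (simp add: J_def e_Suc flip: m_assoc)
  qed
  obtain N j where j: "j \<in> J N" "\<And>n i. i \<in> J n \<Longrightarrow> i \<otimes> j = i"
    by (rule ascending_chain_generator[of J, OF J J_mono]) blast
  have "I m = I N" if m: "m \<ge> N" for m
  proof
    show "I m \<subseteq> I N" using anti[OF m] .
    have em: "e m \<otimes> e N = e m" "e m \<otimes> e m = e m" using e anti[OF m] by blast+
    have jc: "j \<in> carrier R" "j \<otimes> e N = \<zero>" using j(1) by (auto simp: J_def)
    \<comment> \<open>\<open>?u\<close> kills \<open>e m\<close>, hence equals \<open>?u\<close>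
      times \<open>j\<close>, and \<open>j\<close> kills \<open>e N\<close>. So \<open>?u\<close>
      kills \<open>e N\<close> as well, which gives e N = e m e N = e m.\<close>
    let ?u = "\<one> \<ominus> e m"
    have u: "?u \<in> carrier R" using ec by simp
    have "?u \<otimes> e m = \<zero>" using ec[of m] em(2)
      by (simp add: a_minus_def l_distr l_minus r_neg)
    then have "?u \<in> J m" using u by (simp add: J_def)
    then have "?u = ?u \<otimes> j" using j(2) by simp
    then have "?u \<otimes> e N = ?u \<otimes> (j \<otimes> e N)" using u jc ec by (metis m_assoc)
    then have "?u \<otimes> e N = \<zero>" using jc u by simp
    moreover have "?u \<otimes> e N = e N \<ominus> e m"
      using ec[of m] ec[of N] em(1) by (simp add: a_minus_def l_distr l_minus)
    ultimately have "e N = e m" using ec by (simp add: minus_eq_zero_iff)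
    then have "e N \<in> I m" using e by metis
    then show "I N \<subseteq> I m"
      using e[of N] left_idealD(5)[OF I] car by (metis subsetI)
  qed
  then show ?thesis by blast
qed

text \<open>Von Neumann regularity. The principal left ideal R a contains \<open>a\<close> and has a
  right unit, necessarily of the form r a.\<close>

lemma regular:
  assumes "a \<in> carrier R"
  obtains r where "r \<in> carrier R" "a \<otimes> r \<otimes> a = a"
proof -
  have "left_ideal ((\<lambda>r. r \<otimes> a) ` carrier R) R"
  proof (rule left_idealI)
    show "\<zero> \<in> (\<lambda>r. r \<otimes> a) ` carrier R" using assms by (auto intro!: image_eqI[where x = \<zero>])
  qed (auto simp: assms simp flip: l_distr m_assoc)
  then obtain z where z: "z \<in> (\<lambda>r. r \<otimes> a) ` carrier R"
    "\<forall>i\<in>(\<lambda>r. r \<otimes> a) ` carrier R. i \<otimes> z = i"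
    using idempotent_generator by blast
  then obtain r where r: "r \<in> carrier R" "z = r \<otimes> a" by blast
  have "a \<in> (\<lambda>r. r \<otimes> a) ` carrier R" using assms by (auto intro!: image_eqI[where x = \<one>])
  then have "a \<otimes> (r \<otimes> a) = a" using bspec[OF z(2)] r(2) by metis
  then show ?thesis using that r assms by (simp add: m_assoc)
qed

section \<open>Annihilators and right ideals\<close>

definition annihilator :: "'a set \<Rightarrow> 'a set"
  where "annihilator I = {r \<in> carrier R. \<forall>i\<in>I. r \<otimes> i = \<zero>}"

lemma left_ideal_annihilator: "I \<subseteq> carrier R \<Longrightarrow> left_ideal (annihilator I) R"
  by (rule left_idealI) (auto simp: annihilator_def subset_iff l_distr m_assoc)

text \<open>This form of the chain condition on left ideals lets an idempotent with minimal left
  annihilator be chosen.\<close>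

lemma left_ideals_wf: "wf {(X, Y). left_ideal X R \<and> left_ideal Y R \<and> X \<subset> Y}"
proof -
  have False if f: "\<And>i. (f (Suc i), f i) \<in> {(X, Y). left_ideal X R \<and> left_ideal Y R \<and> X \<subset> Y}"
    for f :: "nat \<Rightarrow> 'a set"
  proof -
    have l: "left_ideal (f i) R" and s: "f (Suc i) \<subset> f i" for i using f[of i] by auto
    obtain n where n: "\<forall>m\<ge>n. f m = f n" using left_dcc[of f, OF l psubset_imp_subset[OF s]] by blast
    have "f (Suc n) = f n" using n by (metis lessI less_imp_le)
    then show False using s[of n] by simp
  qed
  then show ?thesis unfolding wf_iff_no_infinite_down_chain by blast
qed

text \<open>Among the idempotents of \<open>I\<close> let \<open>u\<close> have minimal left
  annihilator. If u i differed from i, regularity applied to i - u i would produce an idempotent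
  \<open>h\<close> with u h = 0, and combining \<open>h\<close> with \<open>u\<close> would give an
  idempotent with a strictly smaller annihilator.\<close>

lemma right_ideal_idempotent:
  assumes "right_ideal I R"
  obtains u where "u \<in> I" "\<And>i. i \<in> I \<Longrightarrow> u \<otimes> i = i"
proof -
  interpret I: additive_subgroup I R using assms by (simp add: right_ideal_def)
  have Ic: "i \<in> carrier R" if "i \<in> I" for i using that I.a_subset by blast
  have Ir: "i \<otimes> r \<in> I" if "i \<in> I" "r \<in> carrier R" for i r
    using that assms by (simp add: right_ideal_def)
  have Im: "i \<ominus> j \<in> I" if "i \<in> I" "j \<in> I" for i j
    using additive_subgroup_minus[OF abelian_group_axioms I.additive_subgroup_axioms that] .
  let ?U = "{u \<in> I. u \<otimes> u = u}"
  \<comment> \<open>The idempotent 0 shows that there is something to minimise over.\<close>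
  have "annihilator {\<zero>} \<in> (\<lambda>u. annihilator {u}) ` ?U" by auto
  then obtain M where M: "M \<in> (\<lambda>u. annihilator {u}) ` ?U"
    "\<And>Y. (Y, M) \<in> {(X, Y). left_ideal X R \<and> left_ideal Y R \<and> X \<subset> Y} \<Longrightarrow> Y \<notin> (\<lambda>u. annihilator {u}) ` ?U"
    by (rule wfE_min[OF left_ideals_wf]) blast
  then obtain u where u: "u \<in> I" "u \<otimes> u = u" "M = annihilator {u}" by blast
  have uc: "u \<in> carrier R" using u Ic by blast
  have "u \<otimes> i = i" if i: "i \<in> I" for i
  proof (rule ccontr)
    assume ne: "u \<otimes> i \<noteq> i"
    have ic: "i \<in> carrier R" using i Ic by blast
    let ?a = "i \<ominus> u \<otimes> i"
    have a: "?a \<in> I" using Im[OF i Ir[OF u(1) ic]] .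
    then have ac: "?a \<in> carrier R" by (rule Ic)
    obtain r where r: "r \<in> carrier R" "?a \<otimes> r \<otimes> ?a = ?a" by (rule regular[OF ac])
    define h where "h = ?a \<otimes> r"
    have h: "h \<in> I" "h \<in> carrier R" using Ir[OF a r(1)] Ic by (auto simp: h_def)
    have ua: "u \<otimes> ?a = \<zero>"
    proof -
      have "u \<otimes> ?a = u \<otimes> i \<ominus> (u \<otimes> u) \<otimes> i"
        using uc ic by (simp add: a_minus_def r_distr r_minus m_assoc)
      then show ?thesis using u(2) uc ic by (simp add: a_minus_def r_neg)
    qed
    have hh: "h \<otimes> h = h"
      using r ac by (simp add: h_def flip: m_assoc)
    have uh: "u \<otimes> h = \<zero>" using ua uc ac r by (simp add: h_def flip: m_assoc)
    \<comment> \<open>\<open>h\<close> is orthogonal to \<open>u\<close> on one side only.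
      Subtracting h u makes the correction orthogonal on both sides, so that the sum is idempotent.
      It satisfies w u = u, and 1 - u kills \<open>u\<close> but not \<open>w\<close>.\<close>
    define w where "w = u \<oplus> (h \<ominus> h \<otimes> u)"
    have w: "w \<in> I" using u(1) h Im Ir uc by (simp add: w_def)
    have wc: "w \<in> carrier R" using w Ic by blast
    have wu: "w \<otimes> u = u"
      using u(2) h uc by (simp add: w_def a_minus_def l_distr l_minus m_assoc r_neg)
    have wh: "w \<otimes> h = h"
      using uh hh h uc by (simp add: w_def a_minus_def l_distr l_minus m_assoc)
    have "w \<otimes> w = w \<otimes> u \<oplus> (w \<otimes> h \<ominus> (w \<otimes> h) \<otimes> u)"
      using h uc wc by (subst (2) w_def) (simp add: a_minus_def r_distr r_minus m_assoc)
    then have "w \<otimes> w = w" using wu wh by (simp add: w_def)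
    then have "annihilator {w} \<in> (\<lambda>u. annihilator {u}) ` ?U" using w by blast
    moreover have "annihilator {w} \<subset> M"
    proof
      show "annihilator {w} \<subseteq> M"
      proof
        fix r assume "r \<in> annihilator {w}"
        then have r: "r \<in> carrier R" "r \<otimes> w = \<zero>" by (auto simp: annihilator_def)
        have "r \<otimes> u = (r \<otimes> w) \<otimes> u" using wu m_assoc[OF r(1) wc uc] by simp
        then show "r \<in> M" using r uc u(3) by (simp add: annihilator_def)
      qed
      have "\<one> \<ominus> u \<in> M"
        using u uc by (simp add: annihilator_def a_minus_def l_distr l_minus r_neg)
      moreover have "\<one> \<ominus> u \<notin> annihilator {w}"
      proof
        assume "\<one> \<ominus> u \<in> annihilator {w}"
        then have "(\<one> \<ominus> u) \<otimes> w = \<zero>" by (simp add: annihilator_def)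
        moreover have "(\<one> \<ominus> u) \<otimes> w = w \<ominus> u \<otimes> w"
          using uc wc by (simp add: a_minus_def l_distr l_minus)
        moreover have "u \<otimes> w = u"
          using uh u(2) uc h by (simp add: w_def a_minus_def r_distr r_minus flip: m_assoc)
        ultimately have "w = u" using uc wc by (simp add: minus_eq_zero_iff)
        then have "h = \<zero>" using wh uh by simp
        then have "?a = \<zero>" using r ac by (simp add: h_def)
        then show False using minus_eq_zero_iff[of i "u \<otimes> i"] ne uc ic by simp
      qed
      ultimately show "annihilator {w} \<noteq> M" by blast
    qed
    ultimately show False
      using M(2)[of "annihilator {w}"] left_ideal_annihilator[of "{w}"] left_ideal_annihilator[of "{u}"]
        u(3) uc wc by auto
  qed
  then show ?thesis using that u(1) by blast
qed

text \<open>The left annihilators ascend and so stop at some \<open>J N\<close> with right unit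
  \<open>j\<close>. If \<open>u\<close> is a left unit of \<open>I m\<close>, then 1 - u kills
  \<open>I m\<close>, hence equals (1 - u) j; since \<open>j\<close> kills \<open>I N\<close>, every
  i in \<open>I N\<close> is u i and lies in \<open>I m\<close>.\<close>

lemma right_dcc:
  fixes I :: "nat \<Rightarrow> 'a set"
  assumes I: "\<And>n. right_ideal (I n) R" and dec: "\<And>n. I (Suc n) \<subseteq> I n"
  shows "\<exists>n. \<forall>m\<ge>n. I m = I n"
proof -
  have anti: "I n \<subseteq> I m" if "m \<le> n" for m n
    using dec that by (rule lift_Suc_antimono_le)
  have car: "i \<in> carrier R" if "i \<in> I n" for i n
    using I[of n] that additive_subgroup.a_subset[of "I n" R] by (auto simp: right_ideal_def)
  have l: "left_ideal (annihilator (I n)) R" for n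
    using car by (intro left_ideal_annihilator) auto
  have s: "annihilator (I n) \<subseteq> annihilator (I (Suc n))" for n
    using dec by (auto simp: annihilator_def)
  obtain N j where j: "j \<in> annihilator (I N)"
    "\<And>n i. i \<in> annihilator (I n) \<Longrightarrow> i \<otimes> j = i"
    by (rule ascending_chain_generator[of "\<lambda>n. annihilator (I n)", OF l s]) blast
  have "I m = I N" if m: "m \<ge> N" for m
  proof
    show "I m \<subseteq> I N" using anti[OF m] .
    obtain u where u: "u \<in> I m" "\<And>i. i \<in> I m \<Longrightarrow> u \<otimes> i = i"
      using right_ideal_idempotent[OF I] by blast
    have uc: "u \<in> carrier R" using u(1) by (rule car)
    have v: "\<one> \<ominus> u \<in> annihilator (I m)"
      using u uc car by (auto simp: annihilator_def a_minus_def l_distr l_minus r_neg)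
    have jc: "j \<in> carrier R" using j(1) by (simp add: annihilator_def)
    show "I N \<subseteq> I m"
    proof
      fix i assume i: "i \<in> I N"
      then have ic: "i \<in> carrier R" by (rule car)
      have "(\<one> \<ominus> u) \<otimes> i = (\<one> \<ominus> u) \<otimes> (j \<otimes> i)"
        using j(2)[OF v] uc ic jc by (metis m_assoc minus_closed one_closed)
      also have "\<dots> = \<zero>" using j(1) i uc by (simp add: annihilator_def)
      finally have "u \<otimes> i = i"
        using uc ic by (simp add: a_minus_def l_distr l_minus) (metis minus_eq minus_eq_zero_iff m_closed)
      then show "i \<in> I m"
        using I[of m] u(1) ic by (metis right_ideal_def)
    qed
  qed
  then show ?thesis by blast
qed

lemma artinian_ring: "artinian_ring R"
  unfolding artinian_ring_def using ring_axioms left_dcc right_dcc by blast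

text \<open>A right unit \<open>z\<close> of the ideal is also a left unit: for y = i - z i and y r
  y = y, the element y r lies in the ideal, so y r z = y r and therefore y = y r i - y r z i =
  0.\<close>

lemma two_sided_ideal_unit:
  assumes "ideal I R"
  obtains z where "z \<in> I" "\<And>i. i \<in> I \<Longrightarrow> i \<otimes> z = i" "\<And>i. i \<in> I \<Longrightarrow> z \<otimes> i = i"
proof -
  interpret I: ideal I R by fact
  have "left_ideal I R" using I.additive_subgroup_axioms I.I_l_closed by (auto simp: left_ideal_def)
  then obtain z where z: "z \<in> I" "\<And>i. i \<in> I \<Longrightarrow> i \<otimes> z = i" using idempotent_generator by blast
  have "z \<otimes> i = i" if i: "i \<in> I" for i
  proof -
    let ?y = "i \<ominus> z \<otimes> i"
    have c: "i \<in> carrier R" "z \<in> carrier R" using i z I.a_subset by auto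
    then have y: "?y \<in> carrier R" by simp
    obtain r where r: "r \<in> carrier R" "?y \<otimes> r \<otimes> ?y = ?y" by (rule regular[OF y])
    have "?y \<in> I"
      using additive_subgroup_minus[OF abelian_group_axioms I.additive_subgroup_axioms i]
        I.I_l_closed[OF i c(2)] by simp
    then have "?y \<otimes> r \<otimes> z = ?y \<otimes> r" using z(2) I.I_r_closed r(1) by blast
    moreover have "?y \<otimes> r \<otimes> ?y = ?y \<otimes> r \<otimes> i \<ominus> (?y \<otimes> r \<otimes> z) \<otimes> i"
      using c r y by (simp add: a_minus_def[of R "?y \<otimes> r \<otimes> i"] m_assoc)
       (simp add: a_minus_def r_distr r_minus m_assoc)
    ultimately have "?y = \<zero>" using r c y by (simp add: a_minus_def r_neg)
    then show ?thesis using minus_eq_zero_iff[of i "z \<otimes> i"] c by simp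
  qed
  then show ?thesis using that z by blast
qed

end

section \<open>Subcomodules\<close>

lemma regular_bimodule_fields [simp]:
  "carrier (regular_bimodule A) = carrier A"
  "ring.add (regular_bimodule A) = ring.add A"
  "ring.zero (regular_bimodule A) = ring.zero A"
  "smult (regular_bimodule A) = monoid.mult A"
  "rsmult (regular_bimodule A) = monoid.mult A"
  by (simp_all add: regular_bimodule_def)

lemma (in ring) regular_bimodule_abelian_group: "abelian_group (regular_bimodule R)"
  by (rule abelian_group_cong[OF abelian_group_axioms]) simp_all

lemma (in ring) regular_left_module: "left_module R (regular_bimodule R)"
  by (intro left_module.intro left_module_axioms.intro ring_axioms regular_bimodule_abelian_group)
    (simp_all add: l_distr r_distr m_assoc)

lemma (in ring) regular_right_module: "right_module R (regular_bimodule R)"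
  by (intro right_module.intro right_module_axioms.intro ring_axioms regular_bimodule_abelian_group)
    (simp_all add: l_distr r_distr m_assoc)

lemma (in bimodule) tensor_bimodule_self: "tensor_bimodule A M M A"
  by (intro tensor_bimodule.intro tensor_product.intro tensor_bimodule_axioms.intro
      left_module_axioms right_module_axioms) (simp_all add: smult_rsmult_assoc)

section \<open>Contractions and preimages of subcomodules\<close>

context coring
begin

sublocale CC: tensor_bimodule A C C A by (rule tensor_bimodule_self)

abbreviation "\<Delta> \<equiv> comult C"
abbreviation "\<epsilon> \<equiv> counit C"

lemma comult_left_hom: "\<Delta> \<in> left_module_hom A C (tensor A C C)"
  using comult_hom by (simp add: bimodule_hom_def)

lemma comult_ahom: "\<Delta> \<in> ahom C CC.T"
  using left_module_hom_ahom[OF comult_left_hom] by (simp add: ahom_def hom_def)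

lemma comult_smult: "a \<in> carrier A \<Longrightarrow> c \<in> carrier C \<Longrightarrow> \<Delta> (a \<odot>\<^bsub>C\<^esub> c) = a \<odot>\<^bsub>CC.TT\<^esub> \<Delta> c"
  using left_module_hom_smult[OF comult_left_hom] .

lemma comult_rsmult: "a \<in> carrier A \<Longrightarrow> c \<in> carrier C \<Longrightarrow> \<Delta> (c \<triangleleft>\<^bsub>C\<^esub> a) = \<Delta> c \<triangleleft>\<^bsub>CC.TT\<^esub> a"
  using comult_hom unfolding bimodule_hom_def by blast

lemma counit_left_hom: "\<epsilon> \<in> left_module_hom A C (regular_bimodule A)"
  using counit_hom by (simp add: bimodule_hom_def)

lemma counit_ahom: "\<epsilon> \<in> ahom C A"
  using left_module_hom_ahom[OF counit_left_hom] by (simp add: ahom_def hom_def)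

lemma counit_closed [simp]: "c \<in> carrier C \<Longrightarrow> \<epsilon> c \<in> carrier A"
  by (rule ahom_closed[OF counit_ahom])

lemma counit_smult: "a \<in> carrier A \<Longrightarrow> c \<in> carrier C \<Longrightarrow> \<epsilon> (a \<odot>\<^bsub>C\<^esub> c) = a \<otimes>\<^bsub>A\<^esub> \<epsilon> c"
  using left_module_hom_smult[OF counit_left_hom] by simp

lemma counit_rsmult: "a \<in> carrier A \<Longrightarrow> c \<in> carrier C \<Longrightarrow> \<epsilon> (c \<triangleleft>\<^bsub>C\<^esub> a) = \<epsilon> c \<otimes>\<^bsub>A\<^esub> a"
  using counit_hom unfolding bimodule_hom_def by auto

lemma left_subcomodule_iff:
  "left_subcomodule A C C \<Delta> N \<longleftrightarrow> left_submodule A C N \<and> \<Delta> ` N \<subseteq> CC.sub_image N"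
  by (auto simp: left_subcomodule_def left_submodule_def CC.sub_image_def)

definition contract :: "('c \<Rightarrow> 'a) \<Rightarrow> ('c \<times> 'c \<Rightarrow>\<^sub>0 int) set \<Rightarrow> 'c"
  where "contract f = tensor_lift C (\<lambda>c d. c \<triangleleft>\<^bsub>C\<^esub> f d)"

lemma contract:
  assumes "f \<in> ahom C A" "\<And>a c. a \<in> carrier A \<Longrightarrow> c \<in> carrier C \<Longrightarrow> f (a \<odot>\<^bsub>C\<^esub> c) = a \<otimes>\<^bsub>A\<^esub> f c"
  shows "contract f \<in> ahom CC.T C"
    and "c \<in> carrier C \<Longrightarrow> d \<in> carrier C \<Longrightarrow> contract f (CC.ts c d) = c \<triangleleft>\<^bsub>C\<^esub> f d"
proof -
  have "balanced A C C C (\<lambda>c d. c \<triangleleft>\<^bsub>C\<^esub> f d)"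
    using assms by (intro balancedI)
      (simp_all add: ahom_closed ahom_add rsmult_closed rsmult_l_distr rsmult_r_distr rsmult_assoc)
  then show "contract f \<in> ahom CC.T C"
    "c \<in> carrier C \<Longrightarrow> d \<in> carrier C \<Longrightarrow> contract f (CC.ts c d) = c \<triangleleft>\<^bsub>C\<^esub> f d"
    unfolding contract_def by (auto intro!: CC.tensor_lift_hom CC.tensor_lift_tens M.abelian_group_axioms)
qed

lemma contract_counit:
  assumes "c \<in> carrier C"
  shows "contract \<epsilon> (\<Delta> c) = c"
proof -
  let ?A = "regular_bimodule A"
  interpret CA: tensor_product A C ?A
    by (intro tensor_product.intro right_module_axioms A.regular_left_module)
  let ?f = "tensor_map A C ?A id \<epsilon>" and ?h = "tensor_lift C (\<lambda>c a. c \<triangleleft>\<^bsub>C\<^esub> a)"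
  have bal: "balanced A C ?A C (\<lambda>c a. c \<triangleleft>\<^bsub>C\<^esub> a)"
    by (intro balancedI) (simp_all add: rsmult_closed rsmult_l_distr rsmult_r_distr rsmult_assoc)
  note f = CA.tensor_map_id(1)[OF left_module_axioms counit_left_hom]
  have h: "?h \<in> ahom CA.T C" by (rule CA.tensor_lift_hom[OF M.abelian_group_axioms bal])
  have \<Delta>: "\<Delta> c \<in> carrier CC.T" using assms by (rule ahom_closed[OF comult_ahom])
  have "?h (?f (\<Delta> c)) = contract \<epsilon> (\<Delta> c)"
  proof (rule CC.tensor_hom_eqI[OF M.abelian_group_axioms ahom_comp[OF f h]
        contract(1)[OF counit_ahom counit_smult] _ \<Delta>])
    fix m n assume mn: "m \<in> carrier C" "n \<in> carrier C"
    have "?f (CC.ts m n) = CA.ts m (\<epsilon> n)"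
      by (rule CA.tensor_map_id(2)[OF left_module_axioms counit_left_hom mn])
    then show "?h (?f (CC.ts m n)) = contract \<epsilon> (CC.ts m n)"
      using mn CA.tensor_lift_tens[OF M.abelian_group_axioms bal, of m "\<epsilon> n"]
      by (simp add: contract(2)[OF counit_ahom counit_smult])
  qed simp_all
  moreover have "?h (?f (\<Delta> c)) = c"
    using CA.tensor_lift_tens[OF M.abelian_group_axioms bal, of c "\<one>\<^bsub>A\<^esub>"]
    by (simp add: counit_right assms rsmult_one)
  ultimately show ?thesis by simp
qed

text \<open>For the preimage P in \<open>N\<close>, the map \<open>f\<close> induces an injection of
  N/P into C/N'. It stays injective after tensoring with the flat module \<open>C\<close>. The
  comultiplication of an element of P dies in C \<otimes> C/N', hence already in C \<otimes> N/P,
  and by right exactness it comes from C \<otimes> P.\<close>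

lemma left_subcomodule_vimage:
  assumes flat: "flat_right_module TYPE((nat + 'a + 'c) list set) A C"
    and N: "left_subcomodule A C C \<Delta> N" and N': "left_subcomodule A C C \<Delta> N'"
    and f: "f \<in> left_module_hom A C C"
    and colinear: "\<And>c. c \<in> carrier C \<Longrightarrow> \<Delta> (f c) = tensor_map A C C id f (\<Delta> c)"
  shows "left_subcomodule A C C \<Delta> {n \<in> N. f n \<in> N'}"
proof -
  let ?P = "{n \<in> N. f n \<in> N'}" and ?NN = "C\<lparr>carrier := N\<rparr>"
  note fa = left_module_hom_ahom[OF f]
  have Nm: "left_submodule A C N" and N'm: "left_submodule A C N'"
    using N N' by (auto simp: left_subcomodule_iff)
  interpret N: additive_subgroup N C using Nm by (simp add: left_submodule_def)
  interpret N': additive_subgroup N' C using N'm by (simp add: left_submodule_def)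
  have NC: "n \<in> N \<Longrightarrow> n \<in> carrier C" for n using N.a_subset by blast
  have P: "additive_subgroup ?P C"
  proof (rule additive_subgroupI'[OF M.abelian_group_axioms])
    show "\<zero>\<^bsub>C\<^esub> \<in> ?P" using ahom_zero[OF M.abelian_group_axioms M.abelian_group_axioms fa] by simp
    show "\<ominus>\<^bsub>C\<^esub> x \<in> ?P" if "x \<in> ?P" for x
      using that ahom_uminus[OF M.abelian_group_axioms M.abelian_group_axioms fa, of x] NC
        additive_subgroup_uminus[OF M.abelian_group_axioms] N.additive_subgroup_axioms
        N'.additive_subgroup_axioms by auto
    show "x \<oplus>\<^bsub>C\<^esub> y \<in> ?P" if "x \<in> ?P" "y \<in> ?P" for x y
      using that ahom_add[OF fa, of x y] NC by auto
  qed (use NC in auto)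
  have Ps: "a \<odot>\<^bsub>C\<^esub> p \<in> ?P" if "a \<in> carrier A" "p \<in> ?P" for a p
    using that Nm N'm left_module_hom_smult[OF f that(1), of p] NC by (auto simp: left_submodule_def)
  have Pm: "left_submodule A C ?P" using P Ps by (auto simp: left_submodule_def)
  interpret S: tensor_product A C ?NN by (rule CC.tensor_product_sub[OF Nm])
  have PN: "left_submodule A ?NN ?P"
  proof -
    have "additive_subgroup ?P ?NN"
    proof (rule additive_subgroupI'[OF S.N.M.abelian_group_axioms])
      fix x assume x: "x \<in> ?P"
      then show "\<ominus>\<^bsub>?NN\<^esub> x \<in> ?P"
        using additive_subgroup_uminus[OF M.abelian_group_axioms P x]
          additive_subgroup_uminus_eq[OF M.abelian_group_axioms N.additive_subgroup_axioms, of x] by simp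
    qed (use additive_subgroup.zero_closed[OF P] additive_subgroup.a_closed[OF P] in auto)
    then show ?thesis using Ps by (auto simp: left_submodule_def)
  qed
  \<comment> \<open>Flatness is tested on carriers of type \<open>(nat + 'a + 'c) list set\<close>.
    An element of \<open>C\<close> is coded as a one-letter word in the third summand, so that a
    coset becomes a set of words.\<close>
  define enc :: "'c \<Rightarrow> (nat + 'a + 'c) list" where "enc = (\<lambda>c. [Inr (Inr c)])"
  have enc: "inj enc" by (auto simp: enc_def inj_on_def)
  define q1 where "q1 m = enc ` coset ?NN ?P m" for m
  define q2 where "q2 m = enc ` coset C N' m" for m
  have PN': "additive_subgroup ?P ?NN" using PN by (simp add: left_submodule_def)
  interpret q1: quotient ?NN ?P q1
    unfolding q1_def by (rule coset_quotient[OF S.N.M.abelian_group_axioms PN' enc])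
  interpret q2: quotient C N' q2
    unfolding q2_def by (rule coset_quotient[OF M.abelian_group_axioms N'.additive_subgroup_axioms enc])
  let ?N1 = "quot_module ?NN q1" and ?N2 = "quot_module C q2"
  note m1 = quot_module[OF S.left PN q1.quotient_axioms]
  note m2 = quot_module[OF left_module_axioms N'm q2.quotient_axioms]
  interpret S1: tensor_product A C ?N1 by (intro tensor_product.intro right_module_axioms m1(1))
  interpret S2: tensor_product A C ?N2 by (intro tensor_product.intro right_module_axioms m2(1))
  have minus_NN: "x \<ominus>\<^bsub>?NN\<^esub> y = x \<ominus>\<^bsub>C\<^esub> y" if "x \<in> N" "y \<in> N" for x y
    using additive_subgroup_uminus_eq[OF M.abelian_group_axioms N.additive_subgroup_axioms that(2)]
    by (simp add: a_minus_def)
  \<comment> \<open>One direction makes the induced map \<open>h\<close> on the quotients well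
    defined, the other makes it injective.\<close>
  have q12: "q1 m = q1 n \<longleftrightarrow> q2 (f m) = q2 (f n)" if "m \<in> N" "n \<in> N" for m n
  proof -
    have "q1 m = q1 n \<longleftrightarrow> m \<ominus>\<^bsub>C\<^esub> n \<in> ?P" using that q1.q_eq[of m n] minus_NN by simp
    also have "\<dots> \<longleftrightarrow> f m \<ominus>\<^bsub>C\<^esub> f n \<in> N'"
      using that NC ahom_minus[OF M.abelian_group_axioms M.abelian_group_axioms fa, of m n]
        additive_subgroup_minus[OF M.abelian_group_axioms N.additive_subgroup_axioms] by auto
    also have "\<dots> \<longleftrightarrow> q2 (f m) = q2 (f n)"
      using that NC q2.q_eq[of "f m" "f n"] by (simp add: ahom_closed[OF fa])
    finally show ?thesis .
  qed
  define h where "h u = q2 (f (q1.rep u))" for u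
  have hq: "h (q1 n) = q2 (f n)" if "n \<in> N" for n
    unfolding h_def using that q12[of "q1.rep (q1 n)" n] q1.rep_closed[of "q1 n"] q1.q_rep[of "q1 n"] by simp
  note q1a = left_module_hom_ahom[OF m1(2)] and q2a = left_module_hom_ahom[OF m2(2)]
  have h: "h \<in> left_module_hom A ?N1 ?N2"
  proof (rule left_module_homI)
    fix u assume "u \<in> carrier ?N1"
    then obtain m where m: "m \<in> N" "u = q1 m" by auto
    show "h u \<in> carrier ?N2" using m hq NC ahom_closed[OF fa] by simp
    {
      fix v assume "v \<in> carrier ?N1"
      then obtain n where n: "n \<in> N" "v = q1 n" by auto
      show "h (u \<oplus>\<^bsub>?N1\<^esub> v) = h u \<oplus>\<^bsub>?N2\<^esub> h v"
        using m n ahom_add[OF q1a, of m n, symmetric] ahom_add[OF q2a, of "f m" "f n"]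
          ahom_add[OF fa, of m n] NC ahom_closed[OF fa]
        by (simp add: hq)
    next
      fix r assume r: "r \<in> carrier A"
      have rm: "r \<odot>\<^bsub>C\<^esub> m \<in> N" using Nm r m by (simp add: left_submodule_def)
      have "r \<odot>\<^bsub>?N1\<^esub> u = q1 (r \<odot>\<^bsub>C\<^esub> m)"
        using left_module_hom_smult[OF m1(2) r, of m] m by simp
      then have "h (r \<odot>\<^bsub>?N1\<^esub> u) = q2 (r \<odot>\<^bsub>C\<^esub> f m)"
        using hq[OF rm] left_module_hom_smult[OF f r, of m] m NC by simp
      also have "\<dots> = r \<odot>\<^bsub>?N2\<^esub> h u"
        using left_module_hom_smult[OF m2(2) r, of "f m"] hq[OF m(1)] m NC ahom_closed[OF fa] by simp
      finally show "h (r \<odot>\<^bsub>?N1\<^esub> u) = r \<odot>\<^bsub>?N2\<^esub> h u" .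
    }
  qed
  have h_inj: "inj_on h (carrier ?N1)"
    by (rule inj_onI) (clarsimp simp: hq simp flip: q12)
  let ?F1 = "tensor_map A C ?N1 id q1" and ?F2 = "tensor_map A C ?N2 id h"
    and ?G2 = "tensor_map A C ?N2 id q2" and ?\<phi> = "tensor_map A C C id f"
  have F1: "?F1 \<in> ahom S.T S1.T" "m \<in> carrier C \<Longrightarrow> n \<in> N \<Longrightarrow> ?F1 (S.ts m n) = S1.ts m (q1 n)" for m n
    using S1.tensor_map_id[OF S.left m1(2)] by simp_all
  note F2 = S2.tensor_map_id[OF m1(1) h]
    and G2 = S2.tensor_map_id[OF left_module_axioms m2(2)]
    and \<phi> = CC.tensor_map_id[OF left_module_axioms f]
  note F2_inj = flat[unfolded flat_right_module_def, THEN conjunct2, rule_format, of ?N1 ?N2 h]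
  have "\<Delta> n \<in> CC.sub_image ?P" if n: "n \<in> ?P" for n
  proof -
    obtain i where i: "i \<in> ahom S.T CC.T" "\<forall>m\<in>carrier C. \<forall>p\<in>N. i (S.ts m p) = CC.ts m p"
      "CC.sub_image N = i ` carrier S.T"
      by (rule CC.sub_image_hom[OF Nm]) blast
    obtain t where t: "t \<in> carrier S.T" "\<Delta> n = i t"
      using N n i(3) by (auto simp: left_subcomodule_iff)
    \<comment> \<open>The square with corners C \<otimes> N and C \<otimes> C/N' commutes: passing
      through C \<otimes> N/P, or including into C \<otimes> C and applying \<open>f\<close> before
      the projection, gives the same.\<close>
    have "?F2 (?F1 t) = ?G2 (?\<phi> (i t))"
      by (rule S.tensor_hom_eqI[OF S2.T.abelian_group_axioms ahom_comp[OF F1(1) F2(1)]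
            ahom_comp[OF ahom_comp[OF i(1) \<phi>(1)] G2(1)] _ t(1)])
        (use i(2) NC ahom_closed[OF fa] in \<open>simp add: F1 F2 G2 \<phi> hq\<close>)
    also have "\<dots> = ?G2 (\<Delta> (f n))" using t colinear[of n] n NC by simp
    also have "\<dots> = \<zero>\<^bsub>S2.T\<^esub>"
    proof -
      have "\<Delta> (f n) \<in> CC.sub_image N'" using N' n by (auto simp: left_subcomodule_iff)
      then show ?thesis
      proof (induction rule: CC.sub_image_induct[OF N'm, consumes 1, case_names zero tens add])
        case zero
        show ?case by (rule ahom_zero[OF CC.T.abelian_group_axioms S2.T.abelian_group_axioms G2(1)])
      next
        case (tens m p)
        then have "p \<in> carrier C" using N'.a_subset by blast
        then have "q2 p = \<zero>\<^bsub>?N2\<^esub>" using q2.quot_zero_iff tens by simp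
        then show ?case using tens G2(2)[of m p] \<open>p \<in> carrier C\<close> S2.tens_zero_right[of m]
          by metis
      next
        case (add s t)
        then show ?case using ahom_add[OF G2(1)] S2.T.l_zero[OF S2.T.zero_closed] by metis
      qed
    qed
    also have "\<dots> = ?F2 \<zero>\<^bsub>S1.T\<^esub>"
      using ahom_zero[OF S1.T.abelian_group_axioms S2.T.abelian_group_axioms F2(1)] by simp
    finally have "?F1 t = \<zero>\<^bsub>S1.T\<^esub>"
      using F2_inj[THEN inj_onD] m1(1) m2(1) h h_inj ahom_closed[OF F1(1) t(1)] by simp
    then have "t \<in> S.sub_image ?P"
      by (rule S.tensor_quotient_kernel[OF PN q1.quotient_axioms t(1)])
    then have "i t \<in> CC.sub_image ?P"
    proof (induction rule: S.sub_image_induct[OF PN, consumes 1, case_names zero tens add])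
      case zero
      then show ?case
        using ahom_zero[OF S.T.abelian_group_axioms CC.T.abelian_group_axioms i(1)]
          additive_subgroup.zero_closed[OF CC.sub_image_subgroup[OF Pm]] by simp
    next
      case (tens m p)
      then have "i (S.ts m p) = CC.ts m p" using i(2) by blast
      then show ?case using tens CC.tens_sub_image[OF Pm, of m p] by simp
    next
      case (add s t)
      then show ?case
        using ahom_add[OF i(1)] additive_subgroup.a_closed[OF CC.sub_image_subgroup[OF Pm]] by simp
    qed
    then show ?thesis using t by simp
  qed
  then show ?thesis using Pm by (auto simp: left_subcomodule_iff)
qed

end

lemma additive_subgroup_finsum:
  assumes "abelian_group G" "additive_subgroup H G" "finite I" "\<And>i. i \<in> I \<Longrightarrow> f i \<in> H"
  shows "(\<Oplus>\<^bsub>G\<^esub>i\<in>I. f i) \<in> H"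
proof -
  interpret G: abelian_group G by fact
  interpret H: additive_subgroup H G by fact
  show ?thesis
    using assms(3,4)
  proof (induction I rule: finite_induct)
    case (insert i I)
    then have "f \<in> I \<rightarrow> carrier G" "f i \<in> carrier G" using H.a_subset by auto
    then show ?case using insert H.a_closed by (simp add: G.finsum_insert)
  qed simp
qed

lemma internal_direct_sum_generates:
  assumes "abelian_group M" "internal_direct_sum M \<S>" "\<And>S. S \<in> \<S> \<Longrightarrow> additive_subgroup S M"
    and "additive_subgroup H M" "\<And>S. S \<in> \<S> \<Longrightarrow> S \<subseteq> H"
  shows "carrier M \<subseteq> H"
proof
  fix m assume "m \<in> carrier M"
  let ?G = "\<lambda>S. add_monoid (M\<lparr>carrier := S\<rparr>)"
  let ?f = "\<lambda>x. \<Oplus>\<^bsub>M\<^esub>S\<in>{S \<in> \<S>. x S \<noteq> \<zero>\<^bsub>M\<^esub>}. x S"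
  have "?f ` carrier (sum_group \<S> ?G) = carrier (add_monoid M)"
    using assms(2) unfolding internal_direct_sum_def iso_def bij_betw_def by blast
  then obtain x where x: "x \<in> carrier (sum_group \<S> ?G)" "m = ?f x"
    using \<open>m \<in> carrier M\<close> by auto
  have "group (?G S)" if "S \<in> \<S>" for S
    using abelian_group.a_group[OF additive_subgroup_abelian_group[OF assms(1) assms(3)[OF that]]] .
  then have "\<And>S. S \<in> \<S> \<Longrightarrow> x S \<in> S" "finite {S \<in> \<S>. x S \<noteq> \<zero>\<^bsub>M\<^esub>}"
    using x(1) by (auto simp: carrier_sum_group PiE_iff)
  then show "m \<in> H"
    unfolding x(2) using assms(5) by (intro additive_subgroup_finsum[OF assms(1,4)]) auto
qed

lemma (in abelian_group) minus_eq_minus: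
  assumes "a \<in> carrier G" "b \<in> carrier G" "c \<in> carrier G" "d \<in> carrier G" "a \<oplus> b = c \<oplus> d"
  shows "a \<ominus> c = d \<ominus> b"
proof -
  have "(a \<ominus> c) \<oplus> (c \<oplus> b) = a \<oplus> b" using assms(1-4) by (simp add: a_minus_def a_assoc r_neg1)
  also have "\<dots> = d \<oplus> c" using assms by (simp add: a_comm)
  also have "\<dots> = (d \<ominus> b) \<oplus> (b \<oplus> c)" using assms(1-4) by (simp add: a_minus_def a_assoc r_neg1)
  also have "b \<oplus> c = c \<oplus> b" using assms(1-4) by (simp add: a_comm)
  finally show ?thesis using assms(1-4) by simp
qed

section \<open>The elements a g x, the coinvariants and colinear maps\<close>

locale simple_semisimple_grouplike = coring K A \<eta> C
  for K :: "('k, 'y) ring_scheme" and A :: "('a, 'z) ring_scheme"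
    and \<eta> :: "'k \<Rightarrow> 'a" and C :: "('a, 'c, 'x) coring_struct_scheme" (structure) +
  fixes g :: 'c
  assumes grouplike: "grouplike A C g"
    and simple_semisimple: "simple_semisimple_coring K A \<eta> C"
begin

lemma g_closed [simp]: "g \<in> carrier C" and g_nonzero: "g \<noteq> \<zero>"
  and counit_g: "\<epsilon> g = \<one>\<^bsub>A\<^esub>" and comult_g: "\<Delta> g = CC.ts g g"
  using grouplike by (auto simp: grouplike_def)

lemma flat: "flat_right_module TYPE((nat + 'a + 'c) list set) A C"
  using simple_semisimple by (simp add: simple_semisimple_coring_def semisimple_coring_def)

abbreviation Sub :: "'c set \<Rightarrow> bool" where "Sub \<equiv> left_subcomodule A C C \<Delta>"

abbreviation B :: "'a set" where "B \<equiv> coinvariants A C g"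

definition elt :: "'a \<Rightarrow> 'a \<Rightarrow> 'c" where "elt a x = (a \<odot> g) \<triangleleft> x"

lemma elt_closed [simp]: "a \<in> carrier A \<Longrightarrow> x \<in> carrier A \<Longrightarrow> elt a x \<in> carrier C"
  by (simp add: elt_def smult_closed rsmult_closed)

lemma elt_one_left: "x \<in> carrier A \<Longrightarrow> elt \<one>\<^bsub>A\<^esub> x = g \<triangleleft> x"
  by (simp add: elt_def smult_one)

lemma elt_one_right: "a \<in> carrier A \<Longrightarrow> elt a \<one>\<^bsub>A\<^esub> = a \<odot> g"
  by (simp add: elt_def smult_closed rsmult_one)

lemma elt_add_left:
  "a \<in> carrier A \<Longrightarrow> b \<in> carrier A \<Longrightarrow> x \<in> carrier A \<Longrightarrow> elt (a \<oplus>\<^bsub>A\<^esub> b) x = elt a x \<oplus> elt b x"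
  by (simp add: elt_def smult_closed smult_l_distr rsmult_l_distr)

lemma elt_add_right:
  "a \<in> carrier A \<Longrightarrow> x \<in> carrier A \<Longrightarrow> y \<in> carrier A \<Longrightarrow> elt a (x \<oplus>\<^bsub>A\<^esub> y) = elt a x \<oplus> elt a y"
  by (simp add: elt_def smult_closed rsmult_r_distr)

lemma elt_ahom_left: "x \<in> carrier A \<Longrightarrow> (\<lambda>a. elt a x) \<in> ahom A C"
  by (rule ahomI) (simp_all add: elt_add_left)

lemma elt_ahom_right: "a \<in> carrier A \<Longrightarrow> elt a \<in> ahom A C"
  by (rule ahomI) (simp_all add: elt_add_right)

lemmas elt_minus_left = ahom_minus[OF A.abelian_group_axioms M.abelian_group_axioms elt_ahom_left]
lemmas elt_minus_right = ahom_minus[OF A.abelian_group_axioms M.abelian_group_axioms elt_ahom_right]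
lemmas elt_uminus_left = ahom_uminus[OF A.abelian_group_axioms M.abelian_group_axioms elt_ahom_left]
lemmas elt_zero_left = ahom_zero[OF A.abelian_group_axioms M.abelian_group_axioms elt_ahom_left]


lemma elt_smult:
  "a \<in> carrier A \<Longrightarrow> b \<in> carrier A \<Longrightarrow> x \<in> carrier A \<Longrightarrow> b \<odot> elt a x = elt (b \<otimes>\<^bsub>A\<^esub> a) x"
  by (simp add: elt_def smult_closed smult_assoc smult_rsmult_assoc)

lemma elt_rsmult:
  "a \<in> carrier A \<Longrightarrow> b \<in> carrier A \<Longrightarrow> x \<in> carrier A \<Longrightarrow> elt a x \<triangleleft> b = elt a (x \<otimes>\<^bsub>A\<^esub> b)"
  by (simp add: elt_def smult_closed rsmult_assoc)

lemma counit_elt: "a \<in> carrier A \<Longrightarrow> x \<in> carrier A \<Longrightarrow> \<epsilon> (elt a x) = a \<otimes>\<^bsub>A\<^esub> x"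
  by (simp add: elt_def counit_rsmult counit_smult counit_g smult_closed)

lemma comult_elt:
  "a \<in> carrier A \<Longrightarrow> x \<in> carrier A \<Longrightarrow> \<Delta> (elt a x) = CC.ts (a \<odot> g) (g \<triangleleft> x)"
  unfolding elt_def
  by (simp add: comult_rsmult comult_smult comult_g smult_closed CC.tensor_smult_hom(2)
      CC.tensor_rsmult_hom(2) del: tensor_fields(4,5))

lemma elt_left_inj:
  "a \<in> carrier A \<Longrightarrow> b \<in> carrier A \<Longrightarrow> a \<odot> g = b \<odot> g \<Longrightarrow> a = b"
  using counit_elt[of a "\<one>\<^bsub>A\<^esub>"] counit_elt[of b "\<one>\<^bsub>A\<^esub>"] by (simp add: elt_one_right)

lemma elt_right_inj:
  "a \<in> carrier A \<Longrightarrow> b \<in> carrier A \<Longrightarrow> g \<triangleleft> a = g \<triangleleft> b \<Longrightarrow> a = b"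
  using counit_elt[of "\<one>\<^bsub>A\<^esub>" a] counit_elt[of "\<one>\<^bsub>A\<^esub>" b] by (simp add: elt_one_left)

lemma B_iff: "b \<in> B \<longleftrightarrow> b \<in> carrier A \<and> b \<odot> g = g \<triangleleft> b"
  by (auto simp: coinvariants_def)

text \<open>The counit maps a g to a and g b to b. An element that is both a left and a right
  multiple of \<open>g\<close> thus yields a coinvariant.\<close>

lemma BI:
  assumes "a \<in> carrier A" "b \<in> carrier A" "a \<odot> g = g \<triangleleft> b"
  shows "b \<in> B" "a = b"
proof -
  show "a = b"
    using counit_elt[of a "\<one>\<^bsub>A\<^esub>"] counit_elt[of "\<one>\<^bsub>A\<^esub>" b] assms by (simp add: elt_one_left elt_one_right)
  then show "b \<in> B" using assms by (simp add: B_iff)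
qed

lemma elt_coinvariant:
  assumes "b \<in> B" "a \<in> carrier A" "x \<in> carrier A"
  shows "elt (a \<otimes>\<^bsub>A\<^esub> b) x = elt a (b \<otimes>\<^bsub>A\<^esub> x)"
  using assms by (simp add: elt_def B_iff smult_assoc rsmult_assoc smult_rsmult_assoc
      smult_closed rsmult_closed)

lemma subring_B: "subring B A"
proof (rule A.subringI)
  show "B \<subseteq> carrier A" by (auto simp: B_iff)
  show "\<one>\<^bsub>A\<^esub> \<in> B" by (simp add: B_iff smult_one rsmult_one)
  show "\<ominus>\<^bsub>A\<^esub> b \<in> B" if "b \<in> B" for b
    using that by (simp add: B_iff smult_uminus_left rsmult_uminus_right)
  show "b \<otimes>\<^bsub>A\<^esub> c \<in> B" if "b \<in> B" "c \<in> B" for b c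
    using that by (simp add: B_iff smult_assoc rsmult_assoc flip: smult_rsmult_assoc)
  show "b \<oplus>\<^bsub>A\<^esub> c \<in> B" if "b \<in> B" "c \<in> B" for b c
    using that by (simp add: B_iff smult_l_distr rsmult_r_distr)
qed

lemma B_closed: "b \<in> B \<Longrightarrow> b \<in> carrier A" by (simp add: B_iff)

lemma B_minus: "b \<in> B \<Longrightarrow> c \<in> B \<Longrightarrow> b \<ominus>\<^bsub>A\<^esub> c \<in> B"
  using subringE[OF subring_B] by (simp add: a_minus_def)

text \<open>The left submodule A g X. Closure under negation and under the left action comes from
  the free coefficient \<open>a\<close> in the generators.\<close>

inductive_set gspan :: "'a set \<Rightarrow> 'c set" for X where
  zero: "\<zero> \<in> gspan X"
| elt: "a \<in> carrier A \<Longrightarrow> x \<in> X \<Longrightarrow> elt a x \<in> gspan X"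
| add: "c \<in> gspan X \<Longrightarrow> d \<in> gspan X \<Longrightarrow> c \<oplus> d \<in> gspan X"

lemma gspan_mono: "X \<subseteq> Y \<Longrightarrow> gspan X \<subseteq> gspan Y"
proof
  fix c assume "X \<subseteq> Y" "c \<in> gspan X"
  from this(2,1) show "c \<in> gspan Y" by induction (auto intro: gspan.intros)
qed

lemma gspan_right_mult:
  assumes "c \<in> gspan X" "X \<subseteq> carrier A" "\<And>x. x \<in> X \<Longrightarrow> x \<otimes>\<^bsub>A\<^esub> a \<in> X" "a \<in> carrier A"
  shows "c \<triangleleft> a \<in> gspan X \<and> c \<in> carrier C"
  using assms
proof induction
  case zero
  then show ?case by (simp add: rsmult_zero_left gspan.zero)
next
  case (elt b x)
  then have "x \<in> carrier A" by blast
  then show ?case using elt by (simp add: elt_rsmult gspan.elt)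
next
  case (add c d)
  then show ?case by (auto simp: rsmult_l_distr intro!: gspan.intros)
qed

context
  fixes X assumes X: "X \<subseteq> carrier A"
begin

lemma gspan_closed: "c \<in> gspan X \<Longrightarrow> c \<in> carrier C"
proof (induction rule: gspan.induct)
  case (elt a x)
  then show ?case using X by auto
qed auto

lemma gspan_submodule: "left_submodule A C (gspan X)"
proof -
  have "\<ominus> c \<in> gspan X" if "c \<in> gspan X" for c
    using that
  proof induction
    case zero
    show ?case using gspan.zero M.uminus_zero by metis
  next
    case (elt a x)
    then have "\<ominus> elt a x = elt (\<ominus>\<^bsub>A\<^esub> a) x" using X by (subst elt_uminus_left) auto
    then show ?case using elt by (auto intro: gspan.elt)
  next
    case (add c d)
    then show ?case by (simp add: M.minus_add gspan_closed gspan.add)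
  qed
  then have "additive_subgroup (gspan X) C"
    by (intro additive_subgroupI' M.abelian_group_axioms gspan.zero gspan.add) (auto intro: gspan_closed)
  moreover have "a \<odot> c \<in> gspan X" if "c \<in> gspan X" "a \<in> carrier A" for a c
    using that
  proof induction
    case zero
    then show ?case by (simp add: smult_zero_right gspan.zero)
  next
    case (elt b x)
    then show ?case using X by (subst elt_smult) (auto intro!: gspan.elt)
  next
    case (add c d)
    then show ?case by (simp add: smult_r_distr gspan_closed gspan.add)
  qed
  ultimately show ?thesis by (auto simp: left_submodule_def)
qed

text \<open>The comultiplication sends a g x to a g \<otimes> g x, and the right factor g x is
  itself a generator.\<close>

lemma gspan_Sub: "Sub (gspan X)"
proof -
  interpret I: additive_subgroup "CC.sub_image (gspan X)" CC.T
    by (rule CC.sub_image_subgroup[OF gspan_submodule])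
  have "\<Delta> c \<in> CC.sub_image (gspan X)" if "c \<in> gspan X" for c
    using that
  proof induction
    case zero
    then show ?case
      using ahom_zero[OF M.abelian_group_axioms CC.T.abelian_group_axioms comult_ahom] by simp
  next
    case (elt a x)
    then have x: "x \<in> carrier A" using X by auto
    then have "g \<triangleleft> x \<in> gspan X" using elt gspan.elt[of "\<one>\<^bsub>A\<^esub>" x X] by (simp add: elt_one_left)
    then show ?case
      using elt x by (simp add: comult_elt CC.tens_sub_image[OF gspan_submodule] smult_closed)
  next
    case (add c d)
    then show ?case by (simp add: ahom_add[OF comult_ahom] gspan_closed)
  qed
  then show ?thesis using gspan_submodule by (auto simp: left_subcomodule_iff)
qed

text \<open>The left factor a g of the comultiplication of a g x need not lie in A g X. A
  coinvariant left unit \<open>z\<close> of X repairs this: a g x = a g z x = (a z) g x, and the new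
  left factor (a z) g = a g z does lie there.\<close>

lemma gspan_right_subcomodule:
  assumes right: "\<And>x a. x \<in> X \<Longrightarrow> a \<in> carrier A \<Longrightarrow> x \<otimes>\<^bsub>A\<^esub> a \<in> X"
    and z: "z \<in> X" "z \<in> B" "\<And>x. x \<in> X \<Longrightarrow> z \<otimes>\<^bsub>A\<^esub> x = x"
  shows "right_subcomodule A C C \<Delta> (gspan X)"
proof -
  let ?N = "C\<lparr>carrier := gspan X\<rparr>"
  have gspan: "additive_subgroup (gspan X) C" using gspan_submodule by (simp add: left_submodule_def)
  have rs: "c \<triangleleft> a \<in> gspan X" if "c \<in> gspan X" "a \<in> carrier A" for a c
    using gspan_right_mult[of c X a] that right X by blast
  have N: "right_module A ?N"
    by (intro right_module.intro right_module_axioms.intro A.ring_axioms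
        additive_subgroup_abelian_group[OF M.abelian_group_axioms gspan])
      (simp_all add: rs gspan_closed rsmult_l_distr rsmult_r_distr rsmult_assoc rsmult_one)
  interpret S: tensor_product A ?N C by (intro tensor_product.intro N left_module_axioms)
  define i where "i = tensor_map A C C id id"
  have id: "id \<in> ahom ?N C" by (rule ahomI) (auto intro: gspan_closed)
  have id': "id \<in> left_module_hom A C C" by (rule left_module_homI) auto
  have i: "i \<in> ahom S.T CC.T" unfolding i_def
    by (rule CC.tensor_map_hom[OF S.tensor_product_axioms id _ id']) simp
  have it: "i (S.ts c d) = CC.ts c d" if "c \<in> gspan X" "d \<in> carrier C" for c d
    using CC.tensor_map_tens[OF S.tensor_product_axioms id _ id', of c d] that by (simp add: i_def)
  interpret i: abelian_group_hom S.T CC.T i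
    using i by (intro ahom_abelian_group_hom S.T.abelian_group_axioms CC.T.abelian_group_axioms)
  have "\<Delta> c \<in> i ` carrier S.T" if "c \<in> gspan X" for c
    using that
  proof induction
    case zero
    have "\<Delta> \<zero> = i \<zero>\<^bsub>S.T\<^esub>"
      using ahom_zero[OF M.abelian_group_axioms CC.T.abelian_group_axioms comult_ahom] by simp
    then show ?case by (rule image_eqI) simp
  next
    case (elt a x)
    then have x: "x \<in> carrier A" using X by auto
    have zc: "z \<in> carrier A" using X z by auto
    have az: "(a \<otimes>\<^bsub>A\<^esub> z) \<odot> g \<in> gspan X"
    proof -
      have "(a \<otimes>\<^bsub>A\<^esub> z) \<odot> g = elt a z"
        using elt_coinvariant[OF z(2), of a "\<one>\<^bsub>A\<^esub>"] elt zc by (simp add: elt_one_right)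
      then show ?thesis using elt z by (simp add: gspan.elt)
    qed
    have "elt a x = elt (a \<otimes>\<^bsub>A\<^esub> z) x"
      using elt_coinvariant[OF z(2) elt(1) x] z(3)[OF elt(2)] by simp
    then have "\<Delta> (elt a x) = CC.ts ((a \<otimes>\<^bsub>A\<^esub> z) \<odot> g) (g \<triangleleft> x)"
      using comult_elt[of "a \<otimes>\<^bsub>A\<^esub> z" x] elt zc x by simp
    also have "\<dots> = i (S.ts ((a \<otimes>\<^bsub>A\<^esub> z) \<odot> g) (g \<triangleleft> x))"
      using it[OF az] x by (simp add: rsmult_closed)
    finally show ?case
      by (rule image_eqI) (use az x in \<open>simp add: S.tens_closed rsmult_closed\<close>)
  next
    case (add c d)
    then obtain s t where "s \<in> carrier S.T" "t \<in> carrier S.T" "\<Delta> c = i s" "\<Delta> d = i t" by auto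
    then show ?case using add ahom_add[OF comult_ahom, of c d]
      by (intro image_eqI[where x = "s \<oplus>\<^bsub>S.T\<^esub> t"]) (simp_all add: gspan_closed)
  qed
  then show ?thesis
    using gspan rs by (auto simp: right_subcomodule_def i_def)
qed

end

lemma gspan_carrier: "gspan (carrier A) = carrier C"
proof -
  have "Sub (gspan (carrier A))" by (rule gspan_Sub) simp
  moreover have "right_subcomodule A C C \<Delta> (gspan (carrier A))"
    by (rule gspan_right_subcomodule[where z = "\<one>\<^bsub>A\<^esub>"]) (auto intro: subringE(3)[OF subring_B])
  moreover have "g \<in> gspan (carrier A)"
    using gspan.elt[of "\<one>\<^bsub>A\<^esub>" "\<one>\<^bsub>A\<^esub>"] by (simp add: elt_one_right smult_one)
  ultimately show ?thesis
    using simple_semisimple g_nonzero unfolding simple_semisimple_coring_def by blast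
qed

lemma elt_induct [consumes 1, case_names zero elt add]:
  assumes "c \<in> carrier C" and "P \<zero>"
    and "\<And>a x. a \<in> carrier A \<Longrightarrow> x \<in> carrier A \<Longrightarrow> P (elt a x)"
    and "\<And>c d. c \<in> carrier C \<Longrightarrow> d \<in> carrier C \<Longrightarrow> P c \<Longrightarrow> P d \<Longrightarrow> P (c \<oplus> d)"
  shows "P c"
proof -
  have "c \<in> gspan (carrier A)" using assms(1) by (simp add: gspan_carrier)
  then show ?thesis
    by induction (use assms(2-) in \<open>auto simp: gspan_carrier\<close>)
qed

text \<open>Since \<open>C\<close> is spanned by the elements \<open>a g x\<close>, these are exactly the colinear
  endomorphisms of the left comodule \<open>C\<close>.\<close>

definition comap :: "('c \<Rightarrow> 'c) \<Rightarrow> bool"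
  where "comap f \<longleftrightarrow> f \<in> left_module_hom A C C \<and>
    (\<forall>x\<in>carrier A. \<exists>y\<in>carrier A. f (g \<triangleleft> x) = g \<triangleleft> y)"

lemma comap_ahom: "comap f \<Longrightarrow> f \<in> ahom C C"
  unfolding comap_def by (blast intro: left_module_hom_ahom)

lemma comap_closed: "comap f \<Longrightarrow> c \<in> carrier C \<Longrightarrow> f c \<in> carrier C"
  by (rule ahom_closed[OF comap_ahom])

lemma comap_smult: "comap f \<Longrightarrow> a \<in> carrier A \<Longrightarrow> c \<in> carrier C \<Longrightarrow> f (a \<odot> c) = a \<odot> f c"
  unfolding comap_def by (blast intro: left_module_hom_smult)

text \<open>It suffices to compare additive maps on the elements a g x. If g x goes to g y, both
  sides give a g \<otimes> g y.\<close>

lemma comap_colinear: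
  assumes f: "comap f" and c: "c \<in> carrier C"
  shows "\<Delta> (f c) = tensor_map A C C id f (\<Delta> c)"
proof -
  have fl: "f \<in> left_module_hom A C C" using f by (simp add: comap_def)
  define \<phi> where "\<phi> = tensor_map A C C id f"
  have \<phi>: "\<phi> \<in> ahom CC.T CC.T"
    "m \<in> carrier C \<Longrightarrow> n \<in> carrier C \<Longrightarrow> \<phi> (CC.ts m n) = CC.ts m (f n)" for m n
    unfolding \<phi>_def by (rule CC.tensor_map_id[OF left_module_axioms fl]; assumption)+
  have "\<Delta> (f c) = \<phi> (\<Delta> c)"
    using c
  proof (induction c rule: elt_induct)
    case zero
    show ?case
      using ahom_zero[OF M.abelian_group_axioms CC.T.abelian_group_axioms comult_ahom]
        ahom_zero[OF M.abelian_group_axioms M.abelian_group_axioms comap_ahom[OF f]]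
        ahom_zero[OF CC.T.abelian_group_axioms CC.T.abelian_group_axioms \<phi>(1)] by simp
  next
    case (elt a x)
    obtain y where y: "y \<in> carrier A" "f (g \<triangleleft> x) = g \<triangleleft> y"
      using f elt by (auto simp: comap_def)
    have "elt a x = a \<odot> (g \<triangleleft> x)" using elt by (simp add: elt_def smult_rsmult_assoc)
    then have "f (elt a x) = elt a y"
      using comap_smult[OF f elt(1), of "g \<triangleleft> x"] elt y
      by (simp add: rsmult_closed elt_def smult_rsmult_assoc)
    then show ?case
      using elt y by (simp add: comult_elt \<phi> rsmult_closed smult_closed)
  next
    case (add c d)
    then show ?case
      using ahom_add[OF comult_ahom] ahom_add[OF comap_ahom[OF f]] comap_closed[OF f]
        ahom_add[OF \<phi>(1)] ahom_closed[OF comult_ahom] by simp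
  qed
  then show ?thesis by (simp only: \<phi>_def)
qed

lemma Sub_vimage: "Sub N \<Longrightarrow> Sub N' \<Longrightarrow> comap f \<Longrightarrow> Sub {n \<in> N. f n \<in> N'}"
  by (rule left_subcomodule_vimage[OF flat]) (assumption | simp add: comap_def comap_colinear)+

lemma comap_id: "comap (\<lambda>c. c)"
  by (auto simp: comap_def left_module_hom_def hom_def)

lemma Sub_Int: "Sub N \<Longrightarrow> Sub N' \<Longrightarrow> Sub (N \<inter> N')"
  using Sub_vimage[OF _ _ comap_id, of N N'] by (simp add: Int_def)

section \<open>Sums, unions, complements and projections of subcomodules\<close>

lemma SubD:
  assumes "Sub N"
  shows "additive_subgroup N C" "left_submodule A C N" "N \<subseteq> carrier C"
    "\<And>a n. a \<in> carrier A \<Longrightarrow> n \<in> N \<Longrightarrow> a \<odot> n \<in> N" "\<And>n. n \<in> N \<Longrightarrow> \<Delta> n \<in> CC.sub_image N"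
    "\<zero> \<in> N" "\<And>m n. m \<in> N \<Longrightarrow> n \<in> N \<Longrightarrow> m \<oplus> n \<in> N" "\<And>m n. m \<in> N \<Longrightarrow> n \<in> N \<Longrightarrow> m \<ominus> n \<in> N"
proof -
  show m: "left_submodule A C N" using assms by (simp add: left_subcomodule_iff)
  then show a: "additive_subgroup N C" by (simp add: left_submodule_def)
  interpret additive_subgroup N C by (rule a)
  show "N \<subseteq> carrier C" "\<zero> \<in> N" "\<And>m n. m \<in> N \<Longrightarrow> n \<in> N \<Longrightarrow> m \<oplus> n \<in> N"
    "\<And>m n. m \<in> N \<Longrightarrow> n \<in> N \<Longrightarrow> m \<ominus> n \<in> N"
    using a_subset additive_subgroup_minus[OF M.abelian_group_axioms a] by auto
  show "\<And>a n. a \<in> carrier A \<Longrightarrow> n \<in> N \<Longrightarrow> a \<odot> n \<in> N" using m by (simp add: left_submodule_def)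
  show "\<And>n. n \<in> N \<Longrightarrow> \<Delta> n \<in> CC.sub_image N" using assms by (auto simp: left_subcomodule_iff)
qed

lemma SubI:
  assumes "N \<subseteq> carrier C" "\<zero> \<in> N" "\<And>m n. m \<in> N \<Longrightarrow> n \<in> N \<Longrightarrow> m \<oplus> n \<in> N"
    and smult: "\<And>a n. a \<in> carrier A \<Longrightarrow> n \<in> N \<Longrightarrow> a \<odot> n \<in> N"
    and "left_submodule A C N \<Longrightarrow> \<Delta> ` N \<subseteq> CC.sub_image N"
  shows "Sub N"
proof -
  have "\<ominus> n \<in> N" if "n \<in> N" for n
    using smult[of "\<ominus>\<^bsub>A\<^esub> \<one>\<^bsub>A\<^esub>" n] that assms(1) by (auto simp: smult_uminus_left smult_one)
  then have "additive_subgroup N C"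
    using assms by (intro additive_subgroupI' M.abelian_group_axioms) auto
  then show ?thesis using assms by (auto simp: left_subcomodule_iff left_submodule_def)
qed

lemma Sub_zero: "Sub {\<zero>}"
proof -
  have "gspan {} = {\<zero>}"
  proof
    show "gspan {} \<subseteq> {\<zero>}"
    proof
      fix c assume "c \<in> gspan {}"
      then show "c \<in> {\<zero>}" by induction auto
    qed
  qed (simp add: gspan.zero)
  then show ?thesis using gspan_Sub[of "{}"] by simp
qed

lemma Sub_sum_upper:
  assumes L: "Sub L" and L': "Sub L'"
  shows "L \<subseteq> {l \<oplus> l' | l l'. l \<in> L \<and> l' \<in> L'}" "L' \<subseteq> {l \<oplus> l' | l l'. l \<in> L \<and> l' \<in> L'}"
proof -
  have "l = l \<oplus> \<zero>" if "l \<in> L" for l using SubD(3)[OF L] that by auto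
  then show "L \<subseteq> {l \<oplus> l' | l l'. l \<in> L \<and> l' \<in> L'}" using SubD(6)[OF L'] by blast
  have "l = \<zero> \<oplus> l" if "l \<in> L'" for l using SubD(3)[OF L'] that by auto
  then show "L' \<subseteq> {l \<oplus> l' | l l'. l \<in> L \<and> l' \<in> L'}" using SubD(6)[OF L] by blast
qed

lemma Sub_sum:
  assumes L: "Sub L" and L': "Sub L'"
  shows "Sub {l \<oplus> l' | l l'. l \<in> L \<and> l' \<in> L'}"
proof (rule SubI)
  let ?S = "{l \<oplus> l' | l l'. l \<in> L \<and> l' \<in> L'}"
  have cl: "l \<in> L \<Longrightarrow> l \<in> carrier C" "l \<in> L' \<Longrightarrow> l \<in> carrier C" for l
    using SubD(3)[OF L] SubD(3)[OF L'] by auto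
  show S: "?S \<subseteq> carrier C" using cl by auto
  note i = Sub_sum_upper[OF L L']
  show "\<zero> \<in> ?S" using SubD(6)[OF L] i(1) by blast
  show "m \<oplus> n \<in> ?S" if m: "m \<in> ?S" and n: "n \<in> ?S" for m n
  proof -
    obtain l l' where l: "l \<in> L" "l' \<in> L'" "m = l \<oplus> l'" using m by blast
    obtain k k' where k: "k \<in> L" "k' \<in> L'" "n = k \<oplus> k'" using n by blast
    note lk = l k
    then have "m \<oplus> n = (l \<oplus> k) \<oplus> (l' \<oplus> k')"
      using cl by (simp add: M.a_ac)
    then show ?thesis using lk SubD(7)[OF L] SubD(7)[OF L'] by blast
  qed
  show "a \<odot> n \<in> ?S" if "a \<in> carrier A" and n: "n \<in> ?S" for a n
  proof -
    obtain l l' where l: "l \<in> L" "l' \<in> L'" "n = l \<oplus> l'" using n by blast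
    then have "a \<odot> n = a \<odot> l \<oplus> a \<odot> l'" using cl that by (simp add: smult_r_distr)
    then show ?thesis using l SubD(4)[OF L] SubD(4)[OF L'] that by blast
  qed
  assume m: "left_submodule A C ?S"
  interpret I: additive_subgroup "CC.sub_image ?S" CC.T by (rule CC.sub_image_subgroup[OF m])
  have sub: "CC.sub_image L \<subseteq> CC.sub_image ?S" "CC.sub_image L' \<subseteq> CC.sub_image ?S"
    using CC.sub_image_mono[OF SubD(2)[OF L] m i(1)] CC.sub_image_mono[OF SubD(2)[OF L'] m i(2)] .
  show "\<Delta> ` ?S \<subseteq> CC.sub_image ?S"
  proof clarify
    fix l l' assume l: "l \<in> L" "l' \<in> L'"
    then have "\<Delta> l \<in> CC.sub_image ?S" "\<Delta> l' \<in> CC.sub_image ?S"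
      using SubD(5)[OF L] SubD(5)[OF L'] sub by auto
    then have "\<Delta> l \<oplus>\<^bsub>CC.T\<^esub> \<Delta> l' \<in> CC.sub_image ?S" by (rule I.a_closed)
    then show "\<Delta> (l \<oplus> l') \<in> CC.sub_image ?S"
      using ahom_add[OF comult_ahom, of l l'] l cl by simp
  qed
qed

lemma Sub_Union_chain:
  assumes "\<C> \<noteq> {}" "\<And>N. N \<in> \<C> \<Longrightarrow> Sub N"
    and chain: "\<And>M N. M \<in> \<C> \<Longrightarrow> N \<in> \<C> \<Longrightarrow> M \<subseteq> N \<or> N \<subseteq> M"
  shows "Sub (\<Union>\<C>)"
proof (rule SubI)
  show "\<Union>\<C> \<subseteq> carrier C" using SubD(3)[OF assms(2)] by blast
  show "\<zero> \<in> \<Union>\<C>" using SubD(6)[OF assms(2)] assms(1) by blast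
  show "m \<oplus> n \<in> \<Union>\<C>" if m: "m \<in> \<Union>\<C>" and n: "n \<in> \<Union>\<C>" for m n
  proof -
    obtain M N where MN: "m \<in> M" "M \<in> \<C>" "n \<in> N" "N \<in> \<C>" using m n by blast
    then have "m \<in> N \<and> n \<in> N \<or> m \<in> M \<and> n \<in> M" using chain[OF MN(2,4)] by blast
    then show ?thesis using SubD(7)[OF assms(2)[OF MN(2)], of m n] SubD(7)[OF assms(2)[OF MN(4)], of m n] MN by blast
  qed
  show "a \<odot> n \<in> \<Union>\<C>" if "a \<in> carrier A" "n \<in> \<Union>\<C>" for a n
    using that SubD(4)[OF assms(2)] by blast
  assume m: "left_submodule A C (\<Union>\<C>)"
  show "\<Delta> ` \<Union>\<C> \<subseteq> CC.sub_image (\<Union>\<C>)"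
  proof clarify
    fix n N assume n: "n \<in> N" "N \<in> \<C>"
    then have "\<Delta> n \<in> CC.sub_image N" using SubD(5)[OF assms(2)] by blast
    then show "\<Delta> n \<in> CC.sub_image (\<Union>\<C>)"
      using CC.sub_image_mono[OF SubD(2)[OF assms(2)[OF n(2)]] m] n(2) by blast
  qed
qed

text \<open>A subcomodule maximal among those meeting \<open>L\<close> trivially is a complement: a simple
  subcomodule \<open>S\<close> not contained in the sum would meet it trivially and could be added.\<close>

lemma Sub_complement:
  assumes L: "Sub L"
  obtains L' where "Sub L'" "L \<inter> L' = {\<zero>}"
    "\<And>c. c \<in> carrier C \<Longrightarrow> \<exists>l\<in>L. \<exists>l'\<in>L'. c = l \<oplus> l'"
proof -
  let ?\<A> = "{N. Sub N \<and> L \<inter> N = {\<zero>}}"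
  have "\<exists>M\<in>?\<A>. \<forall>N\<in>?\<A>. M \<subseteq> N \<longrightarrow> N = M"
  proof (rule subset_Zorn_nonempty)
    have "{\<zero>} \<in> ?\<A>" using Sub_zero SubD(6)[OF L] by auto
    then show "?\<A> \<noteq> {}" by blast
    fix \<C> assume \<C>: "\<C> \<noteq> {}" "subset.chain ?\<A> \<C>"
    then have "Sub (\<Union>\<C>)"
      by (intro Sub_Union_chain) (auto simp: subset_chain_def)
    moreover have "L \<inter> \<Union>\<C> = {\<zero>}"
      using \<C> by (auto simp: subset_chain_def)
    ultimately show "\<Union>\<C> \<in> ?\<A>" by blast
  qed
  then obtain L' where "L' \<in> ?\<A>" and "\<forall>N\<in>?\<A>. L' \<subseteq> N \<longrightarrow> N = L'" by (rule bexE)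
  then have L': "Sub L'" "L \<inter> L' = {\<zero>}"
    and max: "\<And>N. Sub N \<Longrightarrow> L \<inter> N = {\<zero>} \<Longrightarrow> L' \<subseteq> N \<Longrightarrow> N = L'" by simp_all
  define H where "H = {l \<oplus> l' | l l'. l \<in> L \<and> l' \<in> L'}"
  have H: "Sub H" unfolding H_def by (rule Sub_sum[OF L L'(1)])
  have cl: "l \<in> L \<Longrightarrow> l \<in> carrier C" "l \<in> L' \<Longrightarrow> l \<in> carrier C" for l
    using SubD(3)[OF L] SubD(3)[OF L'(1)] by auto
  have LH: "L' \<subseteq> H" unfolding H_def by (rule Sub_sum_upper(2)[OF L L'(1)])
  obtain \<S> where \<S>: "\<And>S. S \<in> \<S> \<Longrightarrow> simple_left_subcomodule A C C \<Delta> S" "internal_direct_sum C \<S>"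
    using simple_semisimple
    unfolding simple_semisimple_coring_def semisimple_coring_def semisimple_left_comodule_def by blast
  have SS: "Sub S" if "S \<in> \<S>" for S
    using \<S>(1)[OF that] by (simp add: simple_left_subcomodule_def)
  have "S \<subseteq> H" if S: "S \<in> \<S>" for S
  proof -
    have "Sub (S \<inter> H)" by (rule Sub_Int[OF SS[OF S] H])
    then have "S \<inter> H = {\<zero>} \<or> S \<inter> H = S"
      using \<S>(1)[OF S] unfolding simple_left_subcomodule_def by blast
    moreover have "S \<subseteq> H" if 0: "S \<inter> H = {\<zero>}"
    proof -
      let ?N = "{l \<oplus> l' | l l'. l \<in> L' \<and> l' \<in> S}"
      have N: "Sub ?N" by (rule Sub_sum[OF L'(1) SS[OF S]])
      have Sc: "s \<in> S \<Longrightarrow> s \<in> carrier C" for s using SubD(3)[OF SS[OF S]] by auto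
      have "L \<inter> ?N \<subseteq> {\<zero>}"
      proof clarify
        fix l s assume ls: "l \<oplus> s \<in> L" "l \<in> L'" "s \<in> S"
        \<comment> \<open>Written as the difference of an element of \<open>L\<close> and one of
          \<open>L'\<close>, \<open>s\<close> lies in \<open>H\<close>, hence in the zero
          intersection of \<open>S\<close> with \<open>H\<close>. What remains is an element of
          \<open>L\<close> and \<open>L'\<close>.\<close>
        have "s = (l \<oplus> s) \<oplus> \<ominus> l"
          using ls cl Sc by (metis M.a_comm M.a_inv_closed M.r_neg1 M.a_closed)
        moreover have "\<ominus> l \<in> L'"
          using additive_subgroup_uminus[OF M.abelian_group_axioms SubD(1)[OF L'(1)] ls(2)] .
        ultimately have "s \<in> H" unfolding H_def using ls by blast
        then have "s = \<zero>" using 0 ls by blast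
        then show "l \<oplus> s = \<zero>" using ls cl L'(2) by auto
      qed
      then have "L \<inter> ?N = {\<zero>}" using SubD(6)[OF L] SubD(6)[OF N] by blast
      then have NL: "?N = L'" by (rule max[OF N _ Sub_sum_upper(1)[OF L'(1) SS[OF S]]])
      have "S \<subseteq> ?N" by (rule Sub_sum_upper(2)[OF L'(1) SS[OF S]])
      then show "S \<subseteq> H" unfolding NL using LH by (rule order_trans)
    qed
    ultimately show "S \<subseteq> H" by blast
  qed
  then have "carrier C \<subseteq> H"
    by (intro internal_direct_sum_generates[OF M.abelian_group_axioms \<S>(2)] SubD(1) SS H)
  then show ?thesis using that[OF L'] unfolding H_def by blast
qed

text \<open>The projection along a complement. The point beyond linearity is that it sends g x to
  some g y; this is where both summands being subcomodules is used.\<close>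

lemma Sub_projection:
  assumes L: "Sub L"
  obtains p where "comap p" "\<And>c. c \<in> carrier C \<Longrightarrow> p c \<in> L" "\<And>l. l \<in> L \<Longrightarrow> p l = l"
proof -
  obtain L' where L': "Sub L'" "L \<inter> L' = {\<zero>}"
    and ex: "\<And>c. c \<in> carrier C \<Longrightarrow> \<exists>l\<in>L. \<exists>l'\<in>L'. c = l \<oplus> l'"
    by (rule Sub_complement[OF L]) blast
  have cl: "l \<in> L \<Longrightarrow> l \<in> carrier C" "l \<in> L' \<Longrightarrow> l \<in> carrier C" for l
    using SubD(3)[OF L] SubD(3)[OF L'(1)] by auto
  have uniq: "l = k" if "l \<oplus> l' = k \<oplus> k'" "l \<in> L" "k \<in> L" "l' \<in> L'" "k' \<in> L'" for l l' k k'
  proof -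
    have "l \<ominus> k = k' \<ominus> l'"
      using that cl by (intro M.minus_eq_minus) auto
    then have "l \<ominus> k \<in> L \<inter> L'" using SubD(8)[OF L that(2,3)] SubD(8)[OF L'(1) that(5,4)] by simp
    then show ?thesis using L'(2) M.minus_eq_zero_iff that cl by auto
  qed
  define p where "p c = (THE l. l \<in> L \<and> (\<exists>l'\<in>L'. c = l \<oplus> l'))" for c
  have p: "p (l \<oplus> l') = l" if "l \<in> L" "l' \<in> L'" for l l'
    unfolding p_def using that uniq by (intro the_equality) blast+
  have pL: "p l = l" if "l \<in> L" for l
    using p[OF that SubD(6)[OF L'(1)]] that cl by simp
  have hom: "p \<in> left_module_hom A C C"
  proof (rule left_module_homI)
    fix c assume "c \<in> carrier C"
    then obtain l l' where l: "l \<in> L" "l' \<in> L'" "c = l \<oplus> l'" using ex by blast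
    then show "p c \<in> carrier C" using p cl by simp
    {
      fix d assume "d \<in> carrier C"
      then obtain k k' where k: "k \<in> L" "k' \<in> L'" "d = k \<oplus> k'" using ex by blast
      have "c \<oplus> d = (l \<oplus> k) \<oplus> (l' \<oplus> k')"
        using l k cl by (simp add: M.a_ac)
      then show "p (c \<oplus> d) = p c \<oplus> p d"
        using l k p SubD(7)[OF L] SubD(7)[OF L'(1)] by simp
    next
      fix a assume a: "a \<in> carrier A"
      have "a \<odot> c = a \<odot> l \<oplus> a \<odot> l'" using l cl a by (simp add: smult_r_distr)
      then show "p (a \<odot> c) = a \<odot> p c"
        using l p SubD(4)[OF L a] SubD(4)[OF L'(1) a] by simp
    }
  qed
  have coinv: "\<exists>y\<in>carrier A. p (g \<triangleleft> x) = g \<triangleleft> y" if x: "x \<in> carrier A" for x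
  proof -
    define \<phi> where "\<phi> = tensor_map A C C id p"
    have \<phi>: "\<phi> \<in> ahom CC.T CC.T"
      "m \<in> carrier C \<Longrightarrow> n \<in> carrier C \<Longrightarrow> \<phi> (CC.ts m n) = CC.ts m (p n)" for m n
      unfolding \<phi>_def by (rule CC.tensor_map_id[OF left_module_axioms hom]; assumption)+
    note \<phi>0 = ahom_zero[OF CC.T.abelian_group_axioms CC.T.abelian_group_axioms \<phi>(1)]
    have gx: "g \<triangleleft> x \<in> carrier C" using x by (simp add: rsmult_closed)
    then obtain l l' where l: "l \<in> L" "l' \<in> L'" "g \<triangleleft> x = l \<oplus> l'" using ex by blast
    \<comment> \<open>The map induced by \<open>p\<close> on C \<otimes> C is the identity on the
      image of C \<otimes> L and zero on that of C \<otimes> L'. Applied to the comultiplication of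
      g x = l + l' it leaves only the comultiplication of \<open>l\<close>, while on g \<otimes> g x
      it gives g \<otimes> l.\<close>
    have \<phi>L: "\<phi> t = t" if "t \<in> CC.sub_image L" for t
      using that
    proof (induction rule: CC.sub_image_induct[OF SubD(2)[OF L], consumes 1, case_names zero tens add])
      case zero
      show ?case by (rule \<phi>0)
    next
      case (tens m n)
      then show ?case using \<phi>(2)[of m n] cl pL by simp
    next
      case (add s t)
      then show ?case using ahom_add[OF \<phi>(1)] by simp
    qed
    have \<phi>L': "\<phi> t = \<zero>\<^bsub>CC.T\<^esub>" if "t \<in> CC.sub_image L'" for t
      using that
    proof (induction rule: CC.sub_image_induct[OF SubD(2)[OF L'(1)], consumes 1, case_names zero tens add])
      case zero
      show ?case by (rule \<phi>0)
    next
      case (tens m n)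
      then have "p n = \<zero>" using p[OF SubD(6)[OF L], of n] cl by simp
      then show ?case using \<phi>(2)[of m n] tens cl CC.tens_zero_right by simp
    next
      case (add s t)
      then show ?case using ahom_add[OF \<phi>(1)] by simp
    qed
    have pgx: "p (g \<triangleleft> x) = l" using p l by simp
    have lc: "l \<in> carrier C" "l' \<in> carrier C" using l cl by auto
    note \<Delta>c = ahom_closed[OF comult_ahom]
    have "\<Delta> (g \<triangleleft> x) = CC.ts g (g \<triangleleft> x)"
      using comult_elt[of "\<one>\<^bsub>A\<^esub>" x] x by (simp add: elt_one_left smult_one)
    then have "CC.ts g l = \<phi> (\<Delta> l \<oplus>\<^bsub>CC.T\<^esub> \<Delta> l')"
      using \<phi>(2)[of g "g \<triangleleft> x"] gx pgx ahom_add[OF comult_ahom lc] l by simp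
    also have "\<dots> = \<Delta> l"
      using ahom_add[OF \<phi>(1) \<Delta>c[OF lc(1)] \<Delta>c[OF lc(2)]] \<phi>L \<phi>L' SubD(5)[OF L l(1)] SubD(5)[OF L'(1) l(2)]
        \<Delta>c[OF lc(1)] by simp
    \<comment> \<open>Contracting the right factor by the counit names the witness: y is the counit
      of \<open>l\<close>.\<close>
    finally have "l = g \<triangleleft> \<epsilon> l"
      using contract_counit[OF lc(1)] contract(2)[OF counit_ahom counit_smult, of g l] lc by simp
    then show ?thesis using pgx lc by auto
  qed
  show ?thesis
  proof (rule that)
    show "comap p" using hom coinv by (simp add: comap_def)
    show "p c \<in> L" if "c \<in> carrier C" for c using ex[OF that] p by auto
  qed (rule pL)
qed

section \<open>Cyclic subcomodules and coefficient maps\<close>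

lemma gspan_singleton:
  assumes x: "x \<in> carrier A"
  shows "c \<in> gspan {x} \<longleftrightarrow> (\<exists>a\<in>carrier A. c = elt a x)"
proof
  assume "c \<in> gspan {x}"
  then show "\<exists>a\<in>carrier A. c = elt a x"
  proof induction
    case zero
    show ?case using elt_zero_left[OF x] by (metis A.zero_closed)
  next
    case (elt a y)
    then show ?case by blast
  next
    case (add c d)
    then obtain a b where "a \<in> carrier A" "c = elt a x" "b \<in> carrier A" "d = elt b x" by blast
    then show ?case using x by (intro bexI[where x = "a \<oplus>\<^bsub>A\<^esub> b"]) (simp_all add: elt_add_left)
  qed
qed (auto intro: gspan.elt)

lemma comap_elt:
  assumes f: "comap f" and a: "a \<in> carrier A" "x \<in> carrier A"
  shows "f (elt a x) = a \<odot> f (g \<triangleleft> x)"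
proof -
  have "elt a x = a \<odot> (g \<triangleleft> x)" using a by (simp add: elt_def smult_rsmult_assoc)
  then show ?thesis using comap_smult[OF f a(1), of "g \<triangleleft> x"] a by (simp add: rsmult_closed)
qed

lemma comap_g:
  assumes "comap f" "x \<in> carrier A"
  obtains y where "y \<in> carrier A" "f (g \<triangleleft> x) = g \<triangleleft> y"
  using assms unfolding comap_def by blast

lemma comap_coprojection:
  assumes p: "comap p"
  shows "comap (\<lambda>c. c \<ominus> p c)"
  unfolding comap_def
proof (intro conjI ballI)
  note pa = ahom_add[OF comap_ahom[OF p]] and pc = comap_closed[OF p]
  show "(\<lambda>c. c \<ominus> p c) \<in> left_module_hom A C C"
    by (rule left_module_homI)
      (simp_all add: pa pc comap_smult[OF p] smult_minus_right smult_closed,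
       simp_all add: a_minus_def pc M.minus_add M.a_ac)
  fix x assume x: "x \<in> carrier A"
  then obtain y where y: "y \<in> carrier A" "p (g \<triangleleft> x) = g \<triangleleft> y" by (rule comap_g[OF p])
  then show "\<exists>y\<in>carrier A. g \<triangleleft> x \<ominus> p (g \<triangleleft> x) = g \<triangleleft> y"
    using x by (intro bexI[where x = "x \<ominus>\<^bsub>A\<^esub> y"]) (simp_all add: rsmult_minus_right)
qed

lemma comap_comp:
  assumes f: "comap f" and h: "comap h"
  shows "comap (\<lambda>c. f (h c))"
  unfolding comap_def
proof (intro conjI ballI)
  show "(\<lambda>c. f (h c)) \<in> left_module_hom A C C"
    by (rule left_module_homI)
      (simp_all add: comap_closed[OF f] comap_closed[OF h] comap_smult[OF f] comap_smult[OF h]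
        ahom_add[OF comap_ahom[OF f]] ahom_add[OF comap_ahom[OF h]])
  fix x assume "x \<in> carrier A"
  then obtain y where "y \<in> carrier A" "h (g \<triangleleft> x) = g \<triangleleft> y" by (rule comap_g[OF h])
  then show "\<exists>y\<in>carrier A. f (h (g \<triangleleft> x)) = g \<triangleleft> y" using comap_g[OF f] by metis
qed

lemma comap_rsmult:
  assumes "x \<in> carrier A"
  shows "comap (\<lambda>c. c \<triangleleft> x)"
  unfolding comap_def
proof (intro conjI ballI)
  show "(\<lambda>c. c \<triangleleft> x) \<in> left_module_hom A C C"
    using assms by (intro left_module_homI) (simp_all add: rsmult_closed rsmult_l_distr smult_rsmult_assoc)
  fix y assume "y \<in> carrier A"
  then show "\<exists>z\<in>carrier A. g \<triangleleft> y \<triangleleft> x = g \<triangleleft> z"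
    using assms by (intro bexI[where x = "y \<otimes>\<^bsub>A\<^esub> x"]) (simp_all add: rsmult_assoc)
qed

text \<open>A subcomodule of \<open>A g\<close> is \<open>A z g\<close> for an idempotent coinvariant \<open>z\<close>.\<close>

lemma cyclic_projection:
  assumes L: "Sub L" "L \<subseteq> gspan {\<one>\<^bsub>A\<^esub>}"
  obtains z where "z \<in> B" "g \<triangleleft> z \<in> L"
    "\<And>a. a \<in> carrier A \<Longrightarrow> a \<odot> g \<in> L \<Longrightarrow> a \<otimes>\<^bsub>A\<^esub> z = a"
proof -
  obtain q where q: "comap q" "\<And>c. c \<in> carrier C \<Longrightarrow> q c \<in> L" "\<And>l. l \<in> L \<Longrightarrow> q l = l"
    by (rule Sub_projection[OF L(1)]) blast
  obtain z where z: "z \<in> carrier A" "q (g \<triangleleft> \<one>\<^bsub>A\<^esub>) = g \<triangleleft> z"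
    by (rule comap_g[OF q(1) A.one_closed])
  then have zL: "g \<triangleleft> z \<in> L" "q g = g \<triangleleft> z" using q(2)[of g] by (simp_all add: rsmult_one)
  \<comment> \<open>Being in A g, the element g z is also of the form a g, and the counit then
    forces a = z.\<close>
  then have "g \<triangleleft> z \<in> gspan {\<one>\<^bsub>A\<^esub>}" using L(2) by blast
  then obtain a where "a \<in> carrier A" "g \<triangleleft> z = a \<odot> g"
    using gspan_singleton[OF A.one_closed] elt_one_right by metis
  then have zB: "z \<in> B" using BI(1)[of a z] z by simp
  have az: "a \<otimes>\<^bsub>A\<^esub> z = a" if a: "a \<in> carrier A" "a \<odot> g \<in> L" for a
  proof -
    have "a \<odot> g = q (a \<odot> g)" using q(3) a by simp
    also have "\<dots> = a \<odot> (z \<odot> g)" using comap_smult[OF q(1) a(1), of g] zL zB by (simp add: B_iff)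
    also have "\<dots> = (a \<otimes>\<^bsub>A\<^esub> z) \<odot> g" using a(1) z(1) by (simp add: smult_assoc)
    finally show ?thesis using elt_left_inj[of a "a \<otimes>\<^bsub>A\<^esub> z"] a(1) z(1) by simp
  qed
  show ?thesis
  proof (rule that[OF zB zL(1)])
  qed (rule az)
qed

text \<open>\<open>\<psi>\<close> splits off the last summand of \<open>D + A g x\<close>: modulo \<open>D\<close>, the element \<open>g y\<close> is a
  multiple of \<open>g x\<close> by a coinvariant that depends additively on \<open>y\<close>.\<close>

lemma coefficient_map:
  assumes D: "Sub D" and x: "x \<in> carrier A"
  obtains \<psi> where "\<psi> \<in> ahom C A"
    "\<And>a c. a \<in> carrier A \<Longrightarrow> c \<in> carrier C \<Longrightarrow> \<psi> (a \<odot> c) = a \<otimes>\<^bsub>A\<^esub> \<psi> c"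
    "\<And>y. y \<in> carrier A \<Longrightarrow> \<psi> (g \<triangleleft> y) \<in> B"
    "\<And>y d a. y \<in> carrier A \<Longrightarrow> d \<in> D \<Longrightarrow> a \<in> carrier A \<Longrightarrow> g \<triangleleft> y = d \<oplus> elt a x \<Longrightarrow>
      g \<triangleleft> (y \<ominus>\<^bsub>A\<^esub> \<psi> (g \<triangleleft> y) \<otimes>\<^bsub>A\<^esub> x) \<in> D"
proof -
  obtain p where p: "comap p" "\<And>c. c \<in> carrier C \<Longrightarrow> p c \<in> D" "\<And>d. d \<in> D \<Longrightarrow> p d = d"
    by (rule Sub_projection[OF D]) blast
  have Dc: "d \<in> carrier C" if "d \<in> D" for d using SubD(3)[OF D] that by blast
  define \<pi> where "\<pi> c = c \<ominus> p c" for c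
  have \<pi>: "comap \<pi>" unfolding \<pi>_def by (rule comap_coprojection[OF p(1)])
  have \<pi>D: "\<pi> d = \<zero>" if "d \<in> D" for d
    using p(3)[OF that] Dc[OF that] by (simp add: \<pi>_def a_minus_def M.r_neg)
  have \<pi>0: "c \<in> D" if "c \<in> carrier C" "\<pi> c = \<zero>" for c
    using that p(2)[OF that(1)] M.minus_eq_zero_iff[of c "p c"] Dc unfolding \<pi>_def by simp
  \<comment> \<open>Only the values on A g matter: there a g goes to the class of a g x modulo
    \<open>D\<close>, realised in \<open>C\<close> as a g v. Thus \<open>v\<close> takes the place
    of \<open>x\<close> in a complement of \<open>D\<close>.\<close>
  define f where "f c = \<pi> (c \<triangleleft> x)" for c
  have f: "comap f" unfolding f_def by (rule comap_comp[OF \<pi> comap_rsmult[OF x]])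
  have f_elt: "f (a \<odot> g) = \<pi> (elt a x)" for a by (simp add: f_def elt_def)
  obtain v where v: "v \<in> carrier A" "f (g \<triangleleft> \<one>\<^bsub>A\<^esub>) = g \<triangleleft> v"
    by (rule comap_g[OF f A.one_closed])
  have fa: "f (a \<odot> g) = elt a v" if "a \<in> carrier A" for a
    using comap_elt[OF f that A.one_closed] v that
    by (simp add: elt_one_right elt_def smult_rsmult_assoc rsmult_one)
  \<comment> \<open>The kernel of \<open>f\<close> on A g. It measures the ambiguity of the
    coefficient \<open>a\<close> in a g v.\<close>
  define L where "L = {c \<in> gspan {\<one>\<^bsub>A\<^esub>}. f c \<in> {\<zero>}}"
  have L: "Sub L" "L \<subseteq> gspan {\<one>\<^bsub>A\<^esub>}"
    unfolding L_def using Sub_vimage[OF gspan_Sub Sub_zero f] by auto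
  have L_iff: "a \<odot> g \<in> L \<longleftrightarrow> elt a v = \<zero>" if "a \<in> carrier A" for a
    using that gspan.elt[of a "\<one>\<^bsub>A\<^esub>" "{\<one>\<^bsub>A\<^esub>}"] by (simp add: L_def fa elt_one_right)
  obtain z where z: "z \<in> B" "g \<triangleleft> z \<in> L"
    "\<And>a. a \<in> carrier A \<Longrightarrow> a \<odot> g \<in> L \<Longrightarrow> a \<otimes>\<^bsub>A\<^esub> z = a"
    by (rule cyclic_projection[OF L]) blast
  have zc: "z \<in> carrier A" using z(1) by (rule B_closed)
  \<comment> \<open>The idempotent complementary to the one that generates \<open>L\<close>.
    Multiplication by \<open>w\<close> kills exactly the ambiguity: \<open>aw0\<close> shows that a
    w depends only on a g v, and \<open>awv\<close> that a w is still a coefficient of this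
    element.\<close>
  define w where "w = \<one>\<^bsub>A\<^esub> \<ominus>\<^bsub>A\<^esub> z"
  have wB: "w \<in> B" unfolding w_def using B_minus z(1) subringE(3)[OF subring_B] by blast
  then have w: "w \<in> carrier A" by (rule B_closed)
  have aw: "a \<otimes>\<^bsub>A\<^esub> w = a \<ominus>\<^bsub>A\<^esub> a \<otimes>\<^bsub>A\<^esub> z" if "a \<in> carrier A" for a
    using that zc by (simp add: w_def a_minus_def A.r_distr A.r_minus)
  have aw0: "a \<otimes>\<^bsub>A\<^esub> w = \<zero>\<^bsub>A\<^esub>" if "a \<in> carrier A" "elt a v = \<zero>" for a
    using z(3)[of a] L_iff[of a] that by (simp add: aw a_minus_def A.r_neg)
  have awv: "elt (a \<otimes>\<^bsub>A\<^esub> w) v = elt a v" if a: "a \<in> carrier A" for a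
  proof -
    have "z \<odot> g \<in> L" using z by (simp add: B_iff)
    then have "(a \<otimes>\<^bsub>A\<^esub> z) \<odot> g \<in> L" using SubD(4)[OF L(1) a] a zc by (simp add: smult_assoc)
    then have "elt (a \<otimes>\<^bsub>A\<^esub> z) v = \<zero>" using L_iff a zc by simp
    then have "elt (a \<otimes>\<^bsub>A\<^esub> w) v = elt a v \<ominus> \<zero>" using a zc v(1) by (simp add: aw elt_minus_left)
    then show ?thesis using a v(1) by (simp add: a_minus_def M.uminus_zero)
  qed
  \<comment> \<open>Projecting onto A g v extends the coefficient to all of \<open>C\<close>; only
    then can it be used in \<open>contract\<close>.\<close>
  obtain r where r: "comap r" "\<And>c. c \<in> carrier C \<Longrightarrow> r c \<in> gspan {v}" "\<And>u. u \<in> gspan {v} \<Longrightarrow> r u = u"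
    using Sub_projection[OF gspan_Sub[of "{v}"]] v by blast
  have r_ex: "\<exists>a. a \<in> carrier A \<and> r c = elt a v" if "c \<in> carrier C" for c
    using r(2)[OF that] gspan_singleton[OF v(1)] by blast
  \<comment> \<open>The factor \<open>w\<close> makes the value independent of the chosen
    coefficient, which is what additivity and linearity rest on.\<close>
  define \<tau> where "\<tau> c = (SOME a. a \<in> carrier A \<and> r c = elt a v) \<otimes>\<^bsub>A\<^esub> w" for c
  have \<tau>: "\<tau> c = a \<otimes>\<^bsub>A\<^esub> w" if "c \<in> carrier C" "a \<in> carrier A" "r c = elt a v" for c a
  proof -
    let ?s = "SOME a. a \<in> carrier A \<and> r c = elt a v"
    have s: "?s \<in> carrier A" "r c = elt ?s v" using someI_ex[OF r_ex[OF that(1)]] by auto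
    have "elt (?s \<ominus>\<^bsub>A\<^esub> a) v = elt a v \<ominus> elt a v"
      using elt_minus_left[OF v(1) s(1) that(2)] s(2) that(3) by simp
    also have "\<dots> = \<zero>" using that(2) v by (simp add: a_minus_def M.r_neg)
    finally have "(?s \<ominus>\<^bsub>A\<^esub> a) \<otimes>\<^bsub>A\<^esub> w = \<zero>\<^bsub>A\<^esub>" using aw0 s that by simp
    then have "?s \<otimes>\<^bsub>A\<^esub> w \<ominus>\<^bsub>A\<^esub> a \<otimes>\<^bsub>A\<^esub> w = \<zero>\<^bsub>A\<^esub>"
      using s that w by (simp add: a_minus_def A.l_distr A.l_minus)
    then show ?thesis
      unfolding \<tau>_def using A.minus_eq_zero_iff[of "?s \<otimes>\<^bsub>A\<^esub> w" "a \<otimes>\<^bsub>A\<^esub> w"] s that w by simp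
  qed
  have \<tau>_ahom: "\<tau> \<in> ahom C A"
  proof (rule ahomI)
    fix c assume c: "c \<in> carrier C"
    then obtain a where a: "a \<in> carrier A" "r c = elt a v" using r_ex by blast
    show "\<tau> c \<in> carrier A" using \<tau>[OF c a] a w by simp
    fix d assume d: "d \<in> carrier C"
    then obtain b where b: "b \<in> carrier A" "r d = elt b v" using r_ex by blast
    have "r (c \<oplus> d) = elt (a \<oplus>\<^bsub>A\<^esub> b) v"
      using ahom_add[OF comap_ahom[OF r(1)] c d] a b v by (simp add: elt_add_left)
    then show "\<tau> (c \<oplus> d) = \<tau> c \<oplus>\<^bsub>A\<^esub> \<tau> d"
      using \<tau>[of "c \<oplus> d" "a \<oplus>\<^bsub>A\<^esub> b"] \<tau>[OF c a] \<tau>[OF d b] a b c d w by (simp add: A.l_distr)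
  qed
  have \<tau>_smult: "\<tau> (a \<odot> c) = a \<otimes>\<^bsub>A\<^esub> \<tau> c" if a: "a \<in> carrier A" and c: "c \<in> carrier C" for a c
  proof -
    obtain b where b: "b \<in> carrier A" "r c = elt b v" using c r_ex by blast
    have "r (a \<odot> c) = elt (a \<otimes>\<^bsub>A\<^esub> b) v"
      using comap_smult[OF r(1) a c] a b v by (simp add: elt_smult)
    then show ?thesis
      using \<tau>[of "a \<odot> c" "a \<otimes>\<^bsub>A\<^esub> b"] \<tau>[OF c b] a b c w by (simp add: smult_closed A.m_assoc)
  qed
  have \<tau>_B: "\<tau> (g \<triangleleft> y) \<in> B" if y: "y \<in> carrier A" for y
  proof -
    have gy: "g \<triangleleft> y \<in> carrier C" using y by (simp add: rsmult_closed)
    obtain a where a: "a \<in> carrier A" "r (g \<triangleleft> y) = elt a v" using r_ex[OF gy] by blast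
    obtain y' where y': "y' \<in> carrier A" "r (g \<triangleleft> y) = g \<triangleleft> y'" by (rule comap_g[OF r(1) y])
    have gv: "g \<triangleleft> v \<in> carrier C" using v by (simp add: rsmult_closed)
    have gv': "g \<triangleleft> v \<in> gspan {v}" using gspan.elt[of "\<one>\<^bsub>A\<^esub>" v "{v}"] v by (simp add: elt_one_left)
    have \<tau>v: "\<tau> (g \<triangleleft> v) = w"
      using \<tau>[OF gv A.one_closed] r(3)[OF gv'] v w by (simp add: elt_one_left)
    have ag: "a \<odot> g \<in> carrier C" "g \<triangleleft> a \<in> carrier C" using a by (simp_all add: smult_closed rsmult_closed)
    have eq: "elt a v = a \<odot> (g \<triangleleft> v)" using a v by (simp add: elt_def smult_rsmult_assoc)
    \<comment> \<open>The element a g v = g y' has two comultiplications, a g \<otimes> g v and g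
      \<otimes> a g v = g a \<otimes> g v. Contraction by \<tau>, whose value at g v is
      \<open>w\<close>, gives a g w = g a w; as \<open>w\<close> is coinvariant, so is a w.\<close>
    have "CC.ts (a \<odot> g) (g \<triangleleft> v) = \<Delta> (elt \<one>\<^bsub>A\<^esub> y')"
      using comult_elt[OF a(1) v(1)] a y' by (simp add: elt_one_left)
    also have "\<dots> = CC.ts g (elt a v)"
      using comult_elt[OF A.one_closed y'(1)] a y' by (simp add: smult_one)
    also have "\<dots> = CC.ts (g \<triangleleft> a) (g \<triangleleft> v)"
      unfolding eq using CC.tens_balanced[of g a "g \<triangleleft> v"] a gv by simp
    finally have "contract \<tau> (CC.ts (a \<odot> g) (g \<triangleleft> v)) = contract \<tau> (CC.ts (g \<triangleleft> a) (g \<triangleleft> v))"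
      by simp
    then have "(a \<odot> g) \<triangleleft> w = (g \<triangleleft> a) \<triangleleft> w"
      using contract(2)[OF \<tau>_ahom \<tau>_smult] ag gv \<tau>v by simp
    then have "(a \<otimes>\<^bsub>A\<^esub> w) \<odot> g = g \<triangleleft> (a \<otimes>\<^bsub>A\<^esub> w)"
      using wB a w by (simp add: smult_rsmult_assoc smult_assoc rsmult_assoc B_iff)
    then show ?thesis using \<tau>[OF gy a] a w by (simp add: B_iff)
  qed
  define \<psi> where "\<psi> c = \<tau> (\<pi> c)" for c
  show ?thesis
  proof (rule that)
    show "\<psi> \<in> ahom C A" unfolding \<psi>_def by (rule ahom_comp[OF comap_ahom[OF \<pi>] \<tau>_ahom])
    show "\<psi> (a \<odot> c) = a \<otimes>\<^bsub>A\<^esub> \<psi> c" if "a \<in> carrier A" "c \<in> carrier C" for a c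
      using that by (simp add: \<psi>_def comap_smult[OF \<pi>] comap_closed[OF \<pi>] \<tau>_smult)
    show \<psi>B: "\<psi> (g \<triangleleft> y) \<in> B" if y: "y \<in> carrier A" for y
      using comap_g[OF \<pi> y] \<tau>_B unfolding \<psi>_def by metis
    fix y d a assume y: "y \<in> carrier A" and d: "d \<in> D" and a: "a \<in> carrier A"
      and eq: "g \<triangleleft> y = d \<oplus> elt a x"
    have gy: "g \<triangleleft> y \<in> carrier C" using y by (simp add: rsmult_closed)
    have "\<pi> (g \<triangleleft> y) = \<pi> d \<oplus> \<pi> (elt a x)"
      unfolding eq using ahom_add[OF comap_ahom[OF \<pi>]] Dc[OF d] a x by simp
    then have \<pi>y: "\<pi> (g \<triangleleft> y) = elt a v"
      using \<pi>D[OF d] fa[OF a] a v by (simp add: f_elt)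
    have "elt a v \<in> gspan {v}" using a by (simp add: gspan.elt)
    then have \<psi>y: "\<psi> (g \<triangleleft> y) = a \<otimes>\<^bsub>A\<^esub> w"
      unfolding \<psi>_def \<pi>y using \<tau>[of "elt a v" a] r(3) a v by simp
    let ?b = "a \<otimes>\<^bsub>A\<^esub> w"
    have b: "?b \<in> carrier A" "?b \<in> B" using \<psi>B[OF y] \<psi>y a w by auto
    \<comment> \<open>Membership in \<open>D\<close> is tested by \<pi>: both g y and b g x are sent
      to a g v, because b = a w and a w g v = a g v.\<close>
    have "g \<triangleleft> (y \<ominus>\<^bsub>A\<^esub> ?b \<otimes>\<^bsub>A\<^esub> x) = g \<triangleleft> y \<ominus> elt ?b x"
      using elt_coinvariant[OF b(2) A.one_closed x] y b(1) x
      by (simp add: rsmult_minus_right elt_one_left)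
    moreover have "\<pi> (g \<triangleleft> y \<ominus> elt ?b x) = \<zero>"
      using ahom_minus[OF M.abelian_group_axioms M.abelian_group_axioms comap_ahom[OF \<pi>] gy, of "elt ?b x"]
        fa[OF b(1)] awv[OF a] \<pi>y b(1) x a v by (simp add: f_elt a_minus_def M.r_neg)
    ultimately show "g \<triangleleft> (y \<ominus>\<^bsub>A\<^esub> \<psi> (g \<triangleleft> y) \<otimes>\<^bsub>A\<^esub> x) \<in> D"
      unfolding \<psi>y using \<pi>0 gy b(1) x by simp
  qed
qed

section \<open>Induction over finitely many generators: saturation and partial sections\<close>

lemma gspan_insert:
  assumes "c \<in> gspan (insert x X)" "x \<in> carrier A" "X \<subseteq> carrier A"
  shows "\<exists>d\<in>gspan X. \<exists>a\<in>carrier A. c = d \<oplus> elt a x"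
  using assms(1)
proof induction
  case zero
  have "\<zero> = \<zero> \<oplus> elt \<zero>\<^bsub>A\<^esub> x" using elt_zero_left[OF assms(2)] by simp
  then show ?case using gspan.zero by blast
next
  case (elt a y)
  show ?case
  proof (cases "y = x")
    case True
    then have "elt a y = \<zero> \<oplus> elt a x" using elt assms(2) by simp
    then show ?thesis using gspan.zero elt by blast
  next
    case False
    then have y: "y \<in> X" using elt by simp
    then have "elt a y = elt a y \<oplus> elt \<zero>\<^bsub>A\<^esub> x"
      using elt assms(3) elt_zero_left[OF assms(2)] by (simp add: subset_iff)
    then show ?thesis using gspan.elt[OF elt(1) y] by blast
  qed
next
  case (add c c')
  then obtain d a d' a' where d: "d \<in> gspan X" "a \<in> carrier A" "c = d \<oplus> elt a x"
    "d' \<in> gspan X" "a' \<in> carrier A" "c' = d' \<oplus> elt a' x" by blast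
  then have "c \<oplus> c' = (d \<oplus> d') \<oplus> elt (a \<oplus>\<^bsub>A\<^esub> a') x"
    using assms(2) gspan_closed[OF assms(3)] by (simp add: elt_add_left M.a_ac)
  then show ?case using d gspan.add by blast
qed

lemma gspan_finite:
  assumes "c \<in> gspan X"
  shows "\<exists>xs. set xs \<subseteq> X \<and> c \<in> gspan (set xs)"
  using assms
proof induction
  case zero
  then show ?case by (intro exI[where x = "[]"]) (simp add: gspan.zero)
next
  case (elt a x)
  then show ?case by (intro exI[where x = "[x]"]) (simp add: gspan.elt)
next
  case (add c d)
  then obtain xs ys where xs: "set xs \<subseteq> X" "c \<in> gspan (set xs)" "set ys \<subseteq> X" "d \<in> gspan (set ys)" by blast
  then have "c \<in> gspan (set (xs @ ys))" "d \<in> gspan (set (xs @ ys))"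
    using gspan_mono[of "set xs" "set (xs @ ys)"] gspan_mono[of "set ys" "set (xs @ ys)"] by auto
  then show ?case using xs by (intro exI[where x = "xs @ ys"]) (auto intro: gspan.add)
qed

lemma gspan_empty: "c \<in> gspan {} \<Longrightarrow> c = \<zero>"
  by (induction rule: gspan.induct) auto

lemma g_zero: "y \<in> carrier A \<Longrightarrow> g \<triangleleft> y = \<zero> \<Longrightarrow> y = \<zero>\<^bsub>A\<^esub>"
  using elt_right_inj[of y "\<zero>\<^bsub>A\<^esub>"] by (simp add: rsmult_zero_right)

text \<open>This recovers a left \<open>B\<close>-submodule X of \<open>A\<close> from A g X. With X
  spanned by finitely many generators in play, \<open>coefficient_map\<close> replaces y by y - b x
  for a coinvariant b and removes x from the list; for the empty list g y = 0 forces y = 0.\<close>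

lemma gspan_saturated:
  assumes X: "X \<subseteq> carrier A" "\<zero>\<^bsub>A\<^esub> \<in> X" "\<And>x y. x \<in> X \<Longrightarrow> y \<in> X \<Longrightarrow> x \<oplus>\<^bsub>A\<^esub> y \<in> X"
    "\<And>b x. b \<in> B \<Longrightarrow> x \<in> X \<Longrightarrow> b \<otimes>\<^bsub>A\<^esub> x \<in> X"
    and y: "y \<in> carrier A" "g \<triangleleft> y \<in> gspan X"
  shows "y \<in> X"
proof -
  have "y \<in> X" if "set xs \<subseteq> X" "y \<in> carrier A" "g \<triangleleft> y \<in> gspan (set xs)" for xs y
    using that
  proof (induction xs arbitrary: y)
    case Nil
    then have "y = \<zero>\<^bsub>A\<^esub>" using gspan_empty g_zero by simp
    then show ?case using X(2) by simp
  next
    case (Cons x xs)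
    have x: "x \<in> X" "x \<in> carrier A" "set xs \<subseteq> X" "set xs \<subseteq> carrier A" using Cons.prems(1) X(1) by auto
    obtain \<psi> where \<psi>: "\<psi> (g \<triangleleft> y) \<in> B"
      "\<And>d a. d \<in> gspan (set xs) \<Longrightarrow> a \<in> carrier A \<Longrightarrow> g \<triangleleft> y = d \<oplus> elt a x \<Longrightarrow>
        g \<triangleleft> (y \<ominus>\<^bsub>A\<^esub> \<psi> (g \<triangleleft> y) \<otimes>\<^bsub>A\<^esub> x) \<in> gspan (set xs)"
      by (rule coefficient_map[OF gspan_Sub[OF x(4)] x(2)]) (use Cons.prems(2) in blast)
    let ?b = "\<psi> (g \<triangleleft> y)"
    have b: "?b \<in> carrier A" using \<psi>(1) by (rule B_closed)
    have "g \<triangleleft> y \<in> gspan (insert x (set xs))" using Cons.prems(3) by simp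
    then obtain d a where "d \<in> gspan (set xs)" "a \<in> carrier A" "g \<triangleleft> y = d \<oplus> elt a x"
      using gspan_insert x by blast
    then have "y \<ominus>\<^bsub>A\<^esub> ?b \<otimes>\<^bsub>A\<^esub> x \<in> X"
      using \<psi>(2) Cons.IH[OF x(3)] Cons.prems(2) b x(2) by simp
    then have "(y \<ominus>\<^bsub>A\<^esub> ?b \<otimes>\<^bsub>A\<^esub> x) \<oplus>\<^bsub>A\<^esub> ?b \<otimes>\<^bsub>A\<^esub> x \<in> X" using X(3,4) \<psi>(1) x(1) by blast
    moreover have "(y \<ominus>\<^bsub>A\<^esub> ?b \<otimes>\<^bsub>A\<^esub> x) \<oplus>\<^bsub>A\<^esub> ?b \<otimes>\<^bsub>A\<^esub> x = y"
      using Cons.prems(2) b x(2) by (simp add: a_minus_def A.a_assoc A.l_neg)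
    ultimately show ?case by simp
  qed
  then show ?thesis using gspan_finite[OF y(2)] y(1) by blast
qed

text \<open>A balanced \<beta> is turned into an additive map out of \<open>C\<close> that is
  correct for finitely many right factors. The claim concerns every y with g y in the span, rather
  than the listed factors alone, because the induction passes from y to y - b x.\<close>

lemma partial_section:
  assumes G: "abelian_group G"
    and \<beta>: "\<And>a. a \<in> carrier A \<Longrightarrow> \<beta> a \<in> ahom A G" "\<And>x. x \<in> carrier A \<Longrightarrow> (\<lambda>a. \<beta> a x) \<in> ahom A G"
    "\<And>a b x. a \<in> carrier A \<Longrightarrow> b \<in> B \<Longrightarrow> x \<in> carrier A \<Longrightarrow> \<beta> (a \<otimes>\<^bsub>A\<^esub> b) x = \<beta> a (b \<otimes>\<^bsub>A\<^esub> x)"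
    and xs: "set xs \<subseteq> carrier A"
  shows "\<exists>s\<in>ahom C G. \<forall>a\<in>carrier A. \<forall>y\<in>carrier A. g \<triangleleft> y \<in> gspan (set xs) \<longrightarrow> s (elt a y) = \<beta> a y"
  using xs
proof (induction xs)
  case Nil
  interpret G: abelian_group G by fact
  have z: "(\<lambda>_. \<zero>\<^bsub>G\<^esub>) \<in> ahom C G" by (rule ahomI) simp_all
  have e: "\<zero>\<^bsub>G\<^esub> = \<beta> a y"
    if "a \<in> carrier A" "y \<in> carrier A" "g \<triangleleft> y \<in> gspan (set [])" for a y
  proof -
    have "y = \<zero>\<^bsub>A\<^esub>" using that gspan_empty g_zero by simp
    then show ?thesis using ahom_zero[OF A.abelian_group_axioms G \<beta>(1)[OF that(1)]] by simp
  qed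
  show ?case by (rule bexI[OF _ z], intro ballI impI) (rule e)
next
  case (Cons x xs)
  interpret G: abelian_group G by fact
  have x: "x \<in> carrier A" "set xs \<subseteq> carrier A" using Cons.prems by auto
  obtain s where s: "s \<in> ahom C G"
    "\<And>a y. a \<in> carrier A \<Longrightarrow> y \<in> carrier A \<Longrightarrow> g \<triangleleft> y \<in> gspan (set xs) \<Longrightarrow> s (elt a y) = \<beta> a y"
    using Cons.IH[OF x(2)] by blast
  obtain \<psi> where \<psi>: "\<psi> \<in> ahom C A"
    "\<And>a c. a \<in> carrier A \<Longrightarrow> c \<in> carrier C \<Longrightarrow> \<psi> (a \<odot> c) = a \<otimes>\<^bsub>A\<^esub> \<psi> c"
    "\<And>y. y \<in> carrier A \<Longrightarrow> \<psi> (g \<triangleleft> y) \<in> B"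
    "\<And>y d a. y \<in> carrier A \<Longrightarrow> d \<in> gspan (set xs) \<Longrightarrow> a \<in> carrier A \<Longrightarrow> g \<triangleleft> y = d \<oplus> elt a x \<Longrightarrow>
      g \<triangleleft> (y \<ominus>\<^bsub>A\<^esub> \<psi> (g \<triangleleft> y) \<otimes>\<^bsub>A\<^esub> x) \<in> gspan (set xs)"
    by (rule coefficient_map[OF gspan_Sub[OF x(2)] x(1)]) blast
  \<comment> \<open>The part of \<open>c\<close> along g x is read off by \<psi> and sent where
    \<beta> prescribes; the rest is left to \<open>s\<close>. On a g y the rest is a g (y - b x)
    with b coinvariant, and balancedness of \<beta> reassembles the two values.\<close>
  define s' where "s' c = s (c \<ominus> elt (\<psi> c) x) \<oplus>\<^bsub>G\<^esub> \<beta> (\<psi> c) x" for c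
  have el: "(\<lambda>c. elt (\<psi> c) x) \<in> ahom C C" by (rule ahom_comp[OF \<psi>(1) elt_ahom_left[OF x(1)]])
  have "(\<lambda>c. c \<ominus> elt (\<psi> c) x) \<in> ahom C C"
    using ahom_closed[OF el] ahom_add[OF el]
    by (intro ahomI) (simp_all add: a_minus_def M.minus_add M.a_ac)
  then have s': "s' \<in> ahom C G"
    unfolding s'_def
    by (intro ahom_sum[OF G ahom_comp[OF _ s(1)] ahom_comp[OF \<psi>(1) \<beta>(2)[OF x(1)]]])
  moreover have "s' (elt a y) = \<beta> a y"
    if ay: "a \<in> carrier A" "y \<in> carrier A" "g \<triangleleft> y \<in> gspan (set (x # xs))" for a y
  proof -
    let ?b = "\<psi> (g \<triangleleft> y)"
    have b: "?b \<in> B" "?b \<in> carrier A" using \<psi>(3)[OF ay(2)] B_closed by auto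
    have "elt a y = a \<odot> (g \<triangleleft> y)" using ay by (simp add: elt_def smult_rsmult_assoc)
    then have \<psi>e: "\<psi> (elt a y) = a \<otimes>\<^bsub>A\<^esub> ?b" using \<psi>(2)[OF ay(1), of "g \<triangleleft> y"] ay by (simp add: rsmult_closed)
    have bx: "?b \<otimes>\<^bsub>A\<^esub> x \<in> carrier A" using b x by simp
    have "elt a y \<ominus> elt (\<psi> (elt a y)) x = elt a (y \<ominus>\<^bsub>A\<^esub> ?b \<otimes>\<^bsub>A\<^esub> x)"
      using elt_coinvariant[OF b(1) ay(1) x(1)] elt_minus_right[OF ay(1) ay(2) bx] \<psi>e by simp
    moreover have "g \<triangleleft> (y \<ominus>\<^bsub>A\<^esub> ?b \<otimes>\<^bsub>A\<^esub> x) \<in> gspan (set xs)"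
      using gspan_insert[of "g \<triangleleft> y" x "set xs"] ay(3) x \<psi>(4)[OF ay(2)] by auto
    ultimately have "s' (elt a y) = \<beta> a (y \<ominus>\<^bsub>A\<^esub> ?b \<otimes>\<^bsub>A\<^esub> x) \<oplus>\<^bsub>G\<^esub> \<beta> (a \<otimes>\<^bsub>A\<^esub> ?b) x"
      unfolding s'_def using s(2)[OF ay(1), of "y \<ominus>\<^bsub>A\<^esub> ?b \<otimes>\<^bsub>A\<^esub> x"] ay bx \<psi>e by simp
    also have "\<dots> = \<beta> a ((y \<ominus>\<^bsub>A\<^esub> ?b \<otimes>\<^bsub>A\<^esub> x) \<oplus>\<^bsub>A\<^esub> ?b \<otimes>\<^bsub>A\<^esub> x)"
      using ahom_add[OF \<beta>(1)[OF ay(1)], of "y \<ominus>\<^bsub>A\<^esub> ?b \<otimes>\<^bsub>A\<^esub> x" "?b \<otimes>\<^bsub>A\<^esub> x"]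
        \<beta>(3)[OF ay(1) b(1) x(1)] ay bx by simp
    also have "(y \<ominus>\<^bsub>A\<^esub> ?b \<otimes>\<^bsub>A\<^esub> x) \<oplus>\<^bsub>A\<^esub> ?b \<otimes>\<^bsub>A\<^esub> x = y"
      using ay(2) bx by (simp add: a_minus_def A.a_assoc A.l_neg)
    finally show ?thesis .
  qed
  ultimately show ?case by (intro bexI[where x = s']) simp_all
qed

section \<open>The ring of coinvariants\<close>

abbreviation "BB \<equiv> A\<lparr>carrier := B\<rparr>"

lemma ring_BB: "ring BB" by (rule A.subring_is_ring[OF subring_B])

lemma left_ideal_generator:
  assumes "left_ideal I BB"
  shows "\<exists>z\<in>I. \<forall>i\<in>I. i \<otimes>\<^bsub>A\<^esub> z = i"
proof -
  interpret I: additive_subgroup I BB using assms by (simp add: left_ideal_def)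
  have IB: "i \<in> B" if "i \<in> I" for i using I.a_subset that by auto
  have Ic: "I \<subseteq> carrier A" using IB B_closed by blast
  have sub: "gspan I \<subseteq> gspan {\<one>\<^bsub>A\<^esub>}"
  proof
    fix c assume "c \<in> gspan I"
    then show "c \<in> gspan {\<one>\<^bsub>A\<^esub>}"
    proof induction
      case (elt a i)
      then have "elt a i = elt (a \<otimes>\<^bsub>A\<^esub> i) \<one>\<^bsub>A\<^esub>"
        using elt_coinvariant[OF IB, of i a "\<one>\<^bsub>A\<^esub>"] Ic by (simp add: subset_iff)
      then show ?case using elt Ic by (auto intro: gspan.elt)
    qed (auto intro: gspan.intros)
  qed
  obtain z where z: "z \<in> B" "g \<triangleleft> z \<in> gspan I"
    "\<And>a. a \<in> carrier A \<Longrightarrow> a \<odot> g \<in> gspan I \<Longrightarrow> a \<otimes>\<^bsub>A\<^esub> z = a"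
    by (rule cyclic_projection[OF gspan_Sub[OF Ic] sub]) blast
  \<comment> \<open>The projection only places g z in A g I; saturation brings \<open>z\<close> back
    into the ideal itself.\<close>
  have "z \<in> I"
    by (rule gspan_saturated[OF Ic _ _ _ B_closed[OF z(1)] z(2)])
      (use assms I.zero_closed I.a_closed in \<open>auto simp: left_ideal_def\<close>)
  moreover have "i \<otimes>\<^bsub>A\<^esub> z = i" if i: "i \<in> I" for i
  proof (rule z(3))
    show "i \<odot> g \<in> gspan I"
      using IB[OF i] gspan.elt[of "\<one>\<^bsub>A\<^esub>" i I] i by (simp add: B_iff elt_one_left)
  qed (use i Ic in blast)
  ultimately show ?thesis by blast
qed

sublocale BB: left_idempotent_ring BB
  by (intro left_idempotent_ring.intro left_idempotent_ring_axioms.intro ring_BB)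
    (use left_ideal_generator in simp)

lemma one_nonzero: "\<one>\<^bsub>A\<^esub> \<noteq> \<zero>\<^bsub>A\<^esub>"
proof
  assume "\<one>\<^bsub>A\<^esub> = \<zero>\<^bsub>A\<^esub>"
  then have "g = \<zero>" using smult_one[of g] smult_zero_left[of g] by simp
  then show False using g_nonzero by simp
qed

text \<open>The ideal \<open>I\<close> has a two-sided unit \<open>z\<close>, and X = z A is a right
  ideal of \<open>A\<close> stable under left multiplication by \<open>B\<close>, with
  \<open>z\<close> as coinvariant left unit. So A g X is a subbicomodule, hence zero or all of
  \<open>C\<close>; the first gives z = 0, the second gives z = 1 by saturation.\<close>

lemma simple_ring_BB: "simple_ring BB"
  unfolding simple_ring_def
proof (intro conjI allI impI ring_BB)
  show "\<one>\<^bsub>BB\<^esub> \<noteq> \<zero>\<^bsub>BB\<^esub>" using one_nonzero by simp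
  fix I assume I: "ideal I BB"
  obtain z where z: "z \<in> I" "\<And>i. i \<in> I \<Longrightarrow> i \<otimes>\<^bsub>A\<^esub> z = i" "\<And>i. i \<in> I \<Longrightarrow> z \<otimes>\<^bsub>A\<^esub> i = i"
    using BB.two_sided_ideal_unit[OF I] by auto
  interpret I: ideal I BB by fact
  have zB: "z \<in> B" using z(1) I.a_subset by auto
  then have zc: "z \<in> carrier A" by (rule B_closed)
  let ?X = "{y \<in> carrier A. z \<otimes>\<^bsub>A\<^esub> y = y}"
  have X: "?X \<subseteq> carrier A" by blast
  have Xr: "y \<otimes>\<^bsub>A\<^esub> a \<in> ?X" if "y \<in> ?X" "a \<in> carrier A" for y a
    using that zc by (simp flip: A.m_assoc)
  have Xb: "b \<otimes>\<^bsub>A\<^esub> y \<in> ?X" if b: "b \<in> B" and y: "y \<in> ?X" for b y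
  proof -
    have bc: "b \<in> carrier A" using b by (rule B_closed)
    have yc: "y \<in> carrier A" "z \<otimes>\<^bsub>A\<^esub> y = y" using y by auto
    \<comment> \<open>Here the ideal is used on both sides: b z lies in \<open>I\<close>, so the
      left unit \<open>z\<close> fixes it, and z b y = z b z y = b z y = b y.\<close>
    have "b \<otimes>\<^bsub>A\<^esub> z \<in> I" using I.I_l_closed[OF z(1), of b] b by simp
    then have bz: "z \<otimes>\<^bsub>A\<^esub> (b \<otimes>\<^bsub>A\<^esub> z) = b \<otimes>\<^bsub>A\<^esub> z" by (rule z(3))
    have "z \<otimes>\<^bsub>A\<^esub> (b \<otimes>\<^bsub>A\<^esub> y) = z \<otimes>\<^bsub>A\<^esub> (b \<otimes>\<^bsub>A\<^esub> (z \<otimes>\<^bsub>A\<^esub> y))" using yc by simp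
    also have "\<dots> = (z \<otimes>\<^bsub>A\<^esub> (b \<otimes>\<^bsub>A\<^esub> z)) \<otimes>\<^bsub>A\<^esub> y" using zc bc yc(1) by (simp add: A.m_assoc)
    also have "\<dots> = b \<otimes>\<^bsub>A\<^esub> (z \<otimes>\<^bsub>A\<^esub> y)" using bz zc bc yc(1) by (simp add: A.m_assoc)
    finally show ?thesis using yc bc by simp
  qed
  have zX: "z \<in> ?X" using z zc by simp
  have "Sub (gspan ?X)" by (rule gspan_Sub[OF X])
  moreover have "right_subcomodule A C C \<Delta> (gspan ?X)"
  proof (rule gspan_right_subcomodule[OF X _ zX zB])
    show "z \<otimes>\<^bsub>A\<^esub> x = x" if "x \<in> ?X" for x using that by simp
  qed (rule Xr)
  ultimately have "gspan ?X = {\<zero>} \<or> gspan ?X = carrier C"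
    using simple_semisimple unfolding simple_semisimple_coring_def by blast
  then show "I = {\<zero>\<^bsub>BB\<^esub>} \<or> I = carrier BB"
  proof
    assume 0: "gspan ?X = {\<zero>}"
    have "elt \<one>\<^bsub>A\<^esub> z \<in> gspan ?X" using zX by (intro gspan.elt) auto
    then have "z = \<zero>\<^bsub>A\<^esub>" using 0 g_zero[OF zc] zc by (simp add: elt_one_left)
    have i0: "i = \<zero>\<^bsub>A\<^esub>" if i: "i \<in> I" for i
    proof -
      have "i \<in> carrier A" using i I.a_subset B_closed by auto
      then show ?thesis using z(3)[OF i] \<open>z = \<zero>\<^bsub>A\<^esub>\<close> by simp
    qed
    have "\<zero>\<^bsub>A\<^esub> \<in> I" using I.zero_closed by simp
    then have "I = {\<zero>\<^bsub>A\<^esub>}" using i0 by blast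
    then show ?thesis by simp
  next
    assume C: "gspan ?X = carrier C"
    have "\<one>\<^bsub>A\<^esub> \<in> ?X"
    proof (rule gspan_saturated[OF X _ _ Xb A.one_closed])
      show "g \<triangleleft> \<one>\<^bsub>A\<^esub> \<in> gspan ?X" using C by (simp add: rsmult_closed)
    qed (use zc in \<open>auto simp: A.r_distr\<close>)
    then have "z = \<one>\<^bsub>A\<^esub>" using zc by simp
    then have "carrier BB \<subseteq> I" using I.I_l_closed[OF z(1)] B_closed by fastforce
    then show ?thesis using I.a_subset by blast
  qed
qed

end

section \<open>The coring of a subring\<close>

lemma left_module_cong:
  assumes "left_module R M" "carrier M' = carrier M" "ring.add M' = ring.add M" "\<zero>\<^bsub>M'\<^esub> = \<zero>\<^bsub>M\<^esub>"
    "smult M' = smult M"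
  shows "left_module R M'"
proof -
  interpret left_module R M by fact
  show ?thesis
    by (intro left_module.intro left_module_axioms.intro R.ring_axioms
        abelian_group_cong[OF M.abelian_group_axioms assms(2-4)])
      (simp_all add: assms(2-) smult_closed smult_l_distr smult_r_distr smult_assoc smult_one)
qed

lemma right_module_cong:
  assumes "right_module R M" "carrier M' = carrier M" "ring.add M' = ring.add M" "\<zero>\<^bsub>M'\<^esub> = \<zero>\<^bsub>M\<^esub>"
    "rsmult M' = rsmult M"
  shows "right_module R M'"
proof -
  interpret right_module R M by fact
  show ?thesis
    by (intro right_module.intro right_module_axioms.intro R.ring_axioms
        abelian_group_cong[OF M.abelian_group_axioms assms(2-4)])
      (simp_all add: assms(2-) rsmult_closed rsmult_l_distr rsmult_r_distr rsmult_assoc rsmult_one)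
qed

lemma bimodule_cong:
  assumes "bimodule K A \<eta> M" "carrier M' = carrier M" "ring.add M' = ring.add M" "\<zero>\<^bsub>M'\<^esub> = \<zero>\<^bsub>M\<^esub>"
    "smult M' = smult M" "rsmult M' = rsmult M"
  shows "bimodule K A \<eta> M'"
proof -
  interpret bimodule K A \<eta> M by fact
  show ?thesis
    by (intro bimodule.intro bimodule_axioms.intro K_algebra_axioms
        left_module_cong[OF left_module_axioms assms(2-5)]
        right_module_cong[OF right_module_axioms assms(2-4,6)])
      (simp_all add: assms(2-) smult_rsmult_assoc scalar_symmetric)
qed

text \<open>The comultiplication of \<open>sweedler_coring\<close> is formed over the bare bimodule,
  while the coring axioms refer to the extended record. A tensor product reads none of the fields in
  which the two differ.\<close>

lemma tens_cong:
  assumes "carrier M' = carrier M" "ring.add M' = ring.add M" "rsmult M' = rsmult M"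
    "carrier N' = carrier N" "ring.add N' = ring.add N" "smult N' = smult N"
  shows "tens R M' N' = tens R M N" "tensor_group R M' N' = tensor_group R M N"
proof -
  have "tensor_relations R M' N' = tensor_relations R M N"
    by (simp add: tensor_relations_def assms)
  then have "tensor_kernel R M' N' = tensor_kernel R M N"
    by (simp add: tensor_kernel_def assms)
  then show "tens R M' N' = tens R M N" "tensor_group R M' N' = tensor_group R M N"
    by (simp_all add: tens_def tensor_group_def assms fun_eq_iff)
qed

context bimodule
begin

interpretation MM: tensor_bimodule A M M A by (rule tensor_bimodule_self)

lemma tensor_bimodule_tensor: "bimodule K A \<eta> (tensor A M M)"
  using structure_hom by (intro MM.tensor_bimodule K_algebra_axioms scalar_symmetric)
    (auto simp: ring_hom_def)

interpretation T: bimodule K A \<eta> "tensor A M M" by (rule tensor_bimodule_tensor)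

interpretation TM: tensor_product A "tensor A M M" M
  by (intro tensor_product.intro T.right_module_axioms left_module_axioms)

interpretation MT: tensor_product A M "tensor A M M"
  by (intro tensor_product.intro T.left_module_axioms right_module_axioms)

text \<open>The definition lifts twice. For fixed right factor the inner lift is a map on the first
  tensor product; balancedness of the outer one in the pair is then verified by comparing additive
  maps on pure tensors.\<close>

lemma tensor_assoc:
  shows "tensor_assoc A M M M \<in> ahom (tensor_group A (tensor A M M) M) (tensor_group A M (tensor A M M))"
    and "\<lbrakk>l \<in> carrier M; m \<in> carrier M; n \<in> carrier M\<rbrakk> \<Longrightarrow>
      tensor_assoc A M M M (tens A (tensor A M M) M (tens A M M l m) n)
        = tens A M (tensor A M M) l (tens A M M m n)"
proof -
  let ?G = "tensor A M (tensor A M M)"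
  have G: "abelian_group ?G" by (rule abelian_group_cong[OF MT.T.abelian_group_axioms]) simp_all
  define inner where "inner n = tensor_lift ?G (\<lambda>l m. MT.ts l (MM.ts m n))" for n
  have bal: "balanced A M M ?G (\<lambda>l m. MT.ts l (MM.ts m n))" if "n \<in> carrier M" for n
    using that
    by (intro balancedI)
      (simp_all add: MT.tens_closed MM.tens_closed MT.tens_add_left MT.tens_add_right[simplified]
        MM.tens_add_left MT.tens_balanced MM.tensor_smult_hom(2) del: tensor_fields(4,5))
  have inner: "inner n \<in> ahom MM.T ?G" "l \<in> carrier M \<Longrightarrow> m \<in> carrier M \<Longrightarrow> inner n (MM.ts l m) = MT.ts l (MM.ts m n)"
    if "n \<in> carrier M" for n l m
    unfolding inner_def using MM.tensor_lift_hom[OF G bal[OF that]] MM.tensor_lift_tens[OF G bal[OF that]] by auto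
  have bal2: "balanced A (tensor A M M) M ?G (\<lambda>t n. inner n t)"
  proof (rule balancedI)
    fix t n assume t: "t \<in> carrier (tensor A M M)" and n: "n \<in> carrier M"
    have t': "t \<in> carrier MM.T" using t by simp
    show "inner n t \<in> carrier ?G" by (rule ahom_closed[OF inner(1)[OF n] t'])
    {
      fix s assume "s \<in> carrier (tensor A M M)"
      then show "inner n (t \<oplus>\<^bsub>tensor A M M\<^esub> s) = inner n t \<oplus>\<^bsub>?G\<^esub> inner n s"
        using ahom_add[OF inner(1)[OF n] t', of s] by simp
    next
      fix n' assume n': "n' \<in> carrier M"
      then have nn': "n \<oplus>\<^bsub>M\<^esub> n' \<in> carrier M" using n by simp
      show "inner (n \<oplus>\<^bsub>M\<^esub> n') t = inner n t \<oplus>\<^bsub>?G\<^esub> inner n' t"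
        by (rule MM.tensor_hom_eqI[OF G inner(1)[OF nn'] ahom_sum[OF G inner(1)[OF n] inner(1)[OF n']] _ t'])
          (use n n' nn' in \<open>simp add: inner MM.tens_add_right MT.tens_add_right[simplified] MM.tens_closed\<close>)
    next
      fix r assume r: "r \<in> carrier A"
      then have rn: "r \<odot>\<^bsub>M\<^esub> n \<in> carrier M" using n by (simp add: smult_closed)
      show "inner n (t \<triangleleft>\<^bsub>tensor A M M\<^esub> r) = inner (r \<odot>\<^bsub>M\<^esub> n) t"
        by (rule MM.tensor_hom_eqI[OF G ahom_comp[OF MM.tensor_rsmult_hom(1)[OF r] inner(1)[OF n]] inner(1)[OF rn] _ t'])
          (use n r rn in \<open>simp add: MM.tensor_rsmult_hom(2) inner rsmult_closed MM.tens_balanced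
             del: tensor_fields(4,5)\<close>)
    }
  qed
  have eq: "tensor_assoc A M M M = tensor_lift ?G (\<lambda>t n. inner n t)"
    by (simp add: tensor_assoc_def inner_def Let_def)
  show "tensor_assoc A M M M \<in> ahom TM.T MT.T"
    using TM.tensor_lift_hom[OF G bal2] by (simp add: eq ahom_def hom_def)
  show "tensor_assoc A M M M (TM.ts (MM.ts l m) n) = MT.ts l (MM.ts m n)"
    if "l \<in> carrier M" "m \<in> carrier M" "n \<in> carrier M"
    using TM.tensor_lift_tens[OF G bal2, of "MM.ts l m" n] inner(2)[OF that(3,1,2)] that
    by (simp add: eq MM.tens_closed)
qed

end

locale sweedler = K_algebra K A \<eta>
  for K :: "('k, 'y) ring_scheme" and A :: "('a, 'z) ring_scheme" (structure) and \<eta> :: "'k \<Rightarrow> 'a" +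
  fixes B :: "'a set"
  assumes subring: "subring B A" and structure_B: "k \<in> carrier K \<Longrightarrow> \<eta> k \<in> B"
begin

abbreviation "AB \<equiv> A\<lparr>carrier := B\<rparr>"
abbreviation "M \<equiv> regular_bimodule A"
abbreviation "SC \<equiv> sweedler_coring A B"
abbreviation "st \<equiv> sweedler_tens A B"

lemma B_closed: "b \<in> B \<Longrightarrow> b \<in> carrier A"
  using subringE(1)[OF subring] by blast

lemma ring_AB: "ring AB" by (rule A.subring_is_ring[OF subring])

lemma AB_left_module: "left_module AB M"
  by (intro left_module.intro left_module_axioms.intro ring_AB A.regular_bimodule_abelian_group)
    (simp_all add: B_closed A.l_distr A.r_distr A.m_assoc)

lemma AB_right_module: "right_module AB M"
  by (intro right_module.intro right_module_axioms.intro ring_AB A.regular_bimodule_abelian_group)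
    (simp_all add: B_closed A.l_distr A.r_distr A.m_assoc)

sublocale S: tensor_bimodule AB M M A
  by (intro tensor_bimodule.intro tensor_product.intro tensor_bimodule_axioms.intro AB_left_module
      AB_right_module A.regular_left_module A.regular_right_module)
    (simp_all add: B_closed A.m_assoc)

lemma structure_closed: "k \<in> carrier K \<Longrightarrow> \<eta> k \<in> carrier A"
  using structure_B B_closed by blast

lemma SC_fields:
  "carrier SC = carrier S.TT" "ring.add SC = ring.add S.TT" "\<zero>\<^bsub>SC\<^esub> = \<zero>\<^bsub>S.TT\<^esub>"
  "smult SC = smult S.TT" "rsmult SC = rsmult S.TT"
  by (simp_all add: sweedler_coring_def sweedler_bimodule_def Let_def bimod.extend_def)

sublocale SC: bimodule K A \<eta> SC
  by (rule bimodule_cong[OF S.tensor_bimodule SC_fields])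
    (simp_all add: K_algebra_axioms structure_B structure_closed structure_central)

sublocale SS: tensor_bimodule A SC SC A by (rule SC.tensor_bimodule_self)

lemma st_def: "st = S.ts" by (simp add: sweedler_tens_def fun_eq_iff)

lemma ahom_SC: "ahom SC = ahom S.T" "ahom G SC = ahom G S.T"
  by (simp_all add: ahom_def hom_def SC_fields fun_eq_iff)

lemma SC_carrier: "carrier SC = carrier S.T" by (simp add: SC_fields)

lemma st_closed [simp]: "a \<in> carrier A \<Longrightarrow> x \<in> carrier A \<Longrightarrow> st a x \<in> carrier SC"
  by (simp add: st_def SC_carrier S.tens_closed)

lemma st_add:
  assumes "a \<in> carrier A" "b \<in> carrier A" "x \<in> carrier A"
  shows "st (a \<oplus> b) x = st a x \<oplus>\<^bsub>SC\<^esub> st b x" "st x (a \<oplus> b) = st x a \<oplus>\<^bsub>SC\<^esub> st x b"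
  using S.tens_add_left[of a b x] S.tens_add_right[of x b a] assms by (simp_all add: st_def SC_fields)

lemma st_balanced:
  "a \<in> carrier A \<Longrightarrow> b \<in> B \<Longrightarrow> x \<in> carrier A \<Longrightarrow> st (a \<otimes> b) x = st a (b \<otimes> x)"
  using S.tens_balanced[of a b x] by (simp add: st_def)

lemma st_smult:
  "b \<in> carrier A \<Longrightarrow> a \<in> carrier A \<Longrightarrow> x \<in> carrier A \<Longrightarrow> b \<odot>\<^bsub>SC\<^esub> st a x = st (b \<otimes> a) x"
  using S.tensor_smult_hom(2)[of b a x] by (simp add: st_def SC_fields(4) del: tensor_fields(4,5))

lemma st_rsmult:
  "b \<in> carrier A \<Longrightarrow> a \<in> carrier A \<Longrightarrow> x \<in> carrier A \<Longrightarrow> st a x \<triangleleft>\<^bsub>SC\<^esub> b = st a (x \<otimes> b)"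
  using S.tensor_rsmult_hom(2)[of b a x] by (simp add: st_def SC_fields(5) del: tensor_fields(4,5))

lemma SC_hom_eqI:
  assumes "abelian_group G" "f \<in> ahom SC G" "h \<in> ahom SC G"
    and "\<And>a x. a \<in> carrier A \<Longrightarrow> x \<in> carrier A \<Longrightarrow> f (st a x) = h (st a x)" "c \<in> carrier SC"
  shows "f c = h c"
  by (rule S.tensor_hom_eqI[OF assms(1)]) (use assms in \<open>simp_all add: ahom_SC st_def SC_carrier\<close>)

lemma SC_lift:
  assumes "abelian_group G" "balanced AB M M G \<beta>"
  shows "tensor_lift G \<beta> \<in> ahom SC G"
    and "a \<in> carrier A \<Longrightarrow> x \<in> carrier A \<Longrightarrow> tensor_lift G \<beta> (st a x) = \<beta> a x"
  using S.tensor_lift_hom[OF assms] S.tensor_lift_tens[OF assms] by (simp_all add: ahom_SC st_def)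

text \<open>Well defined because r in \<open>B\<close> can cross three tensor signs in turn: the
  first one over \<open>B\<close>, the middle one over \<open>A\<close>, the last one over
  \<open>B\<close>.\<close>

lemma SC_comult:
  shows "comult SC \<in> ahom SC SS.T"
    and "a \<in> carrier A \<Longrightarrow> x \<in> carrier A \<Longrightarrow> comult SC (st a x) = SS.ts (st a \<one>) (st \<one> x)"
proof -
  let ?T = "sweedler_bimodule A B"
  have T: "?T = S.TT" by (simp add: sweedler_bimodule_def)
  have ts: "tens A ?T ?T = SS.ts" "tensor_group A ?T ?T = SS.T"
    unfolding T by (rule tens_cong[symmetric]; simp add: SC_fields)+
  let ?G = "tensor A ?T ?T"
  have G: "abelian_group ?G"
    by (rule abelian_group_cong[OF SS.T.abelian_group_axioms]) (simp_all add: ts)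
  have bal: "balanced AB M M ?G (\<lambda>a a'. SS.ts (st a \<one>) (st \<one> a'))"
  proof (rule balancedI)
    fix a r x assume a: "a \<in> carrier M" and r: "r \<in> carrier AB" and x: "x \<in> carrier M"
    then have r': "r \<in> B" "r \<in> carrier A" using B_closed by auto
    have "SS.ts (st (a \<otimes> r) \<one>) (st \<one> x) = SS.ts (st a \<one> \<triangleleft>\<^bsub>SC\<^esub> r) (st \<one> x)"
      using a r' st_balanced[of a r "\<one>"] st_rsmult[of r a "\<one>"] by simp
    also have "\<dots> = SS.ts (st a \<one>) (r \<odot>\<^bsub>SC\<^esub> st \<one> x)"
      using a r' x by (intro SS.tens_balanced) simp_all
    also have "\<dots> = SS.ts (st a \<one>) (st \<one> (r \<otimes> x))"
      using x r' st_balanced[of "\<one>" r x] st_smult[of r "\<one>" x] by simp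
    finally show "SS.ts (st (a \<triangleleft>\<^bsub>M\<^esub> r) \<one>) (st \<one> x) = SS.ts (st a \<one>) (st \<one> (r \<odot>\<^bsub>M\<^esub> x))"
      by simp
  qed (simp_all add: ts st_add SS.tens_add_left SS.tens_add_right SS.tens_closed)
  have "comult SC = tensor_lift ?G (\<lambda>a a'. tens A ?T ?T (st a \<one>) (st \<one> a'))"
    by (simp add: sweedler_coring_def Let_def bimod.extend_def)
  then have eq: "comult SC = tensor_lift ?G (\<lambda>a a'. SS.ts (st a \<one>) (st \<one> a'))"
    by (simp only: ts)
  show "comult SC \<in> ahom SC SS.T"
    using SC_lift(1)[OF G bal] by (simp add: eq ahom_def hom_def ts)
  show "a \<in> carrier A \<Longrightarrow> x \<in> carrier A \<Longrightarrow> comult SC (st a x) = SS.ts (st a \<one>) (st \<one> x)"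
    using SC_lift(2)[OF G bal] by (simp add: eq)
qed

lemma SC_counit:
  shows "counit SC \<in> ahom SC A"
    and "a \<in> carrier A \<Longrightarrow> x \<in> carrier A \<Longrightarrow> counit SC (st a x) = a \<otimes> x"
proof -
  have bal: "balanced AB M M A (monoid.mult A)"
    by (rule balancedI) (simp_all add: A.l_distr A.r_distr A.m_assoc B_closed)
  have eq: "counit SC = tensor_lift A (monoid.mult A)"
    by (simp add: sweedler_coring_def Let_def bimod.extend_def)
  show "counit SC \<in> ahom SC A"
    "a \<in> carrier A \<Longrightarrow> x \<in> carrier A \<Longrightarrow> counit SC (st a x) = a \<otimes> x"
    using SC_lift[OF A.abelian_group_axioms bal] by (simp_all add: eq)
qed

lemma smult_ahom: "a \<in> carrier A \<Longrightarrow> smult SC a \<in> ahom SC SC"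
  by (rule ahomI) (simp_all add: SC.smult_closed SC.smult_r_distr)

lemma rsmult_ahom: "a \<in> carrier A \<Longrightarrow> (\<lambda>c. c \<triangleleft>\<^bsub>SC\<^esub> a) \<in> ahom SC SC"
  by (rule ahomI) (simp_all add: SC.rsmult_closed SC.rsmult_l_distr)

lemma SC_bimodule_homI:
  assumes "left_module A N" "right_module A N" and f: "f \<in> ahom SC N"
    and "\<And>b a x. b \<in> carrier A \<Longrightarrow> a \<in> carrier A \<Longrightarrow> x \<in> carrier A \<Longrightarrow>
      f (st (b \<otimes> a) x) = b \<odot>\<^bsub>N\<^esub> f (st a x)"
    and "\<And>b a x. b \<in> carrier A \<Longrightarrow> a \<in> carrier A \<Longrightarrow> x \<in> carrier A \<Longrightarrow>
      f (st a (x \<otimes> b)) = f (st a x) \<triangleleft>\<^bsub>N\<^esub> b"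
  shows "f \<in> bimodule_hom A SC N"
proof -
  interpret N: left_module A N by fact
  interpret N': right_module A N by fact
  have "f (b \<odot>\<^bsub>SC\<^esub> c) = b \<odot>\<^bsub>N\<^esub> f c" if b: "b \<in> carrier A" and c: "c \<in> carrier SC" for b c
  proof (rule SC_hom_eqI[OF N.M.abelian_group_axioms ahom_comp[OF smult_ahom[OF b] f] ahom_comp[OF f] _ c])
    show "smult N b \<in> ahom N N" by (rule ahomI) (simp_all add: b N.smult_closed N.smult_r_distr)
  qed (simp add: b st_smult assms)
  moreover have "f (c \<triangleleft>\<^bsub>SC\<^esub> b) = f c \<triangleleft>\<^bsub>N\<^esub> b" if b: "b \<in> carrier A" and c: "c \<in> carrier SC" for b c
  proof (rule SC_hom_eqI[OF N.M.abelian_group_axioms ahom_comp[OF rsmult_ahom[OF b] f] ahom_comp[OF f] _ c])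
    show "(\<lambda>n. n \<triangleleft>\<^bsub>N\<^esub> b) \<in> ahom N N" by (rule ahomI) (simp_all add: b N'.rsmult_closed N'.rsmult_l_distr)
  qed (simp add: b st_rsmult assms)
  ultimately show ?thesis
    using f by (simp add: bimodule_hom_def left_module_hom_def ahom_def)
qed

text \<open>All maps involved are additive, so each axiom is checked on a \<otimes> x. Both sides of
  coassociativity have the factors a \<otimes> 1, 1 \<otimes> 1 and 1 \<otimes> x; in the counit
  laws the remaining scalar crosses the tensor sign over \<open>A\<close>.\<close>

lemma sweedler_coring: "coring K A \<eta> SC"
proof (intro coring.intro coring_axioms.intro SC.bimodule_axioms)
  note \<Delta> = SC_comult and \<epsilon> = SC_counit
  interpret SSb: bimodule K A \<eta> SS.TT by (rule SC.tensor_bimodule_tensor)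
  have \<Delta>': "comult SC \<in> ahom SC SS.TT" using \<Delta>(1) by (simp add: ahom_def hom_def)
  have \<epsilon>': "counit SC \<in> ahom SC M" using \<epsilon>(1) by (simp add: ahom_def hom_def)
  show \<Delta>_hom: "comult SC \<in> bimodule_hom A SC SS.TT"
    by (rule SC_bimodule_homI[OF SSb.left_module_axioms SSb.right_module_axioms \<Delta>'])
      (simp_all add: \<Delta> SS.tensor_smult_hom(2) SS.tensor_rsmult_hom(2) st_smult st_rsmult
        del: tensor_fields(4,5))
  show \<epsilon>_hom: "counit SC \<in> bimodule_hom A SC M"
    by (rule SC_bimodule_homI[OF A.regular_left_module A.regular_right_module \<epsilon>'])
      (simp_all add: \<epsilon> A.m_assoc)
  have \<Delta>_left: "comult SC \<in> left_module_hom A SC SS.TT"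
    and \<epsilon>_left: "counit SC \<in> left_module_hom A SC M"
    using \<Delta>_hom \<epsilon>_hom by (simp_all add: bimodule_hom_def)
  have \<Delta>_right: "comult SC (p \<triangleleft>\<^bsub>SC\<^esub> r) = comult SC p \<triangleleft>\<^bsub>SS.TT\<^esub> r"
    if "p \<in> carrier SC" "r \<in> carrier A" for p r
    using \<Delta>_hom that unfolding bimodule_hom_def by blast
  have \<epsilon>_right: "counit SC (p \<triangleleft>\<^bsub>SC\<^esub> r) = counit SC p \<triangleleft>\<^bsub>M\<^esub> r"
    if "p \<in> carrier SC" "r \<in> carrier A" for p r
    using \<epsilon>_hom that unfolding bimodule_hom_def by blast
  have id: "id \<in> left_module_hom A SC SC" by (rule left_module_homI) simp_all
  fix c assume c: "c \<in> carrier SC"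
  interpret TM: tensor_product A SS.TT SC
    by (intro tensor_product.intro SSb.right_module_axioms SC.left_module_axioms)
  interpret MT: tensor_product A SC SS.TT
    by (intro tensor_product.intro SSb.left_module_axioms SC.right_module_axioms)
  note f1 = TM.tensor_map_hom[OF SS.tensor_product_axioms \<Delta>' \<Delta>_right id]
    and f1t = TM.tensor_map_tens[OF SS.tensor_product_axioms \<Delta>' \<Delta>_right id]
    and f2 = MT.tensor_map_id(1)[OF SC.left_module_axioms \<Delta>_left]
    and f2t = MT.tensor_map_id(2)[OF SC.left_module_axioms \<Delta>_left]
  show "tensor_assoc A SC SC SC (tensor_map A SS.TT SC (comult SC) id (comult SC c))
      = tensor_map A SC SS.TT id (comult SC) (comult SC c)"
  proof (rule SC_hom_eqI[OF MT.T.abelian_group_axioms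
        ahom_comp[OF ahom_comp[OF \<Delta>(1) f1] SC.tensor_assoc(1)] ahom_comp[OF \<Delta>(1) f2] _ c])
    fix a x assume ax: "a \<in> carrier A" "x \<in> carrier A"
    have "tensor_map A SS.TT SC (comult SC) id (comult SC (st a x))
        = TM.ts (SS.ts (st a \<one>) (st \<one> \<one>)) (st \<one> x)"
      using ax f1t[of "st a \<one>" "st \<one> x"] by (simp add: \<Delta>(2))
    moreover have "tensor_map A SC SS.TT id (comult SC) (comult SC (st a x))
        = MT.ts (st a \<one>) (SS.ts (st \<one> \<one>) (st \<one> x))"
      using ax f2t[of "st a \<one>" "st \<one> x"] by (simp add: \<Delta>(2))
    ultimately show "tensor_assoc A SC SC SC (tensor_map A SS.TT SC (comult SC) id (comult SC (st a x)))
      = tensor_map A SC SS.TT id (comult SC) (comult SC (st a x))"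
      using ax SC.tensor_assoc(2)[of "st a \<one>" "st \<one> \<one>" "st \<one> x"] by simp
  qed
  interpret EL: tensor_product A M SC
    by (intro tensor_product.intro A.regular_right_module SC.left_module_axioms)
  interpret ER: tensor_product A SC M
    by (intro tensor_product.intro A.regular_left_module SC.right_module_axioms)
  note l = EL.tensor_map_hom[OF SS.tensor_product_axioms \<epsilon>' \<epsilon>_right id]
    and lt = EL.tensor_map_tens[OF SS.tensor_product_axioms \<epsilon>' \<epsilon>_right id]
    and r = ER.tensor_map_id(1)[OF SC.left_module_axioms \<epsilon>_left]
    and rt = ER.tensor_map_id(2)[OF SC.left_module_axioms \<epsilon>_left]
  have EL1: "EL.ts \<one> \<in> ahom SC EL.T"
    by (rule ahomI) (simp_all add: EL.tens_closed EL.tens_add_right)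
  have ER1: "(\<lambda>c. ER.ts c \<one>) \<in> ahom SC ER.T"
    by (rule ahomI) (simp_all add: ER.tens_closed ER.tens_add_left)
  show "tensor_map A M SC (counit SC) id (comult SC c) = EL.ts \<one> c"
  proof (rule SC_hom_eqI[OF EL.T.abelian_group_axioms ahom_comp[OF \<Delta>(1) l] EL1 _ c])
    fix a x assume ax: "a \<in> carrier A" "x \<in> carrier A"
    have "tensor_map A M SC (counit SC) id (comult SC (st a x)) = EL.ts a (st \<one> x)"
      using ax lt[of "st a \<one>" "st \<one> x"] by (simp add: \<Delta>(2) \<epsilon>(2))
    also have "\<dots> = EL.ts \<one> (st a x)"
      using EL.tens_balanced[of "\<one>" a "st \<one> x"] ax by (simp add: st_smult)
    finally show "tensor_map A M SC (counit SC) id (comult SC (st a x)) = EL.ts \<one> (st a x)" .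
  qed
  show "tensor_map A SC M id (counit SC) (comult SC c) = ER.ts c \<one>"
  proof (rule SC_hom_eqI[OF ER.T.abelian_group_axioms ahom_comp[OF \<Delta>(1) r] ER1 _ c])
    fix a x assume ax: "a \<in> carrier A" "x \<in> carrier A"
    have "tensor_map A SC M id (counit SC) (comult SC (st a x)) = ER.ts (st a \<one>) x"
      using ax rt[of "st a \<one>" "st \<one> x"] by (simp add: \<Delta>(2) \<epsilon>(2))
    also have "\<dots> = ER.ts (st a x) \<one>"
      using ER.tens_balanced[of "st a \<one>" x "\<one>"] ax by (simp add: st_rsmult)
    finally show "tensor_map A SC M id (counit SC) (comult SC (st a x)) = ER.ts (st a x) \<one>" .
  qed
qed

end

section \<open>The canonical map\<close>

context simple_semisimple_grouplike
begin

text \<open>The two actions of \<open>K\<close> on \<open>C\<close> agree, in particular at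
  \<open>g\<close>.\<close>

lemma structure_B: "k \<in> carrier K \<Longrightarrow> \<eta> k \<in> B"
  using scalar_symmetric[of k g] structure_hom by (auto simp: B_iff ring_hom_def)

sublocale SW: sweedler K A \<eta> B
  by (intro sweedler.intro sweedler_axioms.intro K_algebra_axioms subring_B structure_B)

abbreviation "\<theta> \<equiv> canonical_map C g"

lemma canonical_map:
  shows "\<theta> \<in> ahom SW.SC C"
    and "a \<in> carrier A \<Longrightarrow> x \<in> carrier A \<Longrightarrow> \<theta> (SW.st a x) = elt a x"
proof -
  have eq: "\<theta> = tensor_lift C elt"
    unfolding canonical_map_def by (intro arg_cong[where f = "tensor_lift C"]) (simp add: elt_def fun_eq_iff)
  have bal: "balanced BB SW.M SW.M C elt"
    by (rule balancedI) (simp_all add: elt_add_left elt_add_right elt_coinvariant)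
  show "\<theta> \<in> ahom SW.SC C" "a \<in> carrier A \<Longrightarrow> x \<in> carrier A \<Longrightarrow> \<theta> (SW.st a x) = elt a x"
    unfolding eq using SW.SC_lift[OF M.abelian_group_axioms bal] by auto
qed

lemma canonical_map_bimodule_hom: "\<theta> \<in> bimodule_hom A SW.SC C"
  by (rule SW.SC_bimodule_homI[OF left_module_axioms right_module_axioms canonical_map(1)])
    (simp_all add: canonical_map(2) elt_smult elt_rsmult)

text \<open>\<open>partial_section\<close> serves only finitely many right factors at a time. A
  given tensor involves only finitely many, and any additive map that is correct on those recovers
  the tensor from its image.\<close>

lemma canonical_map_section:
  assumes "t \<in> carrier SW.SC"
  shows "\<exists>xs. set xs \<subseteq> carrier A \<and> (\<forall>s\<in>ahom C SW.SC.
    (\<forall>a\<in>carrier A. \<forall>x\<in>set xs. s (elt a x) = SW.st a x) \<longrightarrow> s (\<theta> t) = t)"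
proof -
  have "t \<in> carrier SW.S.T" using assms by (simp add: SW.SC_carrier)
  then show ?thesis
  proof (induction t rule: SW.S.tensor_induct)
    case zero
    have "s (\<theta> \<zero>\<^bsub>SW.SC\<^esub>) = \<zero>\<^bsub>SW.SC\<^esub>" if "s \<in> ahom C SW.SC" for s
      using ahom_zero[OF SW.SC.M.abelian_group_axioms SW.SC.M.abelian_group_axioms
          ahom_comp[OF canonical_map(1) that]] .
    then show ?case by (intro exI[where x = "[]"]) (simp add: SW.SC_fields)
  next
    case (tens a x)
    then have "SW.S.ts a x = SW.st a x" "a \<in> carrier A" "x \<in> carrier A" by (simp_all add: SW.st_def)
    then show ?case by (intro exI[where x = "[x]"]) (simp add: canonical_map(2))
  next
    case (add t u)
    obtain xs where xs: "set xs \<subseteq> carrier A" "\<forall>s\<in>ahom C SW.SC.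
        (\<forall>a\<in>carrier A. \<forall>x\<in>set xs. s (elt a x) = SW.st a x) \<longrightarrow> s (\<theta> t) = t"
      using add.IH(1) by (elim exE conjE)
    obtain ys where ys: "set ys \<subseteq> carrier A" "\<forall>s\<in>ahom C SW.SC.
        (\<forall>a\<in>carrier A. \<forall>x\<in>set ys. s (elt a x) = SW.st a x) \<longrightarrow> s (\<theta> u) = u"
      using add.IH(2) by (elim exE conjE)
    have tu: "t \<in> carrier SW.SC" "u \<in> carrier SW.SC" "t \<oplus>\<^bsub>SW.S.T\<^esub> u = t \<oplus>\<^bsub>SW.SC\<^esub> u"
      using add by (simp_all add: SW.SC_fields)
    have "s (\<theta> (t \<oplus>\<^bsub>SW.SC\<^esub> u)) = t \<oplus>\<^bsub>SW.SC\<^esub> u"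
      if s: "s \<in> ahom C SW.SC" "\<forall>a\<in>carrier A. \<forall>x\<in>set (xs @ ys). s (elt a x) = SW.st a x" for s
    proof -
      have "s (\<theta> t) = t" "s (\<theta> u) = u"
        using bspec[OF xs(2) s(1)] bspec[OF ys(2) s(1)] s(2) by simp_all
      then show ?thesis
        using ahom_add[OF ahom_comp[OF canonical_map(1) s(1)] tu(1,2)] by simp
    qed
    then show ?case unfolding tu(3) using xs(1) ys(1) by (intro exI[where x = "xs @ ys"]) simp
  qed
qed

lemma canonical_map_bij: "bij_betw \<theta> (carrier SW.SC) (carrier C)"
  unfolding bij_betw_def
proof
  have zero: "t = \<zero>\<^bsub>SW.SC\<^esub>" if t: "t \<in> carrier SW.SC" "\<theta> t = \<zero>" for t
  proof -
    obtain xs where xs: "set xs \<subseteq> carrier A" "\<forall>s\<in>ahom C SW.SC.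
        (\<forall>a\<in>carrier A. \<forall>x\<in>set xs. s (elt a x) = SW.st a x) \<longrightarrow> s (\<theta> t) = t"
      using canonical_map_section[OF t(1)] by blast
    have l: "SW.st a \<in> ahom A SW.SC" if "a \<in> carrier A" for a
      by (rule ahomI) (simp_all add: that SW.st_add)
    have r: "(\<lambda>a. SW.st a x) \<in> ahom A SW.SC" if "x \<in> carrier A" for x
      by (rule ahomI) (simp_all add: that SW.st_add)
    obtain s where s: "s \<in> ahom C SW.SC" "\<forall>a\<in>carrier A. \<forall>y\<in>carrier A.
        g \<triangleleft> y \<in> gspan (set xs) \<longrightarrow> s (elt a y) = SW.st a y"
      using partial_section[OF SW.SC.M.abelian_group_axioms l r SW.st_balanced xs(1)] by blast
    have "g \<triangleleft> x \<in> gspan (set xs)" if "x \<in> set xs" for x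
      using gspan.elt[OF A.one_closed that] xs(1) that elt_one_left by (metis subsetD)
    then have "\<forall>a\<in>carrier A. \<forall>x\<in>set xs. s (elt a x) = SW.st a x"
      using s(2) xs(1) by blast
    then have "t = s \<zero>" using xs(2) s(1) t(2) by metis
    then show ?thesis
      using ahom_zero[OF M.abelian_group_axioms SW.SC.M.abelian_group_axioms s(1)] by simp
  qed
  show "inj_on \<theta> (carrier SW.SC)"
  proof (rule inj_onI)
    fix t u assume tu: "t \<in> carrier SW.SC" "u \<in> carrier SW.SC" "\<theta> t = \<theta> u"
    have "\<theta> (t \<ominus>\<^bsub>SW.SC\<^esub> u) = \<theta> t \<ominus> \<theta> u"
      by (rule ahom_minus[OF SW.SC.M.abelian_group_axioms M.abelian_group_axioms canonical_map(1) tu(1,2)])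
    also have "\<dots> = \<zero>" using tu ahom_closed[OF canonical_map(1)] by (simp add: M.minus_eq_zero_iff)
    finally have "t \<ominus>\<^bsub>SW.SC\<^esub> u = \<zero>\<^bsub>SW.SC\<^esub>" using zero tu by simp
    then show "t = u" using SW.SC.M.minus_eq_zero_iff tu by simp
  qed
  show "\<theta> ` carrier SW.SC = carrier C"
  proof
    show "\<theta> ` carrier SW.SC \<subseteq> carrier C" using ahom_closed[OF canonical_map(1)] by blast
    show "carrier C \<subseteq> \<theta> ` carrier SW.SC"
    proof
      fix c assume "c \<in> carrier C"
      then show "c \<in> \<theta> ` carrier SW.SC"
      proof (induction c rule: elt_induct)
        case zero
        show ?case
          using ahom_zero[OF SW.SC.M.abelian_group_axioms M.abelian_group_axioms canonical_map(1)]
            SW.SC.M.zero_closed by (metis imageI)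
      next
        case (elt a x)
        then show ?case using canonical_map(2) SW.st_closed by (metis imageI)
      next
        case (add c d)
        then obtain t u where "t \<in> carrier SW.SC" "u \<in> carrier SW.SC" "c = \<theta> t" "d = \<theta> u" by blast
        then show ?case
          using ahom_add[OF canonical_map(1), of t u] SW.SC.M.a_closed[of t u] by (metis imageI)
      qed
    qed
  qed
qed

lemma canonical_map_coring_iso: "coring_iso K A \<eta> SW.SC C \<theta>"
  unfolding coring_iso_def
proof (intro conjI ballI SW.sweedler_coring coring_axioms canonical_map_bimodule_hom canonical_map_bij)
  fix t assume t: "t \<in> carrier SW.SC"
  have hl: "\<theta> \<in> left_module_hom A SW.SC C"
    using canonical_map_bimodule_hom by (simp add: bimodule_hom_def)
  have hr: "\<theta> (c \<triangleleft>\<^bsub>SW.SC\<^esub> r) = \<theta> c \<triangleleft> r" if "c \<in> carrier SW.SC" "r \<in> carrier A" for c r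
    using canonical_map_bimodule_hom that unfolding bimodule_hom_def by blast
  note m = CC.tensor_map_hom[OF SW.SS.tensor_product_axioms canonical_map(1) hr hl]
    and mt = CC.tensor_map_tens[OF SW.SS.tensor_product_axioms canonical_map(1) hr hl]
  show "\<Delta> (\<theta> t) = tensor_map A C C \<theta> \<theta> (comult SW.SC t)"
  proof (rule SW.SC_hom_eqI[OF CC.T.abelian_group_axioms ahom_comp[OF canonical_map(1) comult_ahom]
        ahom_comp[OF SW.SC_comult(1) m] _ t])
    fix a x assume ax: "a \<in> carrier A" "x \<in> carrier A"
    then show "\<Delta> (\<theta> (SW.st a x)) = tensor_map A C C \<theta> \<theta> (comult SW.SC (SW.st a x))"
      using mt[of "SW.st a \<one>\<^bsub>A\<^esub>" "SW.st \<one>\<^bsub>A\<^esub> x"]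
      by (simp add: canonical_map(2) SW.SC_comult(2) comult_elt elt_one_left elt_one_right)
  qed
  show "\<epsilon> (\<theta> t) = counit SW.SC t"
    by (rule SW.SC_hom_eqI[OF A.abelian_group_axioms ahom_comp[OF canonical_map(1) counit_ahom]
          SW.SC_counit(1) _ t])
      (simp add: canonical_map(2) SW.SC_counit(2) counit_elt)
qed

lemma K_algebra_BB: "K_algebra K BB \<eta>"
proof (intro K_algebra.intro K_algebra_axioms.intro K.cring_axioms ring_BB)
  show "\<eta> \<in> ring_hom K BB" using structure_hom structure_B by (auto simp: ring_hom_def)
  show "\<eta> k \<otimes>\<^bsub>BB\<^esub> b = b \<otimes>\<^bsub>BB\<^esub> \<eta> k" if "k \<in> carrier K" "b \<in> carrier BB" for k b
    using structure_central[of k b] that B_closed by simp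
qed

end

theorem theorem4p3:
  fixes K :: "('k, 'y) ring_scheme" and A :: "('a, 'z) ring_scheme" and \<eta> :: "'k \<Rightarrow> 'a"
    and C :: "('a, 'c, 'x) coring_struct_scheme" and g :: 'c
  assumes "K_algebra K A \<eta>"
    and "coring K A \<eta> C"
    and "grouplike A C g"
    and "simple_semisimple_coring K A \<eta> C"
  shows "K_algebra K (A\<lparr>carrier := coinvariants A C g\<rparr>) \<eta>
    \<and> simple_ring (A\<lparr>carrier := coinvariants A C g\<rparr>)
    \<and> artinian_ring (A\<lparr>carrier := coinvariants A C g\<rparr>)
    \<and> canonical_map C g (sweedler_tens A (coinvariants A C g) \<one>\<^bsub>A\<^esub> \<one>\<^bsub>A\<^esub>) = g
    \<and> coring_iso K A \<eta> (sweedler_coring A (coinvariants A C g)) C (canonical_map C g)"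
proof -
  interpret simple_semisimple_grouplike K A \<eta> C g
    using assms by (intro simple_semisimple_grouplike.intro simple_semisimple_grouplike_axioms.intro)
  have "\<theta> (SW.st \<one>\<^bsub>A\<^esub> \<one>\<^bsub>A\<^esub>) = g"
    by (simp add: canonical_map(2) elt_one_right smult_one)
  then show ?thesis
    using K_algebra_BB simple_ring_BB BB.artinian_ring canonical_map_coring_iso by blast
qed

end
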